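(* Let $h_0>0$ be such that there is a constant $C_0>0$ with $\|\hat q_h\|_{BV(\Omega)}\le C_0$ for every $h\in(0,h_0]$ and every optimal control $\hat q_h$ of (P$_{\rm cd}$). Then there is a constant $C>0$ independent of $h$ such that for any $h\in(0,h_0]$ the optimal state $\hat u_h$ associated with the optimal control $\hat q_h$ of (P$_{\rm cd}$) satisfies $$\|\hat u_h-\bar u\|_{L^2(\Omega)}\le Ch .$$
   Context: Continuous problem (P). Let $\Omega=(0,1)$, $V=H^1_0(\Omega)$, and let $Q=BV(\Omega)$ be the space of all $q\in L^1(\Omega)$ whose distributional derivative $q'$ is a finite signed Radon measure on $\Omega$, normed by $\|q\|_{BV(\Omega)}=\|q\|_{L^1(\Omega)}+\|q'\|_{\mathcal M(\Omega)}$, where $\|\cdot\|_{\mathcal M(\Omega)}$ is the total variation norm on the space $\mathcal M(\Omega)$ of finite signed Radon measures on $\Omega$. Fix $\alpha>0$, $u_d\in L^\infty(\Omega)$, $a\in C^{0,1}(\bar\Omega)$ with $a(x)\ge\nu>0$ on $\bar\Omega$, and $d_0\in L^\infty(\Omega)$ with $d_0\ge 0$ a.e. Let $\mathfrak a(v,w)=(av',w')_{L^2(\Omega)}+(d_0v,w)_{L^2(\Omega)}$ for $v,w\in V$. For $q\in Q$ let $Sq\in V$ be the unique solution of $\mathfrak a(Sq,w)=(q,w)_{L^2(\Omega)}$ for all $w\in V$. Problem (P) is $\min_{q\in Q}j(q)$ with $j(q)=\frac12\|Sq-u_d\|_{L^2(\Omega)}^2+\alpha\|q'\|_{\mathcal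 M(\Omega)}$. It has a unique solution $\bar q$, and $\bar u=S\bar q$ is the optimal state. Piecewise constant control discretization (P$_{\rm cd}$). Take a partition $0=x_0<x_1<\dots<x_l=1$, $l>1$, with mesh width $h=\max_i (x_i-x_{i-1})$. Let $V_h\subset V$ be the space of continuous functions on $[0,1]$ that vanish at $0$ and $1$ and are affine on each $(x_{i-1},x_i)$, and let $Q_h\subset BV(\Omega)$ be the space of functions that are constant on each $(x_{i-1},x_i)$. For $q\in Q$ let $S_hq\in V_h$ be the unique solution of $\mathfrak a(S_hq,w_h)=(q,w_h)_{L^2(\Omega)}$ for all $w_h\in V_h$. Problem (P$_{\rm cd}$) is $\min_{q_h\in Q_h}j_h(q_h)$ with $j_h(q_h)=\frac12\|S_hq_h-u_d\|_{L^2(\Omega)}^2+\alpha\|q_h'\|_{\mathcal M(\Omega)}$. $\hat q_h\in Q_h$ denotes an optimal control and $\hat u_h=S_h\hat q_h$ the optimal state. "For any $h\in(0,h_0]$" means for all partitions with mesh width $h\le h_0$; the constants do not depend on the partition. *)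

theory Defs
  imports "HOL-Analysis.Analysis" "HOL-Library.Disjoint_Sets"
begin

(* Function spaces on the interval (0,1) consist of representatives "real => real":
   values outside (0,1) are irrelevant, and elements that agree almost everywhere on (0,1)
   denote the same element of the space. *)

definition Omega :: "real set" where
  "Omega = {0<..<1}"

abbreviation leb :: "real measure" where
  "leb \<equiv> lebesgue_on Omega"


subsection \<open>Lebesgue spaces\<close>

definition L1_space :: "(real \<Rightarrow> real) set" where
  "L1_space = {f. integrable leb f}"

definition L2_space :: "(real \<Rightarrow> real) set" where
  "L2_space = {f \<in> borel_measurable leb. integrable leb (\<lambda>t. (f t)\<^sup>2)}"

definition Linf_space :: "(real \<Rightarrow> real) set" where
  "Linf_space = {f \<in> borel_measurable leb. \<exists>M. AE t in leb. \<bar>f t\<bar> \<le> M}"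

definition L1_norm :: "(real \<Rightarrow> real) \<Rightarrow> real" where
  "L1_norm f = (LINT t|leb. \<bar>f t\<bar>)"

definition L2_inner :: "(real \<Rightarrow> real) \<Rightarrow> (real \<Rightarrow> real) \<Rightarrow> real" where
  "L2_inner f g = (LINT t|leb. f t * g t)"

definition L2_norm :: "(real \<Rightarrow> real) \<Rightarrow> real" where
  "L2_norm f = sqrt (L2_inner f f)"


subsection \<open>Test functions and the Sobolev space with zero boundary values\<close>

(* C_c^infinity(0,1), each function being extended by zero to the real line. *)
definition test_functions :: "(real \<Rightarrow> real) set" where
  "test_functions = {\<phi>. (\<forall>n t. ((deriv ^^ n) \<phi>) differentiable (at t)) \<and>
     (\<exists>K. compact K \<and> K \<subseteq> Omega \<and> (\<forall>t. t \<notin> K \<longrightarrow> \<phi> t = 0))}"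

definition has_weak_deriv :: "(real \<Rightarrow> real) \<Rightarrow> (real \<Rightarrow> real) \<Rightarrow> bool" where
  "has_weak_deriv v g \<longleftrightarrow>
     (\<forall>\<phi>\<in>test_functions. L2_inner v (deriv \<phi>) = - L2_inner g \<phi>)"

definition H1_space :: "(real \<Rightarrow> real) set" where
  "H1_space = {v \<in> L2_space. \<exists>g\<in>L2_space. has_weak_deriv v g}"

(* Unique up to null sets for v in H^1(0,1); unspecified for other v. *)
definition weak_deriv :: "(real \<Rightarrow> real) \<Rightarrow> real \<Rightarrow> real" where
  "weak_deriv v = (SOME g. g \<in> L2_space \<and> has_weak_deriv v g)"

definition H1_norm :: "(real \<Rightarrow> real) \<Rightarrow> real" where
  "H1_norm v = sqrt ((L2_norm v)\<^sup>2 + (L2_norm (weak_deriv v))\<^sup>2)"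

(* H^1_0(0,1): the closure of the test functions in H^1(0,1). *)
definition H10_space :: "(real \<Rightarrow> real) set" where
  "H10_space = {v \<in> H1_space.
     \<forall>\<epsilon>>0. \<exists>\<phi>\<in>test_functions. H1_norm (\<lambda>t. v t - \<phi> t) < \<epsilon>}"


subsection \<open>Finite signed Radon measures and functions of bounded variation\<close>

(* Every finite signed Borel measure on (0,1) is a Radon measure, so no regularity condition
   is needed.  Finiteness is built in since the values are real; only the values on the
   Borel subsets of (0,1) matter. *)
definition signed_measure :: "(real set \<Rightarrow> real) \<Rightarrow> bool" where
  "signed_measure \<mu> \<longleftrightarrow>
     (\<forall>A :: nat \<Rightarrow> real set. range A \<subseteq> sets (restrict_space borel Omega) \<longrightarrow>
        disjoint_family A \<longrightarrow> (\<lambda>n. \<mu> (A n)) sums \<mu> (\<Union>n. A n))"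

(* The total variation |mu|(Omega); the supremum of a bounded set, since a signed measure with
   real values has finite total variation. *)
definition total_variation :: "(real set \<Rightarrow> real) \<Rightarrow> real" where
  "total_variation \<mu> =
     (SUP P \<in> {P. finite P \<and> P \<subseteq> sets (restrict_space borel Omega) \<and> partition_on Omega P}.
        \<Sum>E\<in>P. \<bar>\<mu> E\<bar>)"

(* The integral of f with respect to mu, computed from a decomposition of mu into a difference
   of two finite positive measures, e.g. the Jordan decomposition.  The value does not depend
   on the decomposition. *)
definition has_signed_integral :: "(real set \<Rightarrow> real) \<Rightarrow> (real \<Rightarrow> real) \<Rightarrow> real \<Rightarrow> bool" where
  "has_signed_integral \<mu> f I \<longleftrightarrow>
     (\<exists>M N. finite_measure M \<and> finite_measure N \<and>
        sets M = sets (restrict_space borel Omega) \<and>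
        sets N = sets (restrict_space borel Omega) \<and>
        (\<forall>A \<in> sets (restrict_space borel Omega). \<mu> A = measure M A - measure N A) \<and>
        integrable M f \<and> integrable N f \<and>
        I = integral\<^sup>L M f - integral\<^sup>L N f)"

definition has_measure_deriv :: "(real \<Rightarrow> real) \<Rightarrow> (real set \<Rightarrow> real) \<Rightarrow> bool" where
  "has_measure_deriv q \<mu> \<longleftrightarrow> signed_measure \<mu> \<and>
     (\<forall>\<phi>\<in>test_functions. has_signed_integral \<mu> \<phi> (- (LINT t|leb. q t * deriv \<phi> t)))"

definition BV_space :: "(real \<Rightarrow> real) set" where
  "BV_space = {q \<in> L1_space. \<exists>\<mu>. has_measure_deriv q \<mu>}"

(* Determined on the Borel subsets of (0,1) for q in BV(0,1); unspecified for other q. *)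
definition measure_deriv :: "(real \<Rightarrow> real) \<Rightarrow> real set \<Rightarrow> real" where
  "measure_deriv q = (SOME \<mu>. has_measure_deriv q \<mu>)"

definition BV_seminorm :: "(real \<Rightarrow> real) \<Rightarrow> real" where
  "BV_seminorm q = total_variation (measure_deriv q)"

definition BV_norm :: "(real \<Rightarrow> real) \<Rightarrow> real" where
  "BV_norm q = L1_norm q + BV_seminorm q"


subsection \<open>State equation and optimal control problem\<close>

definition state_form ::
  "(real \<Rightarrow> real) \<Rightarrow> (real \<Rightarrow> real) \<Rightarrow> (real \<Rightarrow> real) \<Rightarrow> (real \<Rightarrow> real) \<Rightarrow> real" where
  "state_form a d0 v w =
     L2_inner (\<lambda>t. a t * weak_deriv v t) (weak_deriv w) + L2_inner (\<lambda>t. d0 t * v t) w"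

definition is_state ::
  "(real \<Rightarrow> real) \<Rightarrow> (real \<Rightarrow> real) \<Rightarrow> (real \<Rightarrow> real) set \<Rightarrow> (real \<Rightarrow> real) \<Rightarrow> (real \<Rightarrow> real) \<Rightarrow> bool"
where
  "is_state a d0 W q u \<longleftrightarrow> u \<in> W \<and> (\<forall>w\<in>W. state_form a d0 u w = L2_inner q w)"

(* The solution operator for trial and test space W; the solution is unique as an element of
   the space, hence the choice operator only selects a representative. *)
definition sol_op ::
  "(real \<Rightarrow> real) \<Rightarrow> (real \<Rightarrow> real) \<Rightarrow> (real \<Rightarrow> real) set \<Rightarrow> (real \<Rightarrow> real) \<Rightarrow> real \<Rightarrow> real" where
  "sol_op a d0 W q = (SOME u. is_state a d0 W q u)"

definition objective ::
  "(real \<Rightarrow> real) \<Rightarrow> (real \<Rightarrow> real) \<Rightarrow> (real \<Rightarrow> real) \<Rightarrow> real \<Rightarrow> (real \<Rightarrow> real) set \<Rightarrow>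
   (real \<Rightarrow> real) \<Rightarrow> real" where
  "objective a d0 ud \<alpha> W q =
     1 / 2 * (L2_norm (\<lambda>t. sol_op a d0 W q t - ud t))\<^sup>2 + \<alpha> * BV_seminorm q"

(* W is the state space and U the control space: (P) is the case W = H10_space, U = BV_space. *)
definition optimal_control ::
  "(real \<Rightarrow> real) \<Rightarrow> (real \<Rightarrow> real) \<Rightarrow> (real \<Rightarrow> real) \<Rightarrow> real \<Rightarrow> (real \<Rightarrow> real) set \<Rightarrow>
   (real \<Rightarrow> real) set \<Rightarrow> (real \<Rightarrow> real) \<Rightarrow> bool" where
  "optimal_control a d0 ud \<alpha> W U q \<longleftrightarrow>
     q \<in> U \<and> (\<forall>p\<in>U. objective a d0 ud \<alpha> W q \<le> objective a d0 ud \<alpha> W p)"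


subsection \<open>Discretization\<close>

definition is_partition :: "nat \<Rightarrow> (nat \<Rightarrow> real) \<Rightarrow> bool" where
  "is_partition l x \<longleftrightarrow>
     l > 1 \<and> x 0 = 0 \<and> x l = 1 \<and> (\<forall>i\<in>{1..l}. x (i - 1) < x i)"

definition mesh_width :: "nat \<Rightarrow> (nat \<Rightarrow> real) \<Rightarrow> real" where
  "mesh_width l x = Max ((\<lambda>i. x i - x (i - 1)) ` {1..l})"

definition V_h :: "nat \<Rightarrow> (nat \<Rightarrow> real) \<Rightarrow> (real \<Rightarrow> real) set" where
  "V_h l x = {v. continuous_on {0..1} v \<and> v 0 = 0 \<and> v 1 = 0 \<and>
     (\<forall>i\<in>{1..l}. \<exists>c d. \<forall>t\<in>{x (i - 1)<..<x i}. v t = c + d * t)}"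

definition Q_h :: "nat \<Rightarrow> (nat \<Rightarrow> real) \<Rightarrow> (real \<Rightarrow> real) set" where
  "Q_h l x = {q. \<forall>i\<in>{1..l}. \<exists>c. \<forall>t\<in>{x (i - 1)<..<x i}. q t = c}"

end

theory Submission
  imports Defs
begin

text \<open>Write \<open>S\<close> and \<open>S\<^sub>h\<close> for the two solution operators, \<open>q\<close> and \<open>p\<close> for the continuous and the discrete
  optimal control, \<open>u = S q\<close> and \<open>v = S\<^sub>h p\<close> for the optimal states, and let \<open>\<pi>\<close> be the piecewise constant
  function of the cell averages of \<open>q\<close>.  Both objectives are convex, so each optimal control satisfies a
  variational inequality (\<open>variational_inequality\<close>).  The one of the continuous problem is tested with
  \<open>p\<close>, the one of the discrete problem with \<open>\<pi>\<close>, and they are added.  The variations cancel in the right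
  direction because averaging does not increase the variation (\<open>average_variation\<close>), and what is left is
  \<open>\<parallel>v - u\<parallel>\<^sup>2 \<le> (u - u\<^sub>d, S p - S\<^sub>h p) + (v - u\<^sub>d, S\<^sub>h \<pi> - S \<pi>) + (v - u\<^sub>d, S \<pi> - S q)\<close>.

  Each of the three terms is of second order.  The first two pair a bounded function with a finite
  element error; by Galerkin orthogonality such a pairing is an energy product of two finite element
  errors, each of first order (\<open>galerkin_pairing\<close>).  The third equals \<open>(z, \<pi> - q)\<close> with the Lipschitz
  continuous function \<open>z = S (v - u\<^sub>d)\<close>; as \<open>\<pi> - q\<close> has mean zero on each cell, \<open>z\<close> may be replaced by
  its deviation from a nodal value, which is of first order, while the \<open>L\<^sup>1\<close> norm of \<open>\<pi> - q\<close> is of first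
  order because \<open>q\<close> has bounded variation (\<open>average_pairing\<close>).  Taking the square root yields the
  linear rate (\<open>optimal_state_error\<close>).

  All controls and adjoint right-hand sides that occur are essentially bounded, uniformly in the
  partition, since functions of bounded variation are (\<open>BV_ess_bounded\<close>).  For bounded data the state
  equation can be solved by integrating twice and shooting (\<open>state_exists_regular\<close>), and the derivative of
  the solution is Lipschitz continuous, so interpolation is accurate to first order in energy.

  The remaining parts connect these arguments with the definitions of the function spaces: test
  functions approximate bounded measurable functions (\<open>bounded_measurable_test_approx\<close>), which gives
  uniqueness of weak derivatives and a supply of members of \<open>H10_space\<close> (\<open>prim_H10\<close>), and functions of
  bounded variation are almost everywhere differences of distribution functions
  (\<open>measure_deriv_representation\<close>).\<close>

section \<open>Smooth functions and cutoffs\<close>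

definition smooth :: "(real \<Rightarrow> real) \<Rightarrow> bool" where
  "smooth f \<longleftrightarrow> (\<forall>n t. ((deriv ^^ n) f) differentiable (at t))"

text \<open>Smoothness is shown by exhibiting a class of differentiable functions that contains the
  function and is closed under differentiation; this avoids formulas for iterated derivatives.\<close>

lemma smooth_coinduct:
  assumes "P f" and step: "\<And>g. P g \<Longrightarrow> (\<forall>t. g differentiable (at t)) \<and> P (deriv g)"
  shows "smooth f"
proof -
  have "P ((deriv ^^ n) f)" for n
    by (induction n) (use assms in auto)
  then show ?thesis
    unfolding smooth_def using step by blast
qed

lemma smooth_differentiable: "smooth f \<Longrightarrow> f differentiable (at t)"
  unfolding smooth_def by (metis funpow_0)

lemma smooth_deriv: "smooth f \<Longrightarrow> smooth (deriv f)"
  unfolding smooth_def by (metis comp_apply funpow_Suc_right)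

lemma smooth_has_deriv: "smooth f \<Longrightarrow> (f has_real_derivative deriv f t) (at t)"
  by (metis DERIV_deriv_iff_real_differentiable smooth_differentiable)

lemma smooth_if_deriv_smooth:
  assumes "\<And>t. (f has_real_derivative g t) (at t)" and "smooth g"
  shows "smooth f"
proof -
  have d: "deriv f = g"
    using assms(1) by (auto intro!: DERIV_imp_deriv)
  have "(deriv ^^ n) f differentiable (at t)" for n t
  proof (cases n)
    case 0 then show ?thesis using assms(1) real_differentiable_def by auto
  next
    case (Suc m)
    then have "(deriv ^^ n) f = (deriv ^^ m) g"
      by (simp add: funpow_swap1 d)
    then show ?thesis using assms(2) unfolding smooth_def by simp
  qed
  then show ?thesis unfolding smooth_def by blast
qed

lemma smooth_const: "smooth (\<lambda>t. c)"
  by (rule smooth_coinduct[where P = "\<lambda>f. \<exists>c. f = (\<lambda>t. c)"]) auto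

lemma smooth_add:
  assumes "smooth f" "smooth g" shows "smooth (\<lambda>t. f t + g t)"
proof (rule smooth_coinduct[where P = "\<lambda>h. \<exists>f g. smooth f \<and> smooth g \<and> h = (\<lambda>t. f t + g t)"])
  show "\<exists>f' g'. smooth f' \<and> smooth g' \<and> (\<lambda>t. f t + g t) = (\<lambda>t. f' t + g' t)"
    using assms by blast
next
  fix h assume "\<exists>f g. smooth f \<and> smooth g \<and> h = (\<lambda>t. f t + g t)"
  then obtain f g where fg: "smooth f" "smooth g" "h = (\<lambda>t. f t + g t)" by blast
  have *: "(h has_real_derivative deriv f t + deriv g t) (at t)" for t
    unfolding fg(3) using fg(1,2) by (auto intro!: derivative_intros smooth_has_deriv)
  then have "deriv h = (\<lambda>t. deriv f t + deriv g t)"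
    by (auto intro!: DERIV_imp_deriv)
  then show "(\<forall>t. h differentiable at t) \<and>
      (\<exists>f g. smooth f \<and> smooth g \<and> deriv h = (\<lambda>t. f t + g t))"
    using * fg(1,2) smooth_deriv real_differentiable_def by blast
qed

text \<open>The class of finite sums of products of smooth functions is closed under differentiation
  by the Leibniz rule, so its members are infinitely often differentiable.\<close>

inductive product_sum :: "(real \<Rightarrow> real) \<Rightarrow> bool" where
  prod: "smooth f \<Longrightarrow> smooth g \<Longrightarrow> product_sum (\<lambda>t. f t * g t)"
| plus: "product_sum f \<Longrightarrow> product_sum g \<Longrightarrow> product_sum (\<lambda>t. f t + g t)"

lemma product_sum_deriv:
  "product_sum h \<Longrightarrow> \<exists>h'. product_sum h' \<and> (\<forall>t. (h has_real_derivative h' t) (at t))"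
proof (induction rule: product_sum.induct)
  case (prod f g)
  have "product_sum (\<lambda>t. deriv f t * g t + f t * deriv g t)"
    by (intro product_sum.intros prod smooth_deriv)
  moreover have "((\<lambda>t. f t * g t) has_real_derivative deriv f t * g t + f t * deriv g t) (at t)" for t
    using prod by (auto intro!: derivative_eq_intros smooth_has_deriv)
  ultimately show ?case by blast
next
  case (plus f g)
  then obtain f' g' where
    "product_sum f'" "\<And>t. (f has_real_derivative f' t) (at t)"
    "product_sum g'" "\<And>t. (g has_real_derivative g' t) (at t)" by blast
  then show ?case
    by (intro exI[of _ "\<lambda>t. f' t + g' t"]) (auto intro!: product_sum.intros derivative_intros)
qed

lemma smooth_mult:
  assumes "smooth f" "smooth g" shows "smooth (\<lambda>t. f t * g t)"
proof (rule smooth_coinduct[where P = product_sum])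
  show "product_sum (\<lambda>t. f t * g t)" by (rule product_sum.prod[OF assms])
next
  fix h assume "product_sum h"
  then obtain h' where h': "product_sum h'" "\<And>t. (h has_real_derivative h' t) (at t)"
    using product_sum_deriv by blast
  then have "deriv h = h'" by (auto intro!: DERIV_imp_deriv)
  then show "(\<forall>t. h differentiable at t) \<and> product_sum (deriv h)"
    using h' real_differentiable_def by auto
qed

lemma smooth_affine_comp:
  assumes "smooth f" shows "smooth (\<lambda>t. f (b * t + c))"
proof (rule smooth_coinduct[where P = "\<lambda>h. \<exists>k f. smooth f \<and> h = (\<lambda>t. k * f (b * t + c))"])
  show "\<exists>k g. smooth g \<and> (\<lambda>t. f (b * t + c)) = (\<lambda>t. k * g (b * t + c))"
    using assms by (metis mult_1)
next
  fix h assume "\<exists>k f. smooth f \<and> h = (\<lambda>t. k * f (b * t + c))"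
  then obtain k f where kf: "smooth f" "h = (\<lambda>t. k * f (b * t + c))" by blast
  have *: "(h has_real_derivative (k * b) * deriv f (b * t + c)) (at t)" for t
  proof -
    have "((\<lambda>t. b * t + c) has_real_derivative b) (at t)"
      by (auto intro!: derivative_eq_intros)
    from DERIV_chain2[OF smooth_has_deriv[OF kf(1)] this]
    have "((\<lambda>t. f (b * t + c)) has_real_derivative deriv f (b * t + c) * b) (at t)" .
    from DERIV_cmult[OF this, of k] show ?thesis
      unfolding kf(2) by (simp add: mult_ac)
  qed
  then have d: "deriv h = (\<lambda>t. (k * b) * deriv f (b * t + c))"
    by (auto intro!: DERIV_imp_deriv)
  have "\<exists>k f. smooth f \<and> deriv h = (\<lambda>t. k * f (b * t + c))"
    by (rule exI[of _ "k * b"], rule exI[of _ "deriv f"]) (simp add: d smooth_deriv kf(1))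
  moreover have "\<forall>t. h differentiable at t"
    using * real_differentiable_def by blast
  ultimately show "(\<forall>t. h differentiable at t) \<and> (\<exists>k f. smooth f \<and> deriv h = (\<lambda>t. k * f (b * t + c)))"
    by blast
qed

lemma smooth_ident: "smooth (\<lambda>t. t)"
  by (rule smooth_if_deriv_smooth[OF DERIV_ident smooth_const])

lemma smooth_real_polynomial_function:
  "real_polynomial_function (p :: real \<Rightarrow> real) \<Longrightarrow> smooth p"
proof (induction rule: real_polynomial_function.induct)
  case (linear f)
  then have "f = (\<lambda>t. t * f 1)"
    by (metis bounded_linear.linear linear.scaleR mult.right_neutral real_scaleR_def)
  moreover have "smooth (\<lambda>t. t * f 1)"
    by (intro smooth_mult smooth_const smooth_ident)
  ultimately show ?case by simp
qed (auto intro: smooth_const smooth_add smooth_mult)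

lemma poly_over_exp_tendsto_0: "((\<lambda>x::real. poly p x * exp (- x)) \<longlongrightarrow> 0) at_top"
proof -
  have "((\<lambda>x::real. \<Sum>i\<le>degree p. coeff p i * (x ^ i / exp x)) \<longlongrightarrow> (\<Sum>i\<le>degree p. coeff p i * 0)) at_top"
    by (intro tendsto_sum tendsto_mult tendsto_const tendsto_power_div_exp_0)
  then show ?thesis
    by (simp add: poly_altdef exp_minus sum_distrib_right divide_inverse mult.assoc)
qed

text \<open>The flat function \<open>exp (- 1 / x)\<close>, multiplied with a polynomial in \<open>1 / x\<close> so that the class is
  closed under differentiation.\<close>

definition exp_flat :: "real poly \<Rightarrow> real \<Rightarrow> real" where
  "exp_flat p x = (if x > 0 then poly p (1 / x) * exp (- (1 / x)) else 0)"

text \<open>Flatness at the origin: there every difference quotient is again of the form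
  polynomial in \<open>1 / x\<close> times \<open>exp (- 1 / x)\<close>, and the exponential wins.\<close>

lemma exp_flat_deriv:
  "(exp_flat p has_real_derivative exp_flat ([:0, 0, 1:] * (p - pderiv p)) t) (at t)"
proof -
  consider "t > 0" | "t < 0" | "t = 0" by linarith
  then show ?thesis
  proof cases
    case 1
    have "((\<lambda>x. poly p (1 / x) * exp (- (1 / x))) has_real_derivative
        exp_flat ([:0, 0, 1:] * (p - pderiv p)) t) (at t)"
      using 1 unfolding exp_flat_def
      by (auto intro!: derivative_eq_intros DERIV_chain2[OF poly_DERIV]
          simp: field_simps power2_eq_square)
    then show ?thesis
      by (rule has_field_derivative_transform_within_open[of _ _ _ "{0<..}"])
         (use 1 in \<open>auto simp: exp_flat_def\<close>)
  next
    case 2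
    have "((\<lambda>x. 0) has_real_derivative exp_flat ([:0, 0, 1:] * (p - pderiv p)) t) (at t)"
      using 2 by (simp add: exp_flat_def)
    then show ?thesis
      by (rule has_field_derivative_transform_within_open[of _ _ _ "{..<0}"])
         (use 2 in \<open>auto simp: exp_flat_def\<close>)
  next
    case 3
    have r: "((\<lambda>h. poly ([:0, 1:] * p) (inverse h) * exp (- inverse h)) \<longlongrightarrow> 0) (at_right (0::real))"
      by (rule filterlim_compose[OF poly_over_exp_tendsto_0 filterlim_inverse_at_top_right])
    have "((\<lambda>h. exp_flat p h / h) \<longlongrightarrow> 0) (at_right 0)"
      by (rule Lim_transform_eventually[OF r])
         (auto simp: eventually_at_filter exp_flat_def divide_inverse mult_ac)
    moreover have "((\<lambda>h. exp_flat p h / h) \<longlongrightarrow> 0) (at_left 0)"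
      by (rule Lim_transform_eventually[OF tendsto_const])
         (auto simp: eventually_at_filter exp_flat_def)
    ultimately have "((\<lambda>h. exp_flat p h / h) \<longlongrightarrow> 0) (at 0)"
      by (simp add: filterlim_split_at)
    then show ?thesis
      using 3 by (simp add: DERIV_def exp_flat_def)
  qed
qed

lemma smooth_exp_flat: "smooth (exp_flat p)"
proof (rule smooth_coinduct[where P = "\<lambda>f. \<exists>p. f = exp_flat p"])
  show "\<exists>q. exp_flat p = exp_flat q" by blast
next
  fix g assume "\<exists>p. g = exp_flat p"
  then obtain p where g: "g = exp_flat p" by blast
  have "deriv g = exp_flat ([:0, 0, 1:] * (p - pderiv p))"
    unfolding g by (rule ext) (rule DERIV_imp_deriv[OF exp_flat_deriv])
  then show "(\<forall>t. g differentiable at t) \<and> (\<exists>p. deriv g = exp_flat p)"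
    using exp_flat_deriv[of p] real_differentiable_def unfolding g by blast
qed

section \<open>Test functions\<close>

text \<open>The support may be enclosed in a compact interval, which is easier to handle than an arbitrary
  compact set when functions are added or integrated.\<close>

lemma test_functions_iff:
  "\<phi> \<in> test_functions \<longleftrightarrow>
    smooth \<phi> \<and> (\<exists>c d. 0 < c \<and> d < 1 \<and> (\<forall>t. t \<notin> {c..d} \<longrightarrow> \<phi> t = 0))"
proof
  assume "\<phi> \<in> test_functions"
  then obtain K where K: "smooth \<phi>" "compact K" "K \<subseteq> Omega" "\<And>t. t \<notin> K \<Longrightarrow> \<phi> t = 0"
    unfolding test_functions_def smooth_def by blast
  have "\<exists>c d. 0 < c \<and> d < 1 \<and> K \<subseteq> {c..d}"
  proof (cases "K = {}")
    case True then show ?thesis by (intro exI[of _ "1/2"]) auto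
  next
    case False
    obtain c where "c \<in> K" "\<forall>t\<in>K. c \<le> t" using compact_attains_inf[OF K(2) False] by blast
    moreover obtain d where "d \<in> K" "\<forall>t\<in>K. t \<le> d" using compact_attains_sup[OF K(2) False] by blast
    ultimately show ?thesis using K(3) unfolding Omega_def
      by (intro exI[of _ c] exI[of _ d]) auto
  qed
  then show "smooth \<phi> \<and> (\<exists>c d. 0 < c \<and> d < 1 \<and> (\<forall>t. t \<notin> {c..d} \<longrightarrow> \<phi> t = 0))"
    using K by (meson subsetD)
next
  assume "smooth \<phi> \<and> (\<exists>c d. 0 < c \<and> d < 1 \<and> (\<forall>t. t \<notin> {c..d} \<longrightarrow> \<phi> t = 0))"
  then obtain c d where "smooth \<phi>" "0 < c" "d < 1" "\<forall>t. t \<notin> {c..d} \<longrightarrow> \<phi> t = 0" by blast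
  then show "\<phi> \<in> test_functions"
    unfolding test_functions_def smooth_def Omega_def
    by (auto intro!: exI[of _ "{c..d}"])
qed

lemma test_smooth: "\<phi> \<in> test_functions \<Longrightarrow> smooth \<phi>"
  by (simp add: test_functions_iff)

lemma test_zero_outside: "\<phi> \<in> test_functions \<Longrightarrow> t \<notin> Omega \<Longrightarrow> \<phi> t = 0"
  unfolding test_functions_iff Omega_def by force

lemma test_lincomb:
  assumes "\<phi> \<in> test_functions" "\<psi> \<in> test_functions"
  shows "(\<lambda>t. \<phi> t + k * \<psi> t) \<in> test_functions"
proof -
  obtain c d where 1: "0 < c" "d < 1" "\<And>t. t \<notin> {c..d} \<Longrightarrow> \<phi> t = 0"
    using assms(1) unfolding test_functions_iff by blast
  obtain c' d' where 2: "0 < c'" "d' < 1" "\<And>t. t \<notin> {c'..d'} \<Longrightarrow> \<psi> t = 0"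
    using assms(2) unfolding test_functions_iff by blast
  have "\<phi> t + k * \<psi> t = 0" if "t \<notin> {min c c'..max d d'}" for t
    using 1(3)[of t] 2(3)[of t] that by (auto simp: min_le_iff_disj le_max_iff_disj)
  moreover have "0 < min c c'" "max d d' < 1" using 1 2 by auto
  moreover have "smooth (\<lambda>t. \<phi> t + k * \<psi> t)"
    using assms unfolding test_functions_iff by (intro smooth_add smooth_mult smooth_const) auto
  ultimately show ?thesis unfolding test_functions_iff by blast
qed

lemma zero_test: "(\<lambda>t. 0) \<in> test_functions"
  unfolding test_functions_iff by (auto intro!: smooth_const exI[of _ "1/2"])

lemma test_scale: "\<phi> \<in> test_functions \<Longrightarrow> (\<lambda>t. k * \<phi> t) \<in> test_functions"
  using test_lincomb[OF zero_test, of \<phi> k] by simp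

lemma test_deriv:
  assumes "\<phi> \<in> test_functions" shows "deriv \<phi> \<in> test_functions"
proof -
  obtain c d where cd: "0 < c" "d < 1" "\<And>t. t \<notin> {c..d} \<Longrightarrow> \<phi> t = 0"
    using assms unfolding test_functions_iff by blast
  have "deriv \<phi> t = 0" if "t \<notin> {c..d}" for t
  proof -
    have "((\<lambda>t. 0) has_real_derivative 0) (at t)" by simp
    then have "(\<phi> has_real_derivative 0) (at t)"
      by (rule has_field_derivative_transform_within_open[of _ _ _ "- {c..d}"])
         (use that cd(3) in auto)
    then show ?thesis by (rule DERIV_imp_deriv)
  qed
  then show ?thesis
    using assms cd(1,2) smooth_deriv unfolding test_functions_iff by blast
qed

lemma continuous_on_test: "\<phi> \<in> test_functions \<Longrightarrow> continuous_on S \<phi>"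
  by (meson DERIV_isCont continuous_at_imp_continuous_on smooth_has_deriv test_smooth)

lemma test_bounded:
  assumes "\<phi> \<in> test_functions" obtains M where "M > 0" "\<And>t. \<bar>\<phi> t\<bar> \<le> M"
proof -
  have "compact (\<phi> ` {0..1})"
    by (intro compact_continuous_image continuous_on_test assms) simp
  then obtain M where M: "\<forall>y\<in>\<phi> ` {0..1}. \<bar>y\<bar> \<le> M"
    using compact_imp_bounded bounded_iff by (metis real_norm_def)
  have "\<bar>\<phi> t\<bar> \<le> \<bar>M\<bar> + 1" for t
  proof (cases "t \<in> {0..1}")
    case False
    then have "t \<notin> Omega" unfolding Omega_def by auto
    then show ?thesis using test_zero_outside[OF assms] by simp
  qed (use M in force)
  then show thesis using that[of "\<bar>M\<bar> + 1"] by simp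
qed

text \<open>The two flat factors vanish for \<open>t \<le> 1 / n\<close> and \<open>t \<ge> 1 - 1 / n\<close>, respectively; at every interior point both
  arguments tend to infinity with \<open>n\<close>, and the factors to \<open>1\<close>.\<close>

definition cutoff :: "nat \<Rightarrow> real \<Rightarrow> real" where
  "cutoff n t = exp_flat 1 (real n * t - 1) * exp_flat 1 (real n - 1 - real n * t)"

lemma exp_flat_1_range: "0 \<le> exp_flat 1 x" "exp_flat 1 x \<le> 1"
  by (auto simp: exp_flat_def)

lemma cutoff_range: "0 \<le> cutoff n t" "cutoff n t \<le> 1"
  unfolding cutoff_def using exp_flat_1_range by (auto intro: mult_le_one)

lemma smooth_cutoff: "smooth (cutoff n)"
proof -
  have "cutoff n = (\<lambda>t. exp_flat 1 (real n * t + (- 1)) * exp_flat 1 (- real n * t + (real n - 1)))"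
    by (auto simp: cutoff_def algebra_simps)
  then show ?thesis
    by (simp only:) (intro smooth_mult smooth_affine_comp smooth_exp_flat)
qed

lemma smooth_times_cutoff_test:
  assumes "smooth f" shows "(\<lambda>t. f t * cutoff n t) \<in> test_functions"
proof -
  have "f t * cutoff n t = 0" if "t \<notin> {1 / (real n + 1)..1 - 1 / (real n + 1)}" for t
  proof -
    \<comment> \<open>the bound \<open>1 / (n + 1)\<close> instead of \<open>1 / n\<close> also makes sense for \<open>n = 0\<close>, where the cutoff is zero\<close>
    have "real n * t - 1 \<le> 0 \<or> real n - 1 - real n * t \<le> 0"
    proof (rule ccontr)
      assume "\<not> ?thesis"
      then have *: "real n * t > 1" "real n * (1 - t) > 1" by (auto simp: algebra_simps)
      then have "0 < t" "0 < 1 - t" by (smt (verit) mult_nonneg_nonpos of_nat_0_le_iff)+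
      then have "(real n + 1) * t > 1" "(real n + 1) * (1 - t) > 1"
        using * by (auto simp: algebra_simps)
      then have "t > 1 / (real n + 1)" "1 - t > 1 / (real n + 1)"
        by (simp_all add: field_simps)
      then show False using that by auto
    qed
    then show ?thesis unfolding cutoff_def exp_flat_def by auto
  qed
  moreover have "0 < 1 / (real n + 1)" "1 - 1 / (real n + 1) < 1" by auto
  ultimately show ?thesis
    unfolding test_functions_iff using smooth_mult[OF assms smooth_cutoff] by blast
qed

lemma cutoff_tendsto:
  assumes "t \<in> Omega" shows "(\<lambda>n. cutoff n t) \<longlonglongrightarrow> 1"
proof -
  have one: "((exp_flat 1) \<longlongrightarrow> 1) at_top"
  proof -
    have "((\<lambda>x::real. exp (- inverse x)) \<longlongrightarrow> exp (- 0)) at_top"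
      by (intro tendsto_intros tendsto_inverse_0_at_top filterlim_ident)
    moreover have "\<forall>\<^sub>F x in at_top. exp (- inverse x) = exp_flat 1 x"
      using eventually_gt_at_top[of "0::real"]
      by eventually_elim (simp add: exp_flat_def inverse_eq_divide)
    ultimately show ?thesis
      using Lim_transform_eventually by fastforce
  qed
  have lin: "filterlim (\<lambda>n. real n * s - 1) at_top sequentially" if "s > 0" for s
  proof -
    have "filterlim (\<lambda>n. s * real n) at_top sequentially"
      by (rule filterlim_tendsto_pos_mult_at_top[OF tendsto_const that filterlim_real_sequentially])
    then have "filterlim (\<lambda>n. - 1 + s * real n) at_top sequentially"
      by (rule filterlim_tendsto_add_at_top[OF tendsto_const])
    then show ?thesis by (simp add: mult.commute)
  qed
  have "(\<lambda>n. exp_flat 1 (real n * t - 1) * exp_flat 1 (real n * (1 - t) - 1)) \<longlonglongrightarrow> 1 * 1"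
    by (intro tendsto_mult filterlim_compose[OF one] lin) (use assms in \<open>auto simp: Omega_def\<close>)
  then show ?thesis unfolding cutoff_def by (simp add: algebra_simps)
qed

section \<open>Positive semidefinite forms on function spaces\<close>

text \<open>The \<open>L\<^sup>2\<close> inner product and the energy form are only semidefinite here, because functions that
  agree almost everywhere are distinct as functions.\<close>

locale semidefinite_form =
  fixes W :: "(real \<Rightarrow> real) set" and B :: "(real \<Rightarrow> real) \<Rightarrow> (real \<Rightarrow> real) \<Rightarrow> real"
  assumes zero_mem: "(\<lambda>t. 0) \<in> W"
    and lincomb_mem: "f \<in> W \<Longrightarrow> g \<in> W \<Longrightarrow> (\<lambda>t. f t + c * g t) \<in> W"
    and form_lincomb_left: "f \<in> W \<Longrightarrow> g \<in> W \<Longrightarrow> k \<in> W \<Longrightarrow>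
      B (\<lambda>t. f t + c * g t) k = B f k + c * B g k"
    and form_sym: "f \<in> W \<Longrightarrow> g \<in> W \<Longrightarrow> B f g = B g f"
    and form_nonneg: "f \<in> W \<Longrightarrow> 0 \<le> B f f"
begin

lemma diff_mem: "f \<in> W \<Longrightarrow> g \<in> W \<Longrightarrow> (\<lambda>t. f t - g t) \<in> W"
  using lincomb_mem[of f g "- 1"] by simp

lemma form_diff_left: "f \<in> W \<Longrightarrow> g \<in> W \<Longrightarrow> k \<in> W \<Longrightarrow> B (\<lambda>t. f t - g t) k = B f k - B g k"
  using form_lincomb_left[of f g k "- 1"] by simp

lemma form_lincomb_right: "f \<in> W \<Longrightarrow> g \<in> W \<Longrightarrow> k \<in> W \<Longrightarrow>
    B k (\<lambda>t. f t + c * g t) = B k f + c * B k g"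
  using form_sym[of k "\<lambda>t. f t + c * g t"] form_sym[of k f] form_sym[of k g]
  by (simp add: form_lincomb_left lincomb_mem)

lemma form_diff_right: "f \<in> W \<Longrightarrow> g \<in> W \<Longrightarrow> k \<in> W \<Longrightarrow> B k (\<lambda>t. f t - g t) = B k f - B k g"
  using form_lincomb_right[of f g k "- 1"] by simp

lemma form_square: 
  assumes "f \<in> W" "g \<in> W"
  shows "B (\<lambda>t. f t + c * g t) (\<lambda>t. f t + c * g t) = B f f + 2 * c * B f g + c\<^sup>2 * B g g"
  using assms by (simp add: form_lincomb_left form_lincomb_right lincomb_mem form_sym[of g f]
      power2_eq_square algebra_simps)

lemma Cauchy_Schwarz_square:
  assumes "f \<in> W" "g \<in> W" shows "(B f g)\<^sup>2 \<le> B f f * B g g"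
proof (cases "B g g = 0")
  case True
  \<comment> \<open>a nonnegative affine function of \<open>c\<close> is constant\<close>
  have *: "0 \<le> B f f + 2 * c * B f g" for c
    using form_nonneg[OF lincomb_mem[OF assms, of c]] form_square[OF assms, of c] True by simp
  have "B f g = 0"
  proof (rule ccontr)
    assume "B f g \<noteq> 0"
    then show False
      using *[of "- (B f f + 1) / (2 * B f g)"] by (simp add: field_simps)
  qed
  then show ?thesis using True by simp
next
  case False
  then have p: "B g g > 0" using form_nonneg[OF assms(2)] by simp
  \<comment> \<open>the value of \<open>c\<close> that minimizes the quadratic polynomial \<open>form_square\<close>\<close>
  have "0 \<le> B f f + 2 * (- B f g / B g g) * B f g + (- B f g / B g g)\<^sup>2 * B g g"
    using form_nonneg[OF lincomb_mem[OF assms, of "- B f g / B g g"]] form_square[OF assms] by metis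
  then show ?thesis using p by (simp add: field_simps power2_eq_square)
qed

lemma Cauchy_Schwarz:
  assumes "f \<in> W" "g \<in> W" shows "\<bar>B f g\<bar> \<le> sqrt (B f f) * sqrt (B g g)"
proof -
  have "\<bar>B f g\<bar> = sqrt ((B f g)\<^sup>2)" by simp
  also have "\<dots> \<le> sqrt (B f f * B g g)"
    using Cauchy_Schwarz_square[OF assms] real_sqrt_le_mono by blast
  finally show ?thesis by (simp add: real_sqrt_mult)
qed

lemma norm_lincomb_le:
  assumes "f \<in> W" "g \<in> W"
  shows "sqrt (B (\<lambda>t. f t + c * g t) (\<lambda>t. f t + c * g t)) \<le> sqrt (B f f) + \<bar>c\<bar> * sqrt (B g g)"
proof (rule real_le_lsqrt)
  show "0 \<le> sqrt (B f f) + \<bar>c\<bar> * sqrt (B g g)"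
    using assms form_nonneg by simp
  have "c * B f g \<le> \<bar>c\<bar> * (sqrt (B f f) * sqrt (B g g))"
    using Cauchy_Schwarz[OF assms] by (metis abs_ge_self abs_mult mult_left_mono abs_ge_zero order_trans)
  then show "B (\<lambda>t. f t + c * g t) (\<lambda>t. f t + c * g t) \<le> (sqrt (B f f) + \<bar>c\<bar> * sqrt (B g g))\<^sup>2"
    using assms form_nonneg by (simp add: form_square power2_sum power_mult_distrib algebra_simps)
qed

text \<open>One Gram--Schmidt step.  If \<open>b\<close> is the new direction and \<open>b'\<close> its component orthogonal to
  \<open>U\<close>, the projection gains the component of \<open>f\<close> along \<open>b'\<close>; when \<open>b'\<close> has zero length, it is
  orthogonal to everything by Cauchy--Schwarz and nothing has to be added.\<close>

lemma projection_extend: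
  assumes U: "U \<subseteq> W" and lin: "\<And>u v c. u \<in> U \<Longrightarrow> v \<in> U \<Longrightarrow> (\<lambda>t. u t + c * v t) \<in> U"
    and proj: "\<And>f. f \<in> W \<Longrightarrow> \<exists>p\<in>U. \<forall>w\<in>U. B p w = B f w"
    and b: "b \<in> W" and f: "f \<in> W"
  shows "\<exists>u\<in>U. \<exists>k. \<forall>w\<in>U. \<forall>c. B (\<lambda>t. u t + k * b t) (\<lambda>t. w t + c * b t) = B f (\<lambda>t. w t + c * b t)"
proof -
  obtain pb where pb: "pb \<in> U" "\<forall>w\<in>U. B pb w = B b w" using proj[OF b] by blast
  obtain pf where pf: "pf \<in> U" "\<forall>w\<in>U. B pf w = B f w" using proj[OF f] by blast
  define b' where "b' = (\<lambda>t. b t - pb t)"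
  have b'W: "b' \<in> W" unfolding b'_def using b pb(1) U by (auto intro: diff_mem)
  have orth: "B b' w = 0" "B w b' = 0" if "w \<in> U" for w
    using that pb b U b'W form_sym[of w b'] unfolding b'_def by (auto simp: form_diff_left subset_iff)
  define k where "k = (if B b' b' = 0 then 0 else B f b' / B b' b')"
  have k: "k * B b' b' = B f b'"
    using Cauchy_Schwarz[OF f b'W] by (auto simp: k_def)
  define u where "u = (\<lambda>t. pf t + (- k) * pb t)"
  have uU: "u \<in> U" unfolding u_def by (rule lin[OF pf(1) pb(1)])
  have eq: "(\<lambda>t. u t + k * b t) = (\<lambda>t. pf t + k * b' t)"
    by (auto simp: u_def b'_def algebra_simps)
  show ?thesis
  proof (intro bexI[OF _ uU] exI[of _ k] ballI allI)
    fix w c assume w: "w \<in> U"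
    define w' where "w' = (\<lambda>t. w t + c * pb t)"
    have w'U: "w' \<in> U" unfolding w'_def by (rule lin[OF w pb(1)])
    have eqw: "(\<lambda>t. w t + c * b t) = (\<lambda>t. w' t + c * b' t)"
      by (auto simp: w'_def b'_def algebra_simps)
    have W: "w' \<in> W" "pf \<in> W" using w'U pf U by auto
    show "B (\<lambda>t. u t + k * b t) (\<lambda>t. w t + c * b t) = B f (\<lambda>t. w t + c * b t)"
      unfolding eq eqw using W b'W f pf(2) w'U orth[OF w'U] orth[OF pf(1)] k
      by (simp add: form_lincomb_left form_lincomb_right lincomb_mem distrib_left mult.left_commute)
  qed
qed

end

section \<open>Integration over the unit interval\<close>

lemma space_leb [simp]: "space leb = Omega"
  by simp

lemma Omega_sets [simp]: "Omega \<in> sets lebesgue"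
  unfolding Omega_def by simp

lemma Omega_borel [simp]: "Omega \<in> sets borel"
  unfolding Omega_def by simp

lemma Omega_iff: "t \<in> Omega \<longleftrightarrow> 0 < t \<and> t < 1"
  unfolding Omega_def by simp

lemma measure_leb_interval:
  assumes "0 \<le> c" "c \<le> d" "d \<le> 1" shows "measure leb {c<..<d} = d - c"
  using assms by (subst measure_restrict_space) (auto simp: Omega_def)

lemma emeasure_leb_space: "emeasure leb Omega = 1"
  by (subst emeasure_restrict_space) (auto simp: Omega_def)

lemma measure_leb_space [simp]: "measure leb Omega = 1"
  by (simp add: measure_def emeasure_leb_space)

interpretation leb: finite_measure leb
  by standard (simp add: emeasure_leb_space)

lemma borel_measurable_leb [measurable (raw)]:
  "f \<in> borel_measurable borel \<Longrightarrow> f \<in> borel_measurable leb"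
  by (intro measurable_restrict_space1 measurable_completion) simp

lemma AE_leb_I: "(\<And>t. t \<in> Omega \<Longrightarrow> P t) \<Longrightarrow> AE t in leb. P t"
  by (intro AE_I2) simp

lemma AE_leb_not_in_finite:
  assumes "finite F" shows "AE t in leb. t \<notin> F"
proof -
  have "negligible F" using assms by (rule negligible_finite)
  then have "AE t in lebesgue. t \<notin> F"
    by (metis AE_not_in negligible_iff_null_sets)
  then show ?thesis
    by (subst AE_restrict_space_iff) auto
qed

lemma integrable_bounded:
  fixes f :: "real \<Rightarrow> real"
  assumes "f \<in> borel_measurable leb" "AE t in leb. \<bar>f t\<bar> \<le> M" shows "integrable leb f"
  using leb.integrable_const_bound[of f M] assms by simp

lemma integral_leb_bound:
  fixes f :: "real \<Rightarrow> real"
  assumes "integrable leb f" "AE t in leb. \<bar>f t\<bar> \<le> M" shows "\<bar>LINT t|leb. f t\<bar> \<le> M"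
proof -
  have "\<bar>LINT t|leb. f t\<bar> \<le> (LINT t|leb. \<bar>f t\<bar>)"
    using integral_norm_bound[of leb f] by simp
  also have "\<dots> \<le> (LINT t|leb. M)"
    using assms by (intro integral_mono_AE) auto
  finally show ?thesis by simp
qed

lemma integrable_indicator_mult:
  fixes f :: "real \<Rightarrow> real"
  assumes "integrable leb f" "A \<in> sets borel" shows "integrable leb (\<lambda>t. indicator A t * f t)"
  by (rule Bochner_Integration.integrable_bound[OF assms(1)])
     (use assms in \<open>auto simp: indicator_def intro!: AE_I2 borel_measurable_times borel_measurable_leb
        dest: borel_measurable_integrable\<close>)

lemma integrable_mult_bounded:
  fixes f g :: "real \<Rightarrow> real"
  assumes "integrable leb f" "g \<in> borel_measurable leb" "AE t in leb. \<bar>g t\<bar> \<le> M"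
  shows "integrable leb (\<lambda>t. f t * g t)"
proof (rule Bochner_Integration.integrable_bound[where f = "\<lambda>t. M * f t"])
  show "integrable leb (\<lambda>t. M * f t)" using assms(1) by simp
  show "(\<lambda>t. f t * g t) \<in> borel_measurable leb"
    using assms by (auto dest: borel_measurable_integrable)
  show "AE t in leb. norm (f t * g t) \<le> norm (M * f t)"
    using assms(3) by eventually_elim (simp add: abs_mult mult.commute[of "\<bar>f _\<bar>"] mult_right_mono)
qed

subsection \<open>Primitives\<close>

text \<open>Only the part of \<open>{..<t}\<close> inside the unit interval contributes, so that the primitive is continued
  as a constant on both sides and is continuous on the whole line.\<close>

definition prim :: "(real \<Rightarrow> real) \<Rightarrow> real \<Rightarrow> real" where
  "prim g t = (LINT s|leb. indicator {..<t} s * g s)"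

lemma prim_0 [simp]: "t \<le> 0 \<Longrightarrow> prim g t = 0"
  unfolding prim_def by (rule integral_eq_zero_AE) (auto intro!: AE_leb_I simp: Omega_iff)

lemma prim_1: "1 \<le> t \<Longrightarrow> prim g t = (LINT s|leb. g s)"
  unfolding prim_def by (rule Bochner_Integration.integral_cong) (auto simp: Omega_iff)

lemma prim_cong_AE:
  assumes "f \<in> borel_measurable leb" "g \<in> borel_measurable leb" "AE t in leb. f t = g t"
  shows "prim f t = prim g t"
proof -
  have [measurable]: "indicator {..<t} \<in> borel_measurable leb"
    by (intro borel_measurable_leb) simp
  show ?thesis
    unfolding prim_def using assms by (intro integral_cong_AE) auto
qed

lemma prim_lincomb:
  assumes "integrable leb f" "integrable leb g"
  shows "prim (\<lambda>t. f t + c * g t) t = prim f t + c * prim g t"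
proof -
  have "prim (\<lambda>t. f t + c * g t) t = (LINT s|leb. indicator {..<t} s * f s + c * (indicator {..<t} s * g s))"
    unfolding prim_def by (rule Bochner_Integration.integral_cong) (auto simp: algebra_simps)
  then show ?thesis
    using assms by (simp add: prim_def integrable_indicator_mult)
qed

lemma prim_diff_eq:
  assumes "integrable leb g" "s \<le> t"
  shows "prim g t - prim g s = (LINT r|leb. indicator {s..<t} r * g r)"
proof -
  have "prim g t - prim g s = (LINT r|leb. indicator {..<t} r * g r - indicator {..<s} r * g r)"
    unfolding prim_def using assms by (simp add: integrable_indicator_mult)
  also have "\<dots> = (LINT r|leb. indicator {s..<t} r * g r)"
    by (rule Bochner_Integration.integral_cong) (use assms in \<open>auto simp: indicator_def\<close>)
  finally show ?thesis .
qed

lemma integral_indicator_leb_le: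
  assumes "s \<le> t" shows "(LINT r|leb. indicator {s..<t} r) \<le> t - s"
proof -
  have "measure lebesgue ({s..<t} \<inter> Omega) \<le> measure lebesgue {s..<t}"
    using assms by (intro measure_mono_fmeasurable fmeasurableI) auto
  moreover have "(LINT r|leb. indicator {s..<t} r) = measure lebesgue ({s..<t} \<inter> Omega)"
    by (simp add: Int_commute measure_restrict_space)
  ultimately show ?thesis using assms by simp
qed

lemma integral_over_interval_le:
  assumes g: "integrable leb g" and st: "s \<le> t"
    and b: "AE r in leb. r \<in> {s..<t} \<longrightarrow> \<bar>g r\<bar> \<le> M" and M: "M \<ge> 0"
  shows "\<bar>LINT r|leb. indicator {s..<t} r * g r\<bar> \<le> M * (t - s)"
proof -
  have i: "integrable leb (\<lambda>r. M * indicator {s..<t} r)"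
    by (intro integrable_bounded[of _ M] borel_measurable_leb AE_leb_I) (auto simp: M indicator_def)
  have "\<bar>LINT r|leb. indicator {s..<t} r * g r\<bar> \<le> (LINT r|leb. \<bar>indicator {s..<t} r * g r\<bar>)"
    using integral_norm_bound[of leb "\<lambda>r. indicator {s..<t} r * g r"] by simp
  also have "\<dots> \<le> (LINT r|leb. M * indicator {s..<t} r)"
    using b by (intro integral_mono_AE i integrable_abs integrable_indicator_mult[OF g])
      (auto simp: indicator_def elim!: eventually_mono)
  also have "\<dots> \<le> M * (t - s)"
    using integral_indicator_leb_le[OF st] M by (simp add: mult_left_mono)
  finally show ?thesis .
qed

lemma prim_lipschitz:
  assumes "integrable leb g" "AE r in leb. \<bar>g r\<bar> \<le> M"
  shows "\<bar>prim g t - prim g s\<bar> \<le> M * \<bar>t - s\<bar>"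
proof -
  have M: "M \<ge> 0"
    using integral_leb_bound[OF assms] by linarith
  have *: "\<bar>prim g t - prim g s\<bar> \<le> M * (t - s)" if "s \<le> t" for s t
    unfolding prim_diff_eq[OF assms(1) that]
    by (rule integral_over_interval_le[OF assms(1) that _ M]) (use assms(2) in auto)
  show ?thesis
    using *[of s t] *[of t s] by (cases "s \<le> t") (auto simp: abs_minus_commute)
qed

lemma continuous_on_prim:
  assumes "integrable leb g" "AE r in leb. \<bar>g r\<bar> \<le> M"
  shows "continuous_on S (prim g)"
proof -
  have "M \<ge> 0" using integral_leb_bound[OF assms] by linarith
  then have "M-lipschitz_on S (prim g)"
    by (intro lipschitz_onI) (use prim_lipschitz[OF assms] in \<open>auto simp: dist_real_def\<close>)
  then show ?thesis by (rule lipschitz_on_continuous_on)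
qed

lemma prim_measurable:
  assumes "integrable leb g" "AE r in leb. \<bar>g r\<bar> \<le> M"
  shows "prim g \<in> borel_measurable leb"
  by (intro borel_measurable_leb borel_measurable_continuous_onI continuous_on_prim[OF assms])

lemma prim_bound:
  assumes "integrable leb g" "AE r in leb. \<bar>g r\<bar> \<le> M" shows "\<bar>prim g t\<bar> \<le> M"
proof -
  have M: "M \<ge> 0" using integral_leb_bound[OF assms] by linarith
  have "AE r in leb. \<bar>indicator {..<t} r * g r\<bar> \<le> M"
    using assms(2) by eventually_elim (auto simp: indicator_def M)
  then show ?thesis
    unfolding prim_def by (intro integral_leb_bound integrable_indicator_mult assms) auto
qed

text \<open>A continuous function that is differentiable off a finite set is the primitive of its
  derivative; this covers test functions and piecewise affine functions alike.\<close>

lemma prim_FTC: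
  assumes "finite F" "continuous_on {0..1} f" "integrable leb g"
    and d: "\<And>t. t \<in> Omega - F \<Longrightarrow> (f has_real_derivative g t) (at t)" and t: "t \<in> {0..1}"
  shows "prim g t = f t - f 0"
proof -
  have A: "{0<..<t} \<in> sets lebesgue" by simp
  have eq: "indicator Omega s * (indicator {..<t} s * g s) = indicator {0<..<t} s * g s" for s
    using t by (auto simp: indicator_def Omega_iff)
  have i: "integrable (lebesgue_on {0<..<t}) g"
  proof -
    have "integrable leb (\<lambda>s. indicator {..<t} s * g s)"
      by (rule integrable_indicator_mult[OF assms(3)]) simp
    then have "integrable lebesgue (\<lambda>s. indicator {0<..<t} s * g s)"
      by (simp add: integrable_restrict_space eq)
    then show ?thesis by (simp add: integrable_restrict_space)
  qed
  have "prim g t = integral\<^sup>L (lebesgue_on {0<..<t}) g"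
    unfolding prim_def by (simp add: integral_restrict_space eq)
  also have "\<dots> = integral {0<..<t} g"
    by (rule lebesgue_integral_eq_integral[OF i A])
  also have "\<dots> = integral {0..t} g"
    by (simp add: integral_open_interval_real)
  also have "(g has_integral (f t - f 0)) {0..t}"
    by (rule fundamental_theorem_of_calculus_interior_strong[OF assms(1)])
       (use t d in \<open>auto simp: has_real_derivative_iff_has_vector_derivative Omega_iff
          intro: continuous_on_subset[OF assms(2)]\<close>)
  then have "integral {0..t} g = f t - f 0" by (rule integral_unique)
  finally show ?thesis .
qed

lemma test_measurable: "\<phi> \<in> test_functions \<Longrightarrow> \<phi> \<in> borel_measurable borel"
  by (intro borel_measurable_continuous_onI continuous_on_test)

lemma integrable_test: "\<phi> \<in> test_functions \<Longrightarrow> integrable leb \<phi>"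
  by (metis AE_leb_I borel_measurable_leb integrable_bounded test_bounded test_measurable)

lemma prim_deriv_test:
  assumes "\<phi> \<in> test_functions" "t \<in> {0..1}" shows "prim (deriv \<phi>) t = \<phi> t"
  using prim_FTC[of "{}" \<phi> "deriv \<phi>" t] assms test_zero_outside[OF assms(1), of 0]
  by (simp add: continuous_on_test integrable_test test_deriv smooth_has_deriv test_smooth Omega_iff)

lemma integral_deriv_test:
  assumes "\<phi> \<in> test_functions" shows "(LINT t|leb. deriv \<phi> t) = 0"
  using prim_deriv_test[OF assms, of 1] test_zero_outside[OF assms, of 1]
  by (simp add: prim_1 Omega_iff)

text \<open>Integration by parts with respect to a measure, in the form produced by Fubini's theorem:
  both sides integrate \<open>r s * \<psi> t\<close> over the triangle \<open>t < s\<close>.\<close>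

lemma integral_times_prim:
  assumes M: "finite_measure M" and spM: "space M \<subseteq> Omega"
    and id: "(\<lambda>s. s) \<in> borel_measurable M"
    and r: "integrable M r" and \<psi>: "integrable leb \<psi>"
  shows "(LINT s|M. r s * prim \<psi> s) = (LINT t|leb. \<psi> t * (LINT s|M. indicator {t<..} s * r s))"
proof -
  interpret M: finite_measure M by fact
  interpret pair_sigma_finite M leb by standard
  have idl: "(\<lambda>s. s) \<in> borel_measurable leb" by (rule borel_measurable_leb) simp
  note [measurable] = id idl borel_measurable_integrable[OF r] borel_measurable_integrable[OF \<psi>]
  define f where "f = (\<lambda>(s, t). r s * ((if t < s then 1 else 0) * \<psi> t))"
  have f[measurable]: "f \<in> borel_measurable (M \<Otimes>\<^sub>M leb)"
    unfolding f_def by measurable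
  have abs\<psi>: "integrable leb (\<lambda>t. \<bar>\<psi> t\<bar>)" using \<psi> by simp
  have ipsi: "integrable leb (\<lambda>t. (if t < s then 1 else 0) * \<psi> t)" for s
    using integrable_indicator_mult[OF \<psi>, of "{..<s}"] by (simp add: indicator_def of_bool_def)
  have "integrable (M \<Otimes>\<^sub>M leb) f"
  proof (rule Fubini_integrable[OF f])
    show "integrable M (\<lambda>s. \<integral>t. norm (f (s, t)) \<partial>leb)"
    proof (rule Bochner_Integration.integrable_bound)
      show "integrable M (\<lambda>s. (LINT t|leb. \<bar>\<psi> t\<bar>) * r s)" using r by simp
      show "(\<lambda>s. \<integral>t. norm (f (s, t)) \<partial>leb) \<in> borel_measurable M" by measurable
      show "AE s in M. norm (\<integral>t. norm (f (s, t)) \<partial>leb) \<le> norm ((LINT t|leb. \<bar>\<psi> t\<bar>) * r s)"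
      proof (intro AE_I2)
        fix s
        have "(\<integral>t. norm (f (s, t)) \<partial>leb) \<le> (\<integral>t. \<bar>r s\<bar> * \<bar>\<psi> t\<bar> \<partial>leb)"
        proof (rule integral_mono)
          show "integrable leb (\<lambda>t. norm (f (s, t)))"
            unfolding f_def using ipsi[of s] by (auto intro!: integrable_norm)
        qed (use abs\<psi> in \<open>auto simp: f_def abs_mult\<close>)
        moreover have "0 \<le> (\<integral>t. norm (f (s, t)) \<partial>leb)" "0 \<le> (LINT t|leb. \<bar>\<psi> t\<bar>)"
          by (auto intro: integral_nonneg_AE)
        ultimately show "norm (\<integral>t. norm (f (s, t)) \<partial>leb) \<le> norm ((LINT t|leb. \<bar>\<psi> t\<bar>) * r s)"
          by (simp add: abs_mult mult.commute)
      qed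
    qed
    show "AE s in M. integrable leb (\<lambda>t. f (s, t))"
      unfolding f_def using ipsi by (intro AE_I2) simp
  qed
  then have "(\<integral>t. (\<integral>s. f (s, t) \<partial>M) \<partial>leb) = (\<integral>s. (\<integral>t. f (s, t) \<partial>leb) \<partial>M)"
    by (intro Fubini_integral) (simp add: case_prod_eta)
  moreover have "(\<integral>t. f (s, t) \<partial>leb) = r s * prim \<psi> s" for s
    by (simp add: f_def prim_def indicator_def of_bool_def)
  moreover have "(\<integral>s. f (s, t) \<partial>M) = \<psi> t * (LINT s|M. indicator {t<..} s * r s)" for t
  proof -
    have "(\<integral>s. f (s, t) \<partial>M) = (\<integral>s. \<psi> t * (indicator {t<..} s * r s) \<partial>M)"
      unfolding f_def by (rule Bochner_Integration.integral_cong) (auto simp: indicator_def)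
    then show ?thesis by simp
  qed
  ultimately show ?thesis by simp
qed

section \<open>Square integrable functions\<close>

lemma L2_measurable: "f \<in> L2_space \<Longrightarrow> f \<in> borel_measurable leb"
  by (simp add: L2_space_def)

lemma L2_mult_integrable:
  assumes "f \<in> L2_space" "g \<in> L2_space" shows "integrable leb (\<lambda>t. f t * g t)"
proof (rule Bochner_Integration.integrable_bound)
  show "integrable leb (\<lambda>t. (f t)\<^sup>2 + (g t)\<^sup>2)" using assms by (simp add: L2_space_def)
  show "(\<lambda>t. f t * g t) \<in> borel_measurable leb" using assms[THEN L2_measurable] by simp
  have "\<bar>f t * g t\<bar> \<le> (f t)\<^sup>2 + (g t)\<^sup>2" for t
    using sum_squares_bound[of "\<bar>f t\<bar>" "\<bar>g t\<bar>"] abs_ge_zero[of "f t * g t"]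
    unfolding power2_abs abs_mult by linarith
  then show "AE t in leb. norm (f t * g t) \<le> norm ((f t)\<^sup>2 + (g t)\<^sup>2)" by simp
qed

lemma bounded_L2:
  assumes "f \<in> borel_measurable leb" "AE t in leb. \<bar>f t\<bar> \<le> M" shows "f \<in> L2_space"
proof -
  have "AE t in leb. \<bar>(f t)\<^sup>2\<bar> \<le> M\<^sup>2"
    using assms(2) by eventually_elim (simp add: abs_le_square_iff[symmetric])
  then show ?thesis
    using assms unfolding L2_space_def by (auto intro!: integrable_bounded)
qed

lemma one_L2: "(\<lambda>t. 1) \<in> L2_space"
  by (rule bounded_L2[of _ 1]) auto

lemma L2_integrable: "f \<in> L2_space \<Longrightarrow> integrable leb f"
  using L2_mult_integrable[OF _ one_L2] by simp

lemma test_L2: "\<phi> \<in> test_functions \<Longrightarrow> \<phi> \<in> L2_space"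
  by (metis AE_leb_I borel_measurable_leb bounded_L2 test_bounded test_measurable)

lemma L2_lincomb:
  assumes "f \<in> L2_space" "g \<in> L2_space" shows "(\<lambda>t. f t + c * g t) \<in> L2_space"
proof -
  have "integrable leb (\<lambda>t. (f t)\<^sup>2 + 2 * c * (f t * g t) + c\<^sup>2 * (g t)\<^sup>2)"
    using assms L2_mult_integrable[OF assms] by (simp add: L2_space_def)
  then have "integrable leb (\<lambda>t. (f t + c * g t)\<^sup>2)"
    by (simp add: power2_sum power_mult_distrib algebra_simps)
  then show ?thesis using assms by (auto simp: L2_space_def)
qed

lemma L2_mult_bounded:
  assumes "f \<in> L2_space" "g \<in> borel_measurable leb" "AE t in leb. \<bar>g t\<bar> \<le> M"
  shows "(\<lambda>t. g t * f t) \<in> L2_space"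
proof -
  have "AE t in leb. \<bar>(g t)\<^sup>2\<bar> \<le> M\<^sup>2"
    using assms(3) by eventually_elim (simp add: abs_le_square_iff[symmetric])
  then have "integrable leb (\<lambda>t. (f t)\<^sup>2 * (g t)\<^sup>2)"
    using assms by (intro integrable_mult_bounded[where M = "M\<^sup>2"]) (auto simp: L2_space_def)
  then show ?thesis
    using assms by (auto simp: L2_space_def power_mult_distrib mult.commute)
qed

interpretation L2: semidefinite_form L2_space L2_inner
proof
  show "(\<lambda>t. 0) \<in> L2_space" by (rule bounded_L2[of _ 0]) auto
next
  fix f g k c assume "f \<in> L2_space" "g \<in> L2_space" "k \<in> L2_space"
  then show "L2_inner (\<lambda>t. f t + c * g t) k = L2_inner f k + c * L2_inner g k"
    unfolding L2_inner_def by (simp add: distrib_right mult.assoc L2_mult_integrable)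
next
  fix f g assume "f \<in> L2_space"
  show "L2_inner f g = L2_inner g f" unfolding L2_inner_def by (simp add: mult.commute)
next
  fix f show "0 \<le> L2_inner f f" unfolding L2_inner_def by (auto intro: integral_nonneg_AE)
qed (rule L2_lincomb)

lemma L2_norm_nonneg [simp]: "0 \<le> L2_norm f"
  unfolding L2_norm_def L2_inner_def by (auto intro: integral_nonneg_AE)

lemma L2_norm_square: "(L2_norm f)\<^sup>2 = L2_inner f f"
  unfolding L2_norm_def L2_inner_def by (simp add: integral_nonneg_AE)

lemma L2_Cauchy_Schwarz:
  "f \<in> L2_space \<Longrightarrow> g \<in> L2_space \<Longrightarrow> \<bar>L2_inner f g\<bar> \<le> L2_norm f * L2_norm g"
  using L2.Cauchy_Schwarz unfolding L2_norm_def .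

lemma L2_norm_lincomb_le:
  "f \<in> L2_space \<Longrightarrow> g \<in> L2_space \<Longrightarrow> L2_norm (\<lambda>t. f t + c * g t) \<le> L2_norm f + \<bar>c\<bar> * L2_norm g"
  using L2.norm_lincomb_le unfolding L2_norm_def .

lemma L2_norm_diff_le:
  "f \<in> L2_space \<Longrightarrow> g \<in> L2_space \<Longrightarrow> L2_norm (\<lambda>t. f t - g t) \<le> L2_norm f + L2_norm g"
  using L2_norm_lincomb_le[of f g "- 1"] by simp

lemma L2_norm_add_le:
  "f \<in> L2_space \<Longrightarrow> g \<in> L2_space \<Longrightarrow> L2_norm (\<lambda>t. f t + g t) \<le> L2_norm f + L2_norm g"
  using L2_norm_lincomb_le[of f g "1"] by simp

lemma L2_inner_cong_AE:
  assumes "f \<in> borel_measurable leb" "g \<in> borel_measurable leb" "AE t in leb. f t = g t"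
    "f' \<in> borel_measurable leb" "g' \<in> borel_measurable leb" "AE t in leb. f' t = g' t"
  shows "L2_inner f f' = L2_inner g g'"
  unfolding L2_inner_def using assms by (intro integral_cong_AE) auto

lemma L2_norm_cong_AE:
  assumes "f \<in> borel_measurable leb" "g \<in> borel_measurable leb" "AE t in leb. f t = g t"
  shows "L2_norm f = L2_norm g"
  unfolding L2_norm_def using L2_inner_cong_AE[OF assms assms] by simp

lemma L2_norm_bound:
  assumes "f \<in> borel_measurable leb" "AE t in leb. \<bar>f t\<bar> \<le> M" "M \<ge> 0" shows "L2_norm f \<le> M"
proof -
  have "AE t in leb. \<bar>f t * f t\<bar> \<le> M * M"
    using assms(2)
  proof eventually_elim
    case (elim t)
    then have "\<bar>f t\<bar> * \<bar>f t\<bar> \<le> M * M" by (intro mult_mono) auto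
    then show ?case by simp
  qed
  then have "\<bar>L2_inner f f\<bar> \<le> M * M"
    unfolding L2_inner_def using bounded_L2[OF assms(1,2)]
    by (intro integral_leb_bound L2_mult_integrable)
  then show ?thesis
    unfolding L2_norm_def using assms(3) by (auto intro!: real_le_lsqrt simp: power2_eq_square)
qed

lemma integral_abs_le_L2_norm:
  assumes "f \<in> L2_space" shows "(LINT t|leb. \<bar>f t\<bar>) \<le> L2_norm f"
proof -
  have a: "(\<lambda>t. \<bar>f t\<bar>) \<in> L2_space" using assms by (auto simp: L2_space_def)
  have "L2_norm (\<lambda>t. \<bar>f t\<bar>) = L2_norm f" unfolding L2_norm_def L2_inner_def by simp
  moreover have "L2_norm (\<lambda>t. 1) = 1" unfolding L2_norm_def L2_inner_def by simp
  ultimately show ?thesis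
    using L2_Cauchy_Schwarz[OF a one_L2] unfolding L2_inner_def by simp
qed

lemma L2_norm_0_AE:
  assumes "f \<in> L2_space" "L2_norm f = 0" shows "AE t in leb. f t = 0"
proof -
  have "(LINT t|leb. f t * f t) = 0"
    using L2_norm_square[of f] assms(2) unfolding L2_inner_def by simp
  then have "AE t in leb. f t * f t = 0"
    using integral_nonneg_eq_0_iff_AE[of leb "\<lambda>t. f t * f t"] L2_mult_integrable[OF assms(1,1)] by simp
  then show ?thesis by simp
qed

lemma prim_le_L2_norm:
  assumes "g \<in> L2_space" shows "\<bar>prim g t\<bar> \<le> L2_norm g"
proof -
  have "\<bar>prim g t\<bar> \<le> (LINT s|leb. \<bar>indicator {..<t} s * g s\<bar>)"
    unfolding prim_def using integral_norm_bound[of leb "\<lambda>s. indicator {..<t} s * g s"] by simp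
  also have "\<dots> \<le> (LINT s|leb. \<bar>g s\<bar>)"
    using L2_integrable[OF assms]
    by (intro integral_mono integrable_abs integrable_indicator_mult) (auto simp: indicator_def)
  finally show ?thesis using integral_abs_le_L2_norm[OF assms] by linarith
qed

section \<open>Density of test functions\<close>

text \<open>Lebesgue measurable functions are almost everywhere limits of continuous functions; these
  are approximated uniformly by polynomials, and multiplication with a cutoff turns polynomials
  into test functions.\<close>

lemma bounded_measurable_test_approx:
  assumes g: "g \<in> borel_measurable leb" and b: "AE t in leb. \<bar>g t\<bar> \<le> M" and M: "M \<ge> 0"
  obtains \<phi> where "\<And>n. \<phi> n \<in> test_functions" "\<And>n t. t \<in> Omega \<Longrightarrow> \<bar>\<phi> n t\<bar> \<le> M + 1"
    "AE t in leb. (\<lambda>n. \<phi> n t) \<longlonglongrightarrow> g t"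
proof -
  have "g measurable_on Omega"
    using g by (simp add: measurable_on_iff_borel_measurable)
  then obtain N k where N: "negligible N" and k: "\<And>n. continuous_on UNIV (k n)"
    "\<And>t. t \<notin> N \<Longrightarrow> (\<lambda>n. k n t) \<longlonglongrightarrow> (if t \<in> Omega then g t else 0)"
    unfolding measurable_on_def by blast
  define c where "c = (\<lambda>n t. max (- M) (min M (k n t :: real)))"
  have "\<exists>p. real_polynomial_function p \<and> (\<forall>t\<in>{0..1}. \<bar>c n t - p t\<bar> < 1 / (real n + 1))" for n
  proof -
    have "continuous_on {0..1} (c n)"
      unfolding c_def by (intro continuous_intros continuous_on_subset[OF k(1)]) auto
    then show ?thesis
      using Stone_Weierstrass_real_polynomial_function[of "{0..1::real}" "c n" "1 / (real n + 1)"]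
      by (metis compact_Icc zero_less_divide_1_iff of_nat_0_le_iff add_nonneg_pos zero_less_one)
  qed
  then obtain p where p: "\<And>n. real_polynomial_function (p n)"
    "\<And>n t. t \<in> {0..1} \<Longrightarrow> \<bar>c n t - p n t\<bar> < 1 / (real n + 1)" by metis
  define \<phi> where "\<phi> = (\<lambda>n t. p n t * cutoff n t)"
  show thesis
  proof
    show "\<phi> n \<in> test_functions" for n
      unfolding \<phi>_def by (rule smooth_times_cutoff_test[OF smooth_real_polynomial_function[OF p(1)]])
    show "\<bar>\<phi> n t\<bar> \<le> M + 1" if "t \<in> Omega" for n t
    proof -
      have "\<bar>c n t\<bar> \<le> M" unfolding c_def using M by auto
      moreover have "1 / (real n + 1) \<le> 1" by simp
      ultimately have "\<bar>p n t\<bar> \<le> M + 1"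
        using p(2)[of t n] that unfolding Omega_iff atLeastAtMost_iff by linarith
      moreover have "\<bar>p n t\<bar> * \<bar>cutoff n t\<bar> \<le> \<bar>p n t\<bar>"
        using cutoff_range[of n t] by (simp add: mult_left_le)
      ultimately show ?thesis unfolding \<phi>_def abs_mult by linarith
    qed
    have "AE t in lebesgue. t \<notin> N"
      using N by (metis AE_not_in negligible_iff_null_sets)
    then have "AE t in leb. t \<in> Omega \<and> t \<notin> N"
      by (subst AE_restrict_space_iff) auto
    then show "AE t in leb. (\<lambda>n. \<phi> n t) \<longlonglongrightarrow> g t"
      using b
    proof eventually_elim
      case (elim t)
      then have "(\<lambda>n. k n t) \<longlonglongrightarrow> g t" using k(2)[of t] by simp
      then have "(\<lambda>n. c n t) \<longlonglongrightarrow> max (- M) (min M (g t))"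
        unfolding c_def by (intro tendsto_intros)
      moreover have "max (- M) (min M (g t)) = g t" using elim by auto
      ultimately have 1: "(\<lambda>n. c n t) \<longlonglongrightarrow> g t" by simp
      have "(\<lambda>n. c n t - p n t) \<longlonglongrightarrow> 0"
      proof (rule LIMSEQ_I)
        fix r :: real assume "r > 0"
        then obtain m where m: "1 / real (Suc m) < r" using nat_approx_posE by blast
        show "\<exists>no. \<forall>n\<ge>no. norm (c n t - p n t - 0) < r"
        proof (intro exI allI impI)
          fix n assume "n \<ge> m"
          then have "1 / (real n + 1) \<le> 1 / real (Suc m)" by (simp add: frac_le)
          then show "norm (c n t - p n t - 0) < r"
            using p(2)[of t n] elim m by (simp add: Omega_iff)
        qed
      qed
      from tendsto_diff[OF 1 this] have "(\<lambda>n. p n t) \<longlonglongrightarrow> g t" by simp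
      from tendsto_mult[OF this cutoff_tendsto] elim show ?case unfolding \<phi>_def by simp
    qed
  qed
qed

lemma integral_mult_tendsto:
  fixes h g :: "real \<Rightarrow> real"
  assumes h: "integrable leb h" and \<phi>: "\<And>n. \<phi> n \<in> borel_measurable leb"
    and g: "g \<in> borel_measurable leb"
    and b: "\<And>n t. t \<in> Omega \<Longrightarrow> \<bar>\<phi> n t\<bar> \<le> M" and lim: "AE t in leb. (\<lambda>n. \<phi> n t) \<longlonglongrightarrow> g t"
  shows "(\<lambda>n. LINT t|leb. h t * \<phi> n t) \<longlonglongrightarrow> (LINT t|leb. h t * g t)"
proof (rule integral_dominated_convergence)
  show "integrable leb (\<lambda>t. M * \<bar>h t\<bar>)" using h by simp
  show "AE t in leb. (\<lambda>n. h t * \<phi> n t) \<longlonglongrightarrow> h t * g t"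
    using lim by eventually_elim (intro tendsto_intros)
  show "AE t in leb. norm (h t * \<phi> n t) \<le> M * \<bar>h t\<bar>" for n
    using b by (intro AE_leb_I) (simp add: abs_mult mult.commute[of "\<bar>h _\<bar>"] mult_right_mono)
qed (use h g \<phi> in \<open>auto dest: borel_measurable_integrable\<close>)

lemma L2_tendsto:
  assumes \<phi>: "\<And>n. \<phi> n \<in> borel_measurable leb" and g: "g \<in> borel_measurable leb"
    and b: "\<And>n t. t \<in> Omega \<Longrightarrow> \<bar>\<phi> n t\<bar> \<le> M" and bg: "AE t in leb. \<bar>g t\<bar> \<le> M"
    and lim: "AE t in leb. (\<lambda>n. \<phi> n t) \<longlonglongrightarrow> g t"
  shows "(\<lambda>n. L2_norm (\<lambda>t. g t - \<phi> n t)) \<longlonglongrightarrow> 0"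
proof -
  have "(\<lambda>n. LINT t|leb. (g t - \<phi> n t) * (g t - \<phi> n t)) \<longlonglongrightarrow> (LINT t|leb. 0)"
  proof (rule integral_dominated_convergence)
    show "AE t in leb. (\<lambda>n. (g t - \<phi> n t) * (g t - \<phi> n t)) \<longlonglongrightarrow> 0"
      using lim
    proof eventually_elim
      case (elim t)
      have "(\<lambda>n. (g t - \<phi> n t) * (g t - \<phi> n t)) \<longlonglongrightarrow> (g t - g t) * (g t - g t)"
        using elim by (intro tendsto_intros)
      then show ?case by simp
    qed
    show "AE t in leb. norm ((g t - \<phi> n t) * (g t - \<phi> n t)) \<le> (2 * M) * (2 * M)" for n
      using bg AE_space
    proof eventually_elim
      case (elim t)
      then have "\<bar>g t - \<phi> n t\<bar> \<le> 2 * M" using b[of t n] by simp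
      then show ?case unfolding real_norm_def abs_mult by (intro mult_mono) auto
    qed
  qed (use \<phi> g in auto)
  then have "(\<lambda>n. sqrt (LINT t|leb. (g t - \<phi> n t) * (g t - \<phi> n t))) \<longlonglongrightarrow> sqrt 0"
    by (intro tendsto_real_sqrt) simp
  then show ?thesis unfolding L2_norm_def L2_inner_def by simp
qed

text \<open>The fundamental lemma: testing with approximations of the sign of \<open>h\<close> recovers the integral
  of \<open>\<bar>h\<bar>\<close>.\<close>

lemma AE_zero_if_orthogonal_to_tests:
  assumes h: "integrable leb h"
    and z: "\<And>\<phi>. \<phi> \<in> test_functions \<Longrightarrow> (LINT t|leb. h t * \<phi> t) = 0"
  shows "AE t in leb. h t = 0"
proof -
  have m: "(\<lambda>t. sgn (h t)) \<in> borel_measurable leb"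
    using borel_measurable_integrable[OF h] by simp
  have b: "AE t in leb. \<bar>sgn (h t)\<bar> \<le> 1" by (auto simp: abs_sgn_eq)
  obtain \<phi> where \<phi>: "\<And>n. \<phi> n \<in> test_functions" "\<And>n t. t \<in> Omega \<Longrightarrow> \<bar>\<phi> n t\<bar> \<le> 1 + 1"
    "AE t in leb. (\<lambda>n. \<phi> n t) \<longlonglongrightarrow> sgn (h t)"
    using bounded_measurable_test_approx[OF m b zero_le_one] by blast
  have "(\<lambda>n. LINT t|leb. h t * \<phi> n t) \<longlonglongrightarrow> (LINT t|leb. h t * sgn (h t))"
    by (rule integral_mult_tendsto[OF h _ m \<phi>(2,3)])
       (use \<phi>(1) in \<open>auto intro: borel_measurable_leb test_measurable\<close>)
  then have "(LINT t|leb. h t * sgn (h t)) = 0"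
    unfolding z[OF \<phi>(1)] by (simp add: LIMSEQ_const_iff)
  then have "(LINT t|leb. \<bar>h t\<bar>) = 0" by (simp add: abs_sgn)
  then show ?thesis
    using integral_nonneg_eq_0_iff_AE[of leb "\<lambda>t. \<bar>h t\<bar>"] h by simp
qed

text \<open>If every test function had mean zero, the fundamental lemma would make the constant \<open>1\<close> vanish.\<close>

lemma unit_mass_test:
  obtains \<rho> where "\<rho> \<in> test_functions" "(LINT t|leb. \<rho> t) = 1"
proof -
  have "\<not> (AE t in leb. (1::real) = 0)" 
    using integral_cong_AE[of "\<lambda>t. 1::real" leb "\<lambda>t. 0"] by auto
  then obtain \<phi> where "\<phi> \<in> test_functions" "(LINT t|leb. \<phi> t) \<noteq> 0"
    using AE_zero_if_orthogonal_to_tests[of "\<lambda>t. 1"] by auto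
  then show thesis
    using that[of "\<lambda>t. (1 / (LINT t|leb. \<phi> t)) * \<phi> t"] test_scale[of \<phi> "1 / (LINT t|leb. \<phi> t)"]
    by simp
qed

text \<open>The vanishing mean is what makes the primitive vanish to the right of the support.\<close>

lemma mean_zero_test_antiderivative:
  assumes \<psi>: "\<psi> \<in> test_functions" and z: "(LINT t|leb. \<psi> t) = 0"
  shows "prim \<psi> \<in> test_functions" and "deriv (prim \<psi>) = \<psi>"
proof -
  obtain c d where cd: "0 < c" "d < 1" "\<And>t. t \<notin> {c..d} \<Longrightarrow> \<psi> t = 0"
    using \<psi> unfolding test_functions_iff by blast
  have z0: "prim \<psi> t = 0" if "t \<notin> {c..d}" for t
  proof -
    have "(\<forall>s. indicator {..<t} s * \<psi> s = 0) \<or> (\<forall>s. indicator {..<t} s * \<psi> s = \<psi> s)"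
      using that cd(3) by (auto simp: indicator_def)
    then have "(\<lambda>s. indicator {..<t} s * \<psi> s) = (\<lambda>s. 0) \<or> (\<lambda>s. indicator {..<t} s * \<psi> s) = \<psi>"
      by (simp only: fun_eq_iff)
    then show ?thesis unfolding prim_def using z by auto
  qed
  have d: "(prim \<psi> has_real_derivative \<psi> t) (at t)" for t
  proof (cases "t \<in> {c..d}")
    case True
    define \<Phi> where "\<Phi> = (\<lambda>t. integral {-1..t} \<psi>)"
    have d\<Phi>: "(\<Phi> has_real_derivative \<psi> s) (at s)" if "s \<in> {-1<..<2}" for s
    proof -
      have "(\<Phi> has_real_derivative \<psi> s) (at s within {-1..2})"
        unfolding \<Phi>_def using that
        by (intro integral_has_real_derivative continuous_on_test[OF \<psi>]) auto
      then show ?thesis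
        using that at_within_interior[of s "{-1..2}"] by simp
    qed
    have "continuous_on {0..1} \<Phi>"
      by (rule continuous_at_imp_continuous_on) (auto intro!: DERIV_isCont[OF d\<Phi>])
    then have eq: "prim \<psi> s = \<Phi> s - \<Phi> 0" if "s \<in> {0..1}" for s
      by (intro prim_FTC[of "{}"]) (use that \<psi> d\<Phi> in \<open>auto simp: integrable_test Omega_iff\<close>)
    have "((\<lambda>s. \<Phi> s - \<Phi> 0) has_real_derivative \<psi> t) (at t)"
      using d\<Phi>[of t] True cd(1,2) by (auto intro!: derivative_eq_intros)
    then show ?thesis
      by (rule has_field_derivative_transform_within_open[of _ _ _ "{0<..<1}"])
         (use True cd(1,2) eq in auto)
  next
    case False
    have "((\<lambda>t. 0) has_real_derivative \<psi> t) (at t)" using cd(3)[OF False] by simp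
    then show ?thesis
      by (rule has_field_derivative_transform_within_open[of _ _ _ "- {c..d}"])
         (use False z0 in auto)
  qed
  show "deriv (prim \<psi>) = \<psi>" using d by (auto intro!: DERIV_imp_deriv)
  have "smooth (prim \<psi>)" by (rule smooth_if_deriv_smooth[OF d test_smooth[OF \<psi>]])
  then show "prim \<psi> \<in> test_functions" unfolding test_functions_iff using z0 cd(1,2) by blast
qed

text \<open>The lemma of du Bois-Reymond: a test function becomes a derivative of a test function after
  subtraction of a multiple of a fixed test function of mass one.\<close>

lemma AE_const_if_orthogonal_to_test_derivs:
  assumes h: "integrable leb h"
    and z: "\<And>\<phi>. \<phi> \<in> test_functions \<Longrightarrow> (LINT t|leb. h t * deriv \<phi> t) = 0"
  shows "\<exists>c. AE t in leb. h t = c"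
proof -
  obtain \<rho> where \<rho>: "\<rho> \<in> test_functions" "(LINT t|leb. \<rho> t) = 1" by (rule unit_mass_test)
  define c where "c = (LINT t|leb. h t * \<rho> t)"
  have hi: "integrable leb (\<lambda>t. h t * \<phi> t)" if "\<phi> \<in> test_functions" for \<phi>
  proof -
    obtain M where M: "\<And>t. \<bar>\<phi> t\<bar> \<le> M" using test_bounded[OF \<open>\<phi> \<in> test_functions\<close>] by metis
    then show ?thesis
      by (intro integrable_mult_bounded[where M = M] h borel_measurable_leb test_measurable that) auto
  qed
  have "AE t in leb. h t - c = 0"
  proof (rule AE_zero_if_orthogonal_to_tests)
    show "integrable leb (\<lambda>t. h t - c)" using h by simp
  next
    fix \<psi> assume \<psi>: "\<psi> \<in> test_functions"
    define I where "I = (LINT t|leb. \<psi> t)"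
    define \<eta> where "\<eta> = (\<lambda>t. \<psi> t + (- I) * \<rho> t)"
    have \<eta>: "\<eta> \<in> test_functions" unfolding \<eta>_def by (rule test_lincomb[OF \<psi> \<rho>(1)])
    have "(LINT t|leb. \<eta> t) = I + (- I) * 1"
      unfolding \<eta>_def I_def using \<rho> \<psi> by (simp add: integrable_test)
    then have "(LINT t|leb. h t * \<eta> t) = 0"
      using z[OF mean_zero_test_antiderivative(1)[OF \<eta>]] mean_zero_test_antiderivative(2)[OF \<eta>] by simp
    then have "(LINT t|leb. h t * \<psi> t + (- I) * (h t * \<rho> t)) = 0"
      unfolding \<eta>_def by (simp add: algebra_simps)
    then have "(LINT t|leb. h t * \<psi> t) = I * c"
      using hi[OF \<psi>] hi[OF \<rho>(1)] by (simp add: c_def)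
    then show "(LINT t|leb. (h t - c) * \<psi> t) = 0"
      using hi[OF \<psi>] integrable_test[OF \<psi>] by (simp add: left_diff_distrib I_def)
  qed
  then show ?thesis by (intro exI[of _ c]) auto
qed

section \<open>Weak derivatives and zero boundary values\<close>

lemma weak_deriv_unique:
  assumes "g1 \<in> L2_space" "g2 \<in> L2_space" "has_weak_deriv v g1" "has_weak_deriv v g2"
  shows "AE t in leb. g1 t = g2 t"
proof -
  have d: "(\<lambda>t. g1 t - g2 t) \<in> L2_space" using assms by (rule_tac L2.diff_mem)
  have "AE t in leb. g1 t - g2 t = 0"
  proof (rule AE_zero_if_orthogonal_to_tests)
    show "integrable leb (\<lambda>t. g1 t - g2 t)" by (rule L2_integrable[OF d])
  next
    fix \<phi> assume \<phi>: "\<phi> \<in> test_functions"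
    have "L2_inner (\<lambda>t. g1 t - g2 t) \<phi> = 0"
      using assms \<phi> test_L2[OF \<phi>] unfolding has_weak_deriv_def by (simp add: L2.form_diff_left)
    then show "(LINT t|leb. (g1 t - g2 t) * \<phi> t) = 0" unfolding L2_inner_def .
  qed
  then show ?thesis by simp
qed

lemma H1_weak_deriv:
  assumes "v \<in> H1_space" shows "weak_deriv v \<in> L2_space" "has_weak_deriv v (weak_deriv v)"
proof -
  obtain g where "g \<in> L2_space \<and> has_weak_deriv v g"
    using assms unfolding H1_space_def by blast
  then have "weak_deriv v \<in> L2_space \<and> has_weak_deriv v (weak_deriv v)"
    unfolding weak_deriv_def by (rule someI[where P = "\<lambda>g. g \<in> L2_space \<and> has_weak_deriv v g"])
  then show "weak_deriv v \<in> L2_space" "has_weak_deriv v (weak_deriv v)" by auto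
qed

lemma H1_I: "v \<in> L2_space \<Longrightarrow> g \<in> L2_space \<Longrightarrow> has_weak_deriv v g \<Longrightarrow> v \<in> H1_space"
  unfolding H1_space_def by blast

lemma weak_deriv_AE_eq:
  assumes "v \<in> L2_space" "g \<in> L2_space" "has_weak_deriv v g"
  shows "AE t in leb. weak_deriv v t = g t"
  using H1_weak_deriv[OF H1_I[OF assms]] assms(2,3) weak_deriv_unique by blast

lemma has_weak_deriv_lincomb:
  assumes "f \<in> L2_space" "f' \<in> L2_space" "has_weak_deriv f f'"
    and "g \<in> L2_space" "g' \<in> L2_space" "has_weak_deriv g g'"
  shows "has_weak_deriv (\<lambda>t. f t + c * g t) (\<lambda>t. f' t + c * g' t)"
  using assms unfolding has_weak_deriv_def
  by (simp add: L2.form_lincomb_left test_L2 test_deriv)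

lemma has_weak_deriv_cong_AE:
  assumes "f \<in> borel_measurable leb" "g \<in> borel_measurable leb" "AE t in leb. f t = g t"
    and "has_weak_deriv g k"
  shows "has_weak_deriv f k"
proof -
  have "L2_inner f (deriv \<phi>) = L2_inner g (deriv \<phi>)" if "\<phi> \<in> test_functions" for \<phi>
    using assms(1-3) L2_measurable[OF test_L2[OF test_deriv[OF that]]]
    by (intro L2_inner_cong_AE) auto
  then show ?thesis using assms(4) unfolding has_weak_deriv_def by simp
qed

text \<open>Fubini's theorem produces the integral of \<open>g\<close> over the part to the right of \<open>t\<close>; the total integral
  drops out since derivatives of test functions have mean zero.\<close>

lemma has_weak_deriv_prim:
  assumes g: "g \<in> borel_measurable leb" and b: "AE t in leb. \<bar>g t\<bar> \<le> M"
  shows "has_weak_deriv (\<lambda>t. c + prim g t) g"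
  unfolding has_weak_deriv_def
proof
  fix \<phi> assume \<phi>: "\<phi> \<in> test_functions"
  have gi: "integrable leb g" by (rule integrable_bounded[OF g b])
  have d: "integrable leb (deriv \<phi>)" by (intro integrable_test test_deriv \<phi>)
  have pi: "integrable leb (\<lambda>t. deriv \<phi> t * prim g t)"
    using prim_bound[OF gi b] by (intro integrable_mult_bounded[OF d prim_measurable[OF gi b]]) auto
  have tail: "(LINT s|leb. indicator {t<..} s * g s) = (LINT s|leb. g s) - prim g t" for t
  proof -
    have [measurable]: "indicator {t<..} \<in> borel_measurable leb" "indicator {..<t} \<in> borel_measurable leb"
      by (intro borel_measurable_leb; simp)+
    have "AE s in leb. s \<noteq> t" using AE_leb_not_in_finite[of "{t}"] by simp
    then have "AE s in leb. indicator {t<..} s * g s = g s - indicator {..<t} s * g s"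
      by eventually_elim (auto simp: indicator_def)
    then have "(LINT s|leb. indicator {t<..} s * g s) = (LINT s|leb. g s - indicator {..<t} s * g s)"
      using g by (intro integral_cong_AE) auto
    then show ?thesis unfolding prim_def using gi by (simp add: integrable_indicator_mult)
  qed
  have "(LINT s|leb. g s * \<phi> s) = (LINT s|leb. g s * prim (deriv \<phi>) s)"
    by (rule Bochner_Integration.integral_cong) (auto simp: prim_deriv_test[OF \<phi>] Omega_iff)
  also have "\<dots> = (LINT t|leb. deriv \<phi> t * (LINT s|leb. indicator {t<..} s * g s))"
    by (rule integral_times_prim[OF leb.finite_measure_axioms _ _ gi d])
       (auto intro: borel_measurable_leb)
  also have "\<dots> = (LINT t|leb. deriv \<phi> t * (LINT s|leb. g s) - deriv \<phi> t * prim g t)"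
    unfolding tail by (simp add: right_diff_distrib)
  also have "\<dots> = - (LINT t|leb. deriv \<phi> t * prim g t)"
    using d pi by (simp add: integral_deriv_test[OF \<phi>])
  finally have *: "(LINT s|leb. g s * \<phi> s) = - (LINT t|leb. deriv \<phi> t * prim g t)" .
  have "(LINT t|leb. (c + prim g t) * deriv \<phi> t) = (LINT t|leb. c * deriv \<phi> t + deriv \<phi> t * prim g t)"
    by (simp add: distrib_left mult.commute)
  also have "\<dots> = (LINT t|leb. deriv \<phi> t * prim g t)"
    using d pi by (simp add: integral_deriv_test[OF \<phi>])
  finally show "L2_inner (\<lambda>t. c + prim g t) (deriv \<phi>) = - L2_inner g \<phi>"
    unfolding L2_inner_def using * by simp
qed

lemma prim_L2:
  assumes "g \<in> borel_measurable leb" "AE t in leb. \<bar>g t\<bar> \<le> M" shows "prim g \<in> L2_space"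
  using prim_measurable[OF integrable_bounded[OF assms] assms(2)]
    prim_bound[OF integrable_bounded[OF assms] assms(2)]
  by (intro bounded_L2[of _ M]) auto

lemma test_has_weak_deriv:
  assumes "\<phi> \<in> test_functions" shows "has_weak_deriv \<phi> (deriv \<phi>)"
proof (rule has_weak_deriv_cong_AE)
  obtain M where M: "\<And>t. \<bar>deriv \<phi> t\<bar> \<le> M" using test_bounded[OF test_deriv[OF assms]] by metis
  have m: "deriv \<phi> \<in> borel_measurable leb" by (rule L2_measurable[OF test_L2[OF test_deriv[OF assms]]])
  show "has_weak_deriv (\<lambda>t. 0 + prim (deriv \<phi>) t) (deriv \<phi>)"
    by (rule has_weak_deriv_prim[OF m]) (use M in auto)
  show "\<phi> \<in> borel_measurable leb" by (rule L2_measurable[OF test_L2[OF assms]])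
  show "(\<lambda>t. 0 + prim (deriv \<phi>) t) \<in> borel_measurable leb"
    using prim_measurable[OF integrable_test[OF test_deriv[OF assms]], of M] M by simp
  show "AE t in leb. \<phi> t = 0 + prim (deriv \<phi>) t"
    by (rule AE_leb_I) (simp add: prim_deriv_test[OF assms] Omega_iff)
qed

lemma H10_H1: "v \<in> H10_space \<Longrightarrow> v \<in> H1_space"
  by (simp add: H10_space_def)

lemma H10_L2: "v \<in> H10_space \<Longrightarrow> v \<in> L2_space"
  by (simp add: H10_space_def H1_space_def)

lemmas H10_weak_deriv = H1_weak_deriv[OF H10_H1]

text \<open>The norm is evaluated with any weak derivative \<open>g\<close> in place of the chosen one.\<close>

lemma H1_norm_minus_test:
  assumes v: "v \<in> L2_space" and g: "g \<in> L2_space" "has_weak_deriv v g" and \<phi>: "\<phi> \<in> test_functions"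
  shows "(H1_norm (\<lambda>t. v t - \<phi> t))\<^sup>2
    = (L2_norm (\<lambda>t. v t - \<phi> t))\<^sup>2 + (L2_norm (\<lambda>t. g t - deriv \<phi> t))\<^sup>2"
proof -
  have \<phi>L: "\<phi> \<in> L2_space" "deriv \<phi> \<in> L2_space" using \<phi> test_L2 test_deriv by auto
  have w: "has_weak_deriv (\<lambda>t. v t - \<phi> t) (\<lambda>t. g t - deriv \<phi> t)"
    using has_weak_deriv_lincomb[OF v g \<phi>L test_has_weak_deriv[OF \<phi>], of "- 1"] by simp
  have L: "(\<lambda>t. v t - \<phi> t) \<in> L2_space" "(\<lambda>t. g t - deriv \<phi> t) \<in> L2_space"
    using v g \<phi>L L2.diff_mem by auto
  have "L2_norm (weak_deriv (\<lambda>t. v t - \<phi> t)) = L2_norm (\<lambda>t. g t - deriv \<phi> t)"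
    using weak_deriv_AE_eq[OF L w] H1_weak_deriv(1)[OF H1_I[OF L w]] L(2)
    by (intro L2_norm_cong_AE L2_measurable) auto
  then show ?thesis unfolding H1_norm_def by simp
qed

lemma H10_I:
  assumes v: "v \<in> L2_space" and g: "g \<in> L2_space" "has_weak_deriv v g"
    and approx: "\<And>\<epsilon>. \<epsilon> > 0 \<Longrightarrow> \<exists>\<phi>\<in>test_functions. L2_norm (\<lambda>t. v t - \<phi> t) < \<epsilon> \<and>
      L2_norm (\<lambda>t. g t - deriv \<phi> t) < \<epsilon>"
  shows "v \<in> H10_space"
proof -
  have "\<exists>\<phi>\<in>test_functions. H1_norm (\<lambda>t. v t - \<phi> t) < \<epsilon>" if "\<epsilon> > 0" for \<epsilon>
  proof -
    obtain \<phi> where \<phi>: "\<phi> \<in> test_functions" "L2_norm (\<lambda>t. v t - \<phi> t) < \<epsilon> / 2"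
      "L2_norm (\<lambda>t. g t - deriv \<phi> t) < \<epsilon> / 2"
      using approx[of "\<epsilon> / 2"] half_gt_zero[OF \<open>\<epsilon> > 0\<close>] by blast
    have "(H1_norm (\<lambda>t. v t - \<phi> t))\<^sup>2 \<le> (\<epsilon> / 2)\<^sup>2 + (\<epsilon> / 2)\<^sup>2"
      unfolding H1_norm_minus_test[OF v g \<phi>(1)]
      by (intro add_mono power_mono) (use \<phi> in auto)
    also have "\<dots> < \<epsilon>\<^sup>2" using that by (simp add: power2_eq_square field_simps)
    finally show ?thesis using \<phi>(1) that power2_less_imp_less[of _ \<epsilon>] by auto
  qed
  then show ?thesis using H1_I[OF v g] unfolding H10_space_def by blast
qed

lemma H10_approx:
  assumes v: "v \<in> H10_space" and \<epsilon>: "\<epsilon> > 0"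
  obtains \<phi> where "\<phi> \<in> test_functions" "L2_norm (\<lambda>t. v t - \<phi> t) < \<epsilon>"
    "L2_norm (\<lambda>t. weak_deriv v t - deriv \<phi> t) < \<epsilon>"
proof -
  obtain \<phi> where \<phi>: "\<phi> \<in> test_functions" "H1_norm (\<lambda>t. v t - \<phi> t) < \<epsilon>"
    using assms unfolding H10_space_def by blast
  have nn: "0 \<le> H1_norm (\<lambda>t. v t - \<phi> t)" unfolding H1_norm_def by simp
  note * = H1_norm_minus_test[OF H10_L2[OF v] H10_weak_deriv[OF v] \<phi>(1)]
  have "L2_norm (\<lambda>t. v t - \<phi> t) \<le> H1_norm (\<lambda>t. v t - \<phi> t)"
    "L2_norm (\<lambda>t. weak_deriv v t - deriv \<phi> t) \<le> H1_norm (\<lambda>t. v t - \<phi> t)"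
    by (rule power2_le_imp_le[OF _ nn], unfold *, simp)+
  then show thesis using \<phi> that by fastforce
qed

lemma H10_lincomb:
  assumes f: "f \<in> H10_space" and g: "g \<in> H10_space"
  shows "(\<lambda>t. f t + c * g t) \<in> H10_space"
    and "AE t in leb. weak_deriv (\<lambda>t. f t + c * g t) t = weak_deriv f t + c * weak_deriv g t"
proof -
  note fL = H10_L2[OF f] H10_weak_deriv[OF f] and gL = H10_L2[OF g] H10_weak_deriv[OF g]
  have w: "has_weak_deriv (\<lambda>t. f t + c * g t) (\<lambda>t. weak_deriv f t + c * weak_deriv g t)"
    by (rule has_weak_deriv_lincomb[OF fL gL])
  have L: "(\<lambda>t. f t + c * g t) \<in> L2_space" "(\<lambda>t. weak_deriv f t + c * weak_deriv g t) \<in> L2_space"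
    using fL gL L2_lincomb by auto
  show "AE t in leb. weak_deriv (\<lambda>t. f t + c * g t) t = weak_deriv f t + c * weak_deriv g t"
    by (rule weak_deriv_AE_eq[OF L w])
  show "(\<lambda>t. f t + c * g t) \<in> H10_space"
  proof (rule H10_I[OF L w])
    fix \<epsilon> :: real assume e: "\<epsilon> > 0"
    define \<delta> where "\<delta> = \<epsilon> / (2 + \<bar>c\<bar>)"
    have \<delta>: "\<delta> > 0" using e unfolding \<delta>_def by simp
    have "\<delta> * (2 + \<bar>c\<bar>) = \<epsilon>" unfolding \<delta>_def by (simp add: field_simps)
    then have d\<epsilon>: "\<delta> + \<bar>c\<bar> * \<delta> < \<epsilon>" using \<delta> by (simp add: algebra_simps)
    obtain \<phi> where \<phi>: "\<phi> \<in> test_functions" "L2_norm (\<lambda>t. f t - \<phi> t) < \<delta>"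
      "L2_norm (\<lambda>t. weak_deriv f t - deriv \<phi> t) < \<delta>" using H10_approx[OF f \<delta>] by blast
    obtain \<psi> where \<psi>: "\<psi> \<in> test_functions" "L2_norm (\<lambda>t. g t - \<psi> t) < \<delta>"
      "L2_norm (\<lambda>t. weak_deriv g t - deriv \<psi> t) < \<delta>" using H10_approx[OF g \<delta>] by blast
    define \<eta> where "\<eta> = (\<lambda>t. \<phi> t + c * \<psi> t)"
    have \<eta>: "\<eta> \<in> test_functions" unfolding \<eta>_def by (rule test_lincomb[OF \<phi>(1) \<psi>(1)])
    have d\<eta>: "deriv \<eta> t = deriv \<phi> t + c * deriv \<psi> t" for t
      unfolding \<eta>_def by (rule DERIV_imp_deriv)
        (auto intro!: derivative_eq_intros smooth_has_deriv test_smooth \<phi>(1) \<psi>(1))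
    have bound: "L2_norm (\<lambda>t. u t + c * v t - (p t + c * q t)) < \<epsilon>"
      if "u \<in> L2_space" "v \<in> L2_space" "p \<in> L2_space" "q \<in> L2_space"
        "L2_norm (\<lambda>t. u t - p t) < \<delta>" "L2_norm (\<lambda>t. v t - q t) < \<delta>" for u v p q
    proof -
      have "L2_norm (\<lambda>t. (u t - p t) + c * (v t - q t))
          \<le> L2_norm (\<lambda>t. u t - p t) + \<bar>c\<bar> * L2_norm (\<lambda>t. v t - q t)"
        using that L2.diff_mem by (intro L2_norm_lincomb_le) auto
      also have "\<dots> \<le> \<delta> + \<bar>c\<bar> * \<delta>" using that by (intro add_mono mult_left_mono) auto
      also note d\<epsilon>
      finally show ?thesis by (simp add: algebra_simps)
    qed
    show "\<exists>\<phi>\<in>test_functions. L2_norm (\<lambda>t. f t + c * g t - \<phi> t) < \<epsilon> \<and>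
        L2_norm (\<lambda>t. weak_deriv f t + c * weak_deriv g t - deriv \<phi> t) < \<epsilon>"
      using \<eta> \<phi> \<psi> fL gL test_L2 test_deriv
      by (intro bexI[OF _ \<eta>]) (auto simp: d\<eta>, auto simp: \<eta>_def intro!: bound)
  qed
qed

lemma zero_H10: "(\<lambda>t. 0) \<in> H10_space"
proof (rule H10_I)
  show "has_weak_deriv (\<lambda>t. 0) (\<lambda>t. 0)" by (simp add: has_weak_deriv_def L2_inner_def)
  have z: "L2_norm (\<lambda>t. 0) = 0" by (simp add: L2_norm_def L2_inner_def)
  show "\<exists>\<phi>\<in>test_functions. L2_norm (\<lambda>t. 0 - \<phi> t) < \<epsilon> \<and> L2_norm (\<lambda>t. 0 - deriv \<phi> t) < \<epsilon>"
    if "\<epsilon> > 0" for \<epsilon>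
    using that by (intro bexI[OF _ zero_test]) (simp add: z)
qed (rule L2.zero_mem)+

text \<open>The derivative is approximated by test functions corrected to mean zero, so that their
  primitives are test functions again.\<close>

lemma prim_H10:
  assumes g: "g \<in> borel_measurable leb" and b: "AE t in leb. \<bar>g t\<bar> \<le> M"
    and mean: "(LINT t|leb. g t) = 0"
    and v: "v \<in> borel_measurable leb" "AE t in leb. v t = prim g t"
  shows "v \<in> H10_space" "AE t in leb. weak_deriv v t = g t"
proof -
  have gL: "g \<in> L2_space" by (rule bounded_L2[OF g b])
  have M: "M \<ge> 0" using integral_leb_bound[OF L2_integrable[OF gL] b] by linarith
  have pL: "prim g \<in> L2_space" by (rule prim_L2[OF g b])
  have "AE t in leb. \<bar>v t\<bar> \<le> M"
    using v(2) by eventually_elim (simp add: prim_bound[OF L2_integrable[OF gL] b])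
  then have vL: "v \<in> L2_space" by (rule bounded_L2[OF v(1)])
  have w: "has_weak_deriv v g"
    using has_weak_deriv_prim[OF g b, of 0] has_weak_deriv_cong_AE[OF v(1) L2_measurable[OF pL] v(2)]
    by simp
  show "AE t in leb. weak_deriv v t = g t" by (rule weak_deriv_AE_eq[OF vL gL w])
  obtain \<phi> where \<phi>: "\<And>n. \<phi> n \<in> test_functions" "\<And>n t. t \<in> Omega \<Longrightarrow> \<bar>\<phi> n t\<bar> \<le> M + 1"
    "AE t in leb. (\<lambda>n. \<phi> n t) \<longlonglongrightarrow> g t" using bounded_measurable_test_approx[OF g b M] by blast
  obtain \<rho> where \<rho>: "\<rho> \<in> test_functions" "(LINT t|leb. \<rho> t) = 1" by (rule unit_mass_test)
  define m where "m = (\<lambda>n. LINT t|leb. \<phi> n t)"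
  have "(\<lambda>n. LINT t|leb. 1 * \<phi> n t) \<longlonglongrightarrow> (LINT t|leb. 1 * g t)"
    by (rule integral_mult_tendsto[OF _ _ g \<phi>(2,3)]) (use \<phi>(1) test_L2 L2_measurable in auto)
  then have m0: "m \<longlonglongrightarrow> 0" unfolding m_def using mean by simp
  have AEg: "AE t in leb. \<bar>g t\<bar> \<le> M + 1" using b by eventually_elim simp
  have "(\<lambda>n. L2_norm (\<lambda>t. g t - \<phi> n t)) \<longlonglongrightarrow> 0"
    by (rule L2_tendsto[OF _ g \<phi>(2) AEg \<phi>(3)]) (use \<phi>(1) test_L2 L2_measurable in auto)
  from tendsto_add[OF this tendsto_mult[OF tendsto_rabs[OF m0] tendsto_const[of "L2_norm \<rho>"]]]
  have lim: "(\<lambda>n. L2_norm (\<lambda>t. g t - \<phi> n t) + \<bar>m n\<bar> * L2_norm \<rho>) \<longlonglongrightarrow> 0" by simp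
  show "v \<in> H10_space"
  proof (rule H10_I[OF vL gL w])
    fix \<epsilon> :: real assume "\<epsilon> > 0"
    then obtain n where n: "L2_norm (\<lambda>t. g t - \<phi> n t) + \<bar>m n\<bar> * L2_norm \<rho> < \<epsilon>"
      using order_tendstoD(2)[OF lim] unfolding eventually_sequentially by blast
    define \<eta> where "\<eta> = (\<lambda>t. \<phi> n t + (- m n) * \<rho> t)"
    have \<eta>: "\<eta> \<in> test_functions" unfolding \<eta>_def by (rule test_lincomb[OF \<phi>(1) \<rho>(1)])
    have mean\<eta>: "(LINT t|leb. \<eta> t) = 0"
      unfolding \<eta>_def using integrable_test[OF \<phi>(1)] integrable_test[OF \<rho>(1)] \<rho>(2) by (simp add: m_def)
    note prim\<eta> = mean_zero_test_antiderivative[OF \<eta> mean\<eta>]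
    have dL: "(\<lambda>t. g t - \<eta> t) \<in> L2_space" by (rule L2.diff_mem[OF gL test_L2[OF \<eta>]])
    have "L2_norm (\<lambda>t. (g t - \<phi> n t) + m n * \<rho> t) \<le> L2_norm (\<lambda>t. g t - \<phi> n t) + \<bar>m n\<bar> * L2_norm \<rho>"
      by (rule L2_norm_lincomb_le[OF L2.diff_mem[OF gL test_L2[OF \<phi>(1)]] test_L2[OF \<rho>(1)]])
    then have 1: "L2_norm (\<lambda>t. g t - \<eta> t) < \<epsilon>" unfolding \<eta>_def using n by (simp add: algebra_simps)
    have "L2_norm (\<lambda>t. v t - prim \<eta> t) \<le> L2_norm (\<lambda>t. g t - \<eta> t)"
    proof (rule L2_norm_bound)
      show "(\<lambda>t. v t - prim \<eta> t) \<in> borel_measurable leb"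
        using v(1) L2_measurable[OF test_L2[OF prim\<eta>(1)]] by simp
      show "AE t in leb. \<bar>v t - prim \<eta> t\<bar> \<le> L2_norm (\<lambda>t. g t - \<eta> t)"
        using v(2)
      proof eventually_elim
        case (elim t)
        have "prim (\<lambda>t. g t - \<eta> t) t = prim g t - prim \<eta> t"
          using prim_lincomb[OF L2_integrable[OF gL] integrable_test[OF \<eta>], of "- 1"] by simp
        then show ?case using prim_le_L2_norm[OF dL, of t] elim by simp
      qed
    qed simp
    then show "\<exists>\<phi>\<in>test_functions. L2_norm (\<lambda>t. v t - \<phi> t) < \<epsilon> \<and> L2_norm (\<lambda>t. g t - deriv \<phi> t) < \<epsilon>"
      using prim\<eta> 1 by (intro bexI[OF _ prim\<eta>(1)]) auto
  qed
qed

text \<open>For test functions the values are bounded by the norm of the derivative; the inequality passes to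
  the closure.\<close>

lemma Poincare:
  assumes v: "v \<in> H10_space" shows "L2_norm v \<le> L2_norm (weak_deriv v)"
proof (rule field_le_epsilon)
  fix e :: real assume "e > 0"
  then obtain \<phi> where \<phi>: "\<phi> \<in> test_functions" "L2_norm (\<lambda>t. v t - \<phi> t) < e / 2"
    "L2_norm (\<lambda>t. weak_deriv v t - deriv \<phi> t) < e / 2" using H10_approx[OF v, of "e / 2"] by auto
  note L = test_L2[OF \<phi>(1)] test_L2[OF test_deriv[OF \<phi>(1)]] H10_L2[OF v] H10_weak_deriv(1)[OF v]
  have "L2_norm \<phi> \<le> L2_norm (deriv \<phi>)"
  proof (rule L2_norm_bound[OF L2_measurable[OF L(1)]])
    show "AE t in leb. \<bar>\<phi> t\<bar> \<le> L2_norm (deriv \<phi>)"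
      using prim_le_L2_norm[OF L(2)] prim_deriv_test[OF \<phi>(1)]
      by (intro AE_leb_I) (metis Omega_iff atLeastAtMost_iff less_imp_le)
  qed simp
  moreover have "L2_norm v \<le> L2_norm (\<lambda>t. v t - \<phi> t) + L2_norm \<phi>"
    using L2_norm_add_le[OF L2.diff_mem[OF L(3,1)] L(1)] by simp
  moreover have "L2_norm (deriv \<phi>) \<le> L2_norm (weak_deriv v) + L2_norm (\<lambda>t. weak_deriv v t - deriv \<phi> t)"
    using L2_norm_diff_le[OF L(4) L2.diff_mem[OF L(4,2)]] by simp
  ultimately show "L2_norm v \<le> L2_norm (weak_deriv v) + e" using \<phi> by linarith
qed

text \<open>The defining identity of the weak derivative, extended from test functions to their closure.\<close>

lemma integration_by_parts_H10:
  assumes p: "p \<in> L2_space" "r \<in> L2_space" "has_weak_deriv p r" and w: "w \<in> H10_space"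
  shows "L2_inner p (weak_deriv w) = - L2_inner r w"
proof -
  have "\<bar>L2_inner p (weak_deriv w) + L2_inner r w\<bar> \<le> 0"
  proof (rule field_le_epsilon)
    fix e :: real assume e: "e > 0"
    define \<delta> where "\<delta> = e / (1 + L2_norm p + L2_norm r)"
    have pos: "0 < 1 + L2_norm p + L2_norm r" using L2_norm_nonneg[of p] L2_norm_nonneg[of r] by linarith
    then have \<delta>: "\<delta> > 0" unfolding \<delta>_def using e by simp
    have \<delta>e: "L2_norm p * \<delta> + L2_norm r * \<delta> \<le> e"
    proof -
      have "\<delta> * (1 + L2_norm p + L2_norm r) = e" using pos unfolding \<delta>_def by simp
      then show ?thesis using \<delta> by (simp add: algebra_simps)
    qed
    obtain \<phi> where \<phi>: "\<phi> \<in> test_functions" "L2_norm (\<lambda>t. w t - \<phi> t) < \<delta>"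
      "L2_norm (\<lambda>t. weak_deriv w t - deriv \<phi> t) < \<delta>" using H10_approx[OF w \<delta>] by blast
    note L = test_L2[OF \<phi>(1)] test_L2[OF test_deriv[OF \<phi>(1)]] H10_L2[OF w] H10_weak_deriv(1)[OF w]
    have "L2_inner p (weak_deriv w) + L2_inner r w
        = L2_inner p (\<lambda>t. weak_deriv w t - deriv \<phi> t) + L2_inner r (\<lambda>t. w t - \<phi> t)"
      using p L \<phi>(1) unfolding has_weak_deriv_def by (simp add: L2.form_diff_right)
    also have "\<bar>\<dots>\<bar> \<le> L2_norm p * \<delta> + L2_norm r * \<delta>"
    proof -
      have "\<bar>L2_inner p (\<lambda>t. weak_deriv w t - deriv \<phi> t)\<bar> \<le> L2_norm p * \<delta>"
        using L2_Cauchy_Schwarz[OF p(1) L2.diff_mem[OF L(4,2)]] \<phi>(3)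
        by (meson L2_norm_nonneg less_imp_le mult_left_mono order_trans)
      moreover have "\<bar>L2_inner r (\<lambda>t. w t - \<phi> t)\<bar> \<le> L2_norm r * \<delta>"
        using L2_Cauchy_Schwarz[OF p(2) L2.diff_mem[OF L(3,1)]] \<phi>(2)
        by (meson L2_norm_nonneg less_imp_le mult_left_mono order_trans)
      ultimately show ?thesis by linarith
    qed
    finally show "\<bar>L2_inner p (weak_deriv w) + L2_inner r w\<bar> \<le> 0 + e" using \<delta>e by linarith
  qed
  then show ?thesis by linarith
qed

section \<open>The energy form\<close>

locale elliptic =
  fixes a d0 :: "real \<Rightarrow> real" and \<nu> L D :: real
  assumes \<nu>: "\<nu> > 0" and a_ge: "\<And>t. t \<in> {0..1} \<Longrightarrow> \<nu> \<le> a t"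
    and a_lipschitz: "L-lipschitz_on {0..1} a"
    and d0_measurable: "d0 \<in> borel_measurable leb"
    and d0_nonneg: "AE t in leb. 0 \<le> d0 t" and d0_le: "AE t in leb. d0 t \<le> D"
    and D: "D \<ge> 0"
begin

text \<open>The Lipschitz condition yields this upper bound of the coefficient \<open>a\<close>.\<close>

definition A :: real where "A = a 0 + L"

lemma L_nonneg: "L \<ge> 0"
  by (rule lipschitz_on_nonneg[OF a_lipschitz])

lemma a_le: "t \<in> {0..1} \<Longrightarrow> a t \<le> A"
proof -
  assume t: "t \<in> {0..1}"
  have "\<bar>a t - a 0\<bar> \<le> L * \<bar>t - 0\<bar>"
    using lipschitz_onD[OF a_lipschitz t, of 0] by (simp add: dist_real_def)
  also have "\<dots> \<le> L" using t L_nonneg by (simp add: mult_left_le)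
  finally show "a t \<le> A" unfolding A_def by linarith
qed

lemma A_pos: "A > 0"
  using a_ge[of 0] \<nu> L_nonneg unfolding A_def by simp

lemma a_measurable: "a \<in> borel_measurable leb"
proof (rule continuous_imp_measurable_on_sets_lebesgue)
  show "continuous_on Omega a"
    by (rule continuous_on_subset[OF lipschitz_on_continuous_on[OF a_lipschitz]]) (auto simp: Omega_iff)
qed simp

lemma a_AE: "AE t in leb. \<bar>a t\<bar> \<le> A"
proof (rule AE_leb_I)
  fix t assume "t \<in> Omega"
  then have "t \<in> {0..1}" by (simp add: Omega_iff)
  then show "\<bar>a t\<bar> \<le> A" using a_le[of t] a_ge[of t] \<nu> by linarith
qed

lemma d0_AE: "AE t in leb. \<bar>d0 t\<bar> \<le> D"
  using d0_nonneg d0_le by eventually_elim simp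

lemma flux_L2: "f \<in> L2_space \<Longrightarrow> (\<lambda>t. a t * f t) \<in> L2_space"
  by (rule L2_mult_bounded[OF _ a_measurable a_AE])

lemma reaction_L2: "f \<in> L2_space \<Longrightarrow> (\<lambda>t. d0 t * f t) \<in> L2_space"
  by (rule L2_mult_bounded[OF _ d0_measurable d0_AE])

lemma reaction_integral_nonneg: "0 \<le> L2_inner (\<lambda>t. d0 t * f t) f"
proof -
  have "0 \<le> (LINT t|leb. d0 t * f t * f t)"
    by (rule integral_nonneg_AE, use d0_nonneg in eventually_elim)
       (metis mult.assoc mult_nonneg_nonneg zero_le_square)
  then show ?thesis unfolding L2_inner_def .
qed

lemma energy_ge:
  assumes v: "v \<in> H10_space"
  shows "\<nu> * (L2_norm (weak_deriv v))\<^sup>2 \<le> state_form a d0 v v"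
proof -
  note L = H10_weak_deriv(1)[OF v]
  have "\<nu> * (L2_norm (weak_deriv v))\<^sup>2 = (LINT t|leb. \<nu> * (weak_deriv v t * weak_deriv v t))"
    unfolding L2_norm_square L2_inner_def by simp
  also have "\<dots> \<le> (LINT t|leb. a t * weak_deriv v t * weak_deriv v t)"
    using L2_mult_integrable[OF L L] L2_mult_integrable[OF flux_L2[OF L] L] a_ge
    by (intro integral_mono) (auto simp: mult.assoc Omega_iff intro!: mult_right_mono)
  also have "\<dots> \<le> state_form a d0 v v"
    using reaction_integral_nonneg[of v] unfolding state_form_def L2_inner_def by simp
  finally show ?thesis .
qed

lemma energy_le:
  assumes v: "v \<in> H10_space"
  shows "state_form a d0 v v \<le> (A + D) * (L2_norm (weak_deriv v))\<^sup>2"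
proof -
  note L = H10_weak_deriv(1)[OF v] H10_L2[OF v]
  have "L2_inner (\<lambda>t. a t * weak_deriv v t) (weak_deriv v) \<le> (LINT t|leb. A * (weak_deriv v t * weak_deriv v t))"
    unfolding L2_inner_def
    using L2_mult_integrable[OF L(1,1)] L2_mult_integrable[OF flux_L2[OF L(1)] L(1)] a_le
    by (intro integral_mono) (auto simp: mult.assoc Omega_iff intro!: mult_right_mono)
  then have 1: "L2_inner (\<lambda>t. a t * weak_deriv v t) (weak_deriv v) \<le> A * (L2_norm (weak_deriv v))\<^sup>2"
    unfolding L2_norm_square L2_inner_def by simp
  have "L2_inner (\<lambda>t. d0 t * v t) v \<le> (LINT t|leb. D * (v t * v t))"
    unfolding L2_inner_def
  proof (rule integral_mono_AE)
    show "AE t in leb. d0 t * v t * v t \<le> D * (v t * v t)"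
      using d0_le by eventually_elim (metis mult.assoc mult_right_mono zero_le_square)
  qed (use L2_mult_integrable[OF L(2,2)] L2_mult_integrable[OF reaction_L2[OF L(2)] L(2)] in auto)
  then have "L2_inner (\<lambda>t. d0 t * v t) v \<le> D * (L2_norm v)\<^sup>2"
    unfolding L2_norm_square L2_inner_def by simp
  also have "\<dots> \<le> D * (L2_norm (weak_deriv v))\<^sup>2"
    using Poincare[OF v] D by (intro mult_left_mono power_mono) auto
  finally show ?thesis using 1 unfolding state_form_def by (simp add: algebra_simps)
qed

lemma energy_ge_L2: "v \<in> H10_space \<Longrightarrow> \<nu> * (L2_norm v)\<^sup>2 \<le> state_form a d0 v v"
  using energy_ge[of v] Poincare[of v] \<nu> power_mono[of "L2_norm v" "L2_norm (weak_deriv v)" 2]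
    mult_left_mono[of "(L2_norm v)\<^sup>2" "(L2_norm (weak_deriv v))\<^sup>2" \<nu>] L2_norm_nonneg[of v]
  by linarith

sublocale energy: semidefinite_form H10_space "state_form a d0"
proof
  show "(\<lambda>t. 0) \<in> H10_space" by (rule zero_H10)
next
  fix f g k c assume H: "f \<in> H10_space" "g \<in> H10_space" "k \<in> H10_space"
  note L = H10_L2[OF H(1)] H10_L2[OF H(2)] H10_L2[OF H(3)]
    and W = H10_weak_deriv(1)[OF H(1)] H10_weak_deriv(1)[OF H(2)] H10_weak_deriv(1)[OF H(3)]
  have "L2_inner (\<lambda>t. a t * weak_deriv (\<lambda>t. f t + c * g t) t) (weak_deriv k)
      = L2_inner (\<lambda>t. a t * weak_deriv f t + c * (a t * weak_deriv g t)) (weak_deriv k)"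
  proof (rule L2_inner_cong_AE)
    show "AE t in leb. a t * weak_deriv (\<lambda>t. f t + c * g t) t = a t * weak_deriv f t + c * (a t * weak_deriv g t)"
      using H10_lincomb(2)[OF H(1,2), of c] by eventually_elim (simp add: algebra_simps)
  qed (use W H10_weak_deriv(1)[OF H10_lincomb(1)[OF H(1,2)]] a_measurable L2_measurable in
      \<open>auto intro!: borel_measurable_times borel_measurable_add\<close>)
  also have "\<dots> = L2_inner (\<lambda>t. a t * weak_deriv f t) (weak_deriv k) + c * L2_inner (\<lambda>t. a t * weak_deriv g t) (weak_deriv k)"
    using W flux_L2 by (intro L2.form_lincomb_left) auto
  moreover have "L2_inner (\<lambda>t. d0 t * (f t + c * g t)) k = L2_inner (\<lambda>t. d0 t * f t) k + c * L2_inner (\<lambda>t. d0 t * g t) k"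
    using L2.form_lincomb_left[OF reaction_L2[OF L(1)] reaction_L2[OF L(2)] L(3), of c]
    by (simp add: algebra_simps)
  ultimately show "state_form a d0 (\<lambda>t. f t + c * g t) k = state_form a d0 f k + c * state_form a d0 g k"
    unfolding state_form_def by (simp add: algebra_simps)
next
  fix f g show "state_form a d0 f g = state_form a d0 g f"
    unfolding state_form_def L2_inner_def by (simp add: mult_ac)
next
  fix f assume f: "f \<in> H10_space"
  have "0 \<le> \<nu> * (L2_norm (weak_deriv f))\<^sup>2" using \<nu> by simp
  then show "0 \<le> state_form a d0 f f" using energy_ge[OF f] by linarith
qed (rule H10_lincomb(1))

text \<open>Coercivity makes solutions unique as elements of the space, for any trial space.\<close>

lemma is_state_unique:
  assumes W: "W \<subseteq> H10_space" "\<And>f g. f \<in> W \<Longrightarrow> g \<in> W \<Longrightarrow> (\<lambda>t. f t - g t) \<in> W"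
    and u: "is_state a d0 W q u" "is_state a d0 W q v"
  shows "AE t in leb. u t = v t"
proof -
  have uv: "u \<in> W" "v \<in> W" using u unfolding is_state_def by auto
  define e where "e = (\<lambda>t. u t - v t)"
  have e: "e \<in> W" unfolding e_def by (rule W(2)[OF uv])
  have eH: "e \<in> H10_space" using e W(1) by auto
  have "state_form a d0 e e = state_form a d0 u e - state_form a d0 v e"
    using uv W(1) eH by (subst e_def) (auto intro!: energy.form_diff_left)
  also have "\<dots> = 0" using u e unfolding is_state_def by auto
  finally have "\<nu> * (L2_norm e)\<^sup>2 \<le> 0" using energy_ge_L2[OF eH] by simp
  then have "L2_norm e = 0" using \<nu> by (simp add: mult_le_0_iff)
  then show ?thesis using L2_norm_0_AE[OF H10_L2[OF eH]] unfolding e_def by auto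
qed

lemma is_state_lincomb:
  assumes "W \<subseteq> H10_space" "\<And>f g c. f \<in> W \<Longrightarrow> g \<in> W \<Longrightarrow> (\<lambda>t. f t + c * g t) \<in> W"
    and "p \<in> L2_space" "q \<in> L2_space" "is_state a d0 W p u" "is_state a d0 W q v"
  shows "is_state a d0 W (\<lambda>t. p t + c * q t) (\<lambda>t. u t + c * v t)"
proof -
  have "state_form a d0 (\<lambda>t. u t + c * v t) w = L2_inner (\<lambda>t. p t + c * q t) w" if w: "w \<in> W" for w
  proof -
    have "w \<in> H10_space" "w \<in> L2_space" using w assms(1) H10_L2 by auto
    then show ?thesis
      using assms w unfolding is_state_def
      by (simp add: energy.form_lincomb_left L2.form_lincomb_left subset_iff)
  qed
  then show ?thesis using assms unfolding is_state_def by blast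
qed

text \<open>The energy estimate, valid for the discrete trial spaces as well: the solution belongs to the
  space of functions that it is tested with.\<close>

lemma state_deriv_bound:
  assumes W: "W \<subseteq> H10_space" and q: "q \<in> L2_space" and u: "is_state a d0 W q u"
  shows "L2_norm (weak_deriv u) \<le> L2_norm q / \<nu>"
proof -
  have uW: "u \<in> W" using u unfolding is_state_def by auto
  then have uH: "u \<in> H10_space" using W by auto
  have "\<nu> * (L2_norm (weak_deriv u))\<^sup>2 \<le> L2_inner q u"
    using energy_ge[OF uH] u uW unfolding is_state_def by simp
  also have "\<dots> \<le> L2_norm q * L2_norm u"
    using L2_Cauchy_Schwarz[OF q H10_L2[OF uH]] by linarith
  also have "\<dots> \<le> L2_norm q * L2_norm (weak_deriv u)"
    by (intro mult_left_mono Poincare uH) simp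
  finally have "\<nu> * L2_norm (weak_deriv u) * L2_norm (weak_deriv u) \<le> L2_norm q * L2_norm (weak_deriv u)"
    by (simp add: power2_eq_square mult.assoc)
  then have "\<nu> * L2_norm (weak_deriv u) \<le> L2_norm q"
    using L2_norm_nonneg[of "weak_deriv u"] L2_norm_nonneg[of q]
    by (cases "L2_norm (weak_deriv u) = 0") (auto simp: mult_le_cancel_right)
  then show ?thesis using \<nu> by (simp add: field_simps)
qed

end

section \<open>Solving the state equation\<close>

text \<open>Measurability and a bound almost everywhere travel together through all constructions below, and
  the bounds enter the constants of the error estimate.\<close>

definition ess_bounded :: "(real \<Rightarrow> real) \<Rightarrow> real \<Rightarrow> bool" where
  "ess_bounded f M \<longleftrightarrow> f \<in> borel_measurable leb \<and> (AE t in leb. \<bar>f t\<bar> \<le> M)"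

lemma ess_bounded_I:
  "f \<in> borel_measurable leb \<Longrightarrow> (\<And>t. t \<in> Omega \<Longrightarrow> \<bar>f t\<bar> \<le> M) \<Longrightarrow> ess_bounded f M"
  unfolding ess_bounded_def using AE_leb_I by auto

lemma ess_bounded_measurable: "ess_bounded f M \<Longrightarrow> f \<in> borel_measurable leb"
  by (simp add: ess_bounded_def)

lemma ess_bounded_integrable: "ess_bounded f M \<Longrightarrow> integrable leb f"
  unfolding ess_bounded_def by (auto intro: integrable_bounded)

lemma ess_bounded_L2: "ess_bounded f M \<Longrightarrow> f \<in> L2_space"
  unfolding ess_bounded_def by (auto intro: bounded_L2)

lemma ess_bounded_nonneg: "ess_bounded f M \<Longrightarrow> M \<ge> 0"
  by (rule order_trans[OF abs_ge_zero integral_leb_bound[OF ess_bounded_integrable]])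
     (auto simp: ess_bounded_def)

lemma ess_bounded_L2_norm: "ess_bounded f M \<Longrightarrow> L2_norm f \<le> M"
  using ess_bounded_nonneg L2_norm_bound unfolding ess_bounded_def by blast

lemma ess_bounded_add:
  assumes "ess_bounded f M" "ess_bounded g N" shows "ess_bounded (\<lambda>t. f t + g t) (M + N)"
proof -
  have "AE t in leb. \<bar>f t\<bar> \<le> M" "AE t in leb. \<bar>g t\<bar> \<le> N" using assms unfolding ess_bounded_def by auto
  then have "AE t in leb. \<bar>f t + g t\<bar> \<le> M + N" by eventually_elim linarith
  then show ?thesis using assms unfolding ess_bounded_def by auto
qed

lemma ess_bounded_diff:
  assumes "ess_bounded f M" "ess_bounded g N" shows "ess_bounded (\<lambda>t. f t - g t) (M + N)"
proof -
  have "AE t in leb. \<bar>f t\<bar> \<le> M" "AE t in leb. \<bar>g t\<bar> \<le> N" using assms unfolding ess_bounded_def by auto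
  then have "AE t in leb. \<bar>f t - g t\<bar> \<le> M + N" by eventually_elim linarith
  then show ?thesis using assms unfolding ess_bounded_def by auto
qed

lemma ess_bounded_mult:
  assumes "ess_bounded f M" "ess_bounded g N" shows "ess_bounded (\<lambda>t. f t * g t) (M * N)"
proof -
  have "AE t in leb. \<bar>f t\<bar> \<le> M" "AE t in leb. \<bar>g t\<bar> \<le> N" using assms unfolding ess_bounded_def by auto
  then have "AE t in leb. \<bar>f t * g t\<bar> \<le> M * N"
  proof eventually_elim
    case (elim t)
    then show ?case unfolding abs_mult by (intro mult_mono) auto
  qed
  then show ?thesis using assms unfolding ess_bounded_def by auto
qed

lemma ess_bounded_const: "ess_bounded (\<lambda>t. c) \<bar>c\<bar>"
  by (rule ess_bounded_I) auto

lemma ess_bounded_cong_AE: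
  assumes "ess_bounded g M" "f \<in> borel_measurable leb" "AE t in leb. f t = g t"
  shows "ess_bounded f M"
proof -
  have "AE t in leb. \<bar>g t\<bar> \<le> M" using assms(1) unfolding ess_bounded_def by simp
  with assms(3) have "AE t in leb. \<bar>f t\<bar> \<le> M" by eventually_elim simp
  then show ?thesis using assms(2) unfolding ess_bounded_def by simp
qed

lemma ess_bounded_continuous:
  assumes "continuous_on UNIV f" "\<And>t. \<bar>f t\<bar> \<le> M" shows "ess_bounded f M"
  by (rule ess_bounded_I) (auto intro: assms borel_measurable_leb borel_measurable_continuous_onI)

lemma prim_ess_bounded_continuous: "ess_bounded g M \<Longrightarrow> continuous_on S (prim g)"
  using continuous_on_prim[OF ess_bounded_integrable] unfolding ess_bounded_def by blast

lemma prim_ess_bound: "ess_bounded g M \<Longrightarrow> \<bar>prim g t\<bar> \<le> M"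
  using prim_bound[OF ess_bounded_integrable] unfolding ess_bounded_def by blast

lemma prim_ess_lipschitz: "ess_bounded g M \<Longrightarrow> \<bar>prim g t - prim g s\<bar> \<le> M * \<bar>t - s\<bar>"
  using prim_lipschitz[OF ess_bounded_integrable] unfolding ess_bounded_def by blast

lemma ess_bounded_prim: "ess_bounded g M \<Longrightarrow> ess_bounded (prim g) M"
  by (rule ess_bounded_continuous) (auto intro: prim_ess_bounded_continuous prim_ess_bound)

lemma prim_cmult: "prim (\<lambda>t. c * g t) x = c * prim g x"
  unfolding prim_def by (simp add: mult.left_commute)

lemma prim_add_ess_bounded:
  assumes "ess_bounded f M" "ess_bounded g N"
  shows "prim (\<lambda>t. f t + c * g t) x = prim f x + c * prim g x"
  by (rule prim_lincomb[OF assms[THEN ess_bounded_integrable]])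

lemma prim_diff_ess_bounded:
  assumes "ess_bounded f M" "ess_bounded g N"
  shows "prim (\<lambda>t. f t - g t) x = prim f x - prim g x"
  using prim_add_ess_bounded[OF assms, of "- 1" x] by simp

lemma prim_abs_le:
  assumes f: "integrable leb f" and g: "integrable leb g" and le: "AE t in leb. \<bar>f t\<bar> \<le> g t"
  shows "\<bar>prim f x\<bar> \<le> prim g x"
proof -
  have "\<bar>prim f x\<bar> \<le> (LINT s|leb. \<bar>indicator {..<x} s * f s\<bar>)"
    unfolding prim_def using integral_norm_bound[of leb "\<lambda>s. indicator {..<x} s * f s"] by simp
  also have "\<dots> \<le> prim g x"
    unfolding prim_def using f g le
    by (intro integral_mono_AE integrable_abs integrable_indicator_mult)
       (auto simp: indicator_def elim!: eventually_mono)
  finally show ?thesis .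
qed

context elliptic
begin

lemma ess_bounded_d0: "ess_bounded d0 D"
  unfolding ess_bounded_def using d0_measurable d0_AE by simp

lemma ess_bounded_div_a:
  assumes "ess_bounded f M" shows "ess_bounded (\<lambda>t. f t / a t) (M / \<nu>)"
proof -
  have "ess_bounded (\<lambda>t. 1 / a t) (1 / \<nu>)"
  proof (rule ess_bounded_I)
    show "(\<lambda>t. 1 / a t) \<in> borel_measurable leb" using a_measurable by simp
    show "\<bar>1 / a t\<bar> \<le> 1 / \<nu>" if "t \<in> Omega" for t
      using a_ge[of t] that \<nu> by (simp add: Omega_iff frac_le)
  qed
  from ess_bounded_mult[OF assms this] show ?thesis by simp
qed

text \<open>The Volterra operator becomes a contraction in the supremum norm weighted with
  \<open>exp (- k x)\<close> once the rate \<open>k\<close> is large enough.\<close>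

lemma volterra:
  assumes G: "continuous_on UNIV G" "\<And>x. \<bar>G x\<bar> \<le> Gb"
  shows "\<exists>u N. continuous_on UNIV u \<and> (\<forall>x. \<bar>u x\<bar> \<le> N) \<and>
    (\<forall>x. u x = G x + prim (\<lambda>t. prim (\<lambda>s. d0 s * u s) t / a t) x)"
proof -
  \<comment> \<open>this rate makes the contraction factor \<open>D / (\<nu> * k)\<close> at most one half\<close>
  define k where "k = 2 * D / \<nu> + 1"
  have k: "k > 0" unfolding k_def using D \<nu> by (simp add: add_nonneg_pos)
  have kD: "D / (\<nu> * k) \<le> 1 / 2"
  proof -
    have "\<nu> * k = 2 * D + \<nu>" unfolding k_def using \<nu> by (simp add: distrib_left)
    then show ?thesis using D \<nu> by (simp add: divide_le_eq)
  qed
  define c where "c = (\<lambda>x::real. max 0 (min 1 x))"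
  define E where "E = (\<lambda>x. exp (k * c x))"
  have Econt: "continuous_on UNIV E" unfolding E_def c_def by (intro continuous_intros)
  have E1: "1 \<le> E x" for x unfolding E_def c_def using k by simp
  have Eb: "\<bar>E x\<bar> \<le> exp k" for x
    unfolding E_def c_def using k by (auto simp: mult_left_le)
  have Emono: "E s \<le> E t" if "s \<le> t" for s t
    unfolding E_def c_def using k that by (auto intro!: mult_left_mono)
  have EB: "ess_bounded E (exp k)" by (rule ess_bounded_continuous[OF Econt Eb])
  have primE: "prim E x \<le> E x / k" for x
  proof -
    have *: "prim E x = E x / k - E 0 / k" if "x \<in> {0..1}" for x
    proof (rule prim_FTC[of "{}" "\<lambda>x. E x / k"])
      show "((\<lambda>x. E x / k) has_real_derivative E t) (at t)" if "t \<in> Omega - {}" for t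
      proof -
        have "((\<lambda>x. exp (k * x) / k) has_real_derivative E t) (at t)"
          using k that by (auto intro!: derivative_eq_intros simp: E_def c_def Omega_iff)
        then show ?thesis
          by (rule has_field_derivative_transform_within_open[of _ _ _ "{0<..<1}"])
             (use that in \<open>auto simp: E_def c_def Omega_iff\<close>)
      qed
    qed (use that EB k in \<open>auto intro!: continuous_intros continuous_on_subset[OF Econt]
         intro: ess_bounded_integrable\<close>)
    consider "x < 0" | "x \<in> {0..1}" | "x > 1" by force
    then show ?thesis
    proof cases
      case 1 then show ?thesis using E1[of x] k by simp
    next
      case 2 then show ?thesis using *[OF 2] E1[of 0] k by simp
    next
      case 3
      have "prim E x = prim E 1" using 3 by (simp add: prim_1)
      moreover have "E x = E 1" using 3 by (simp add: E_def c_def)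
      ultimately show ?thesis using *[of 1] E1[of 0] k by simp
    qed
  qed
  define K where "K = (\<lambda>w x. prim (\<lambda>t. prim (\<lambda>s. d0 s * (E s * w s)) t / a t) x)"
  have KB: "ess_bounded (\<lambda>t. prim (\<lambda>s. d0 s * (E s * w s)) t / a t) (D * (exp k * N) / \<nu>)"
    if "ess_bounded w N" for w N
    by (intro ess_bounded_div_a ess_bounded_prim ess_bounded_mult ess_bounded_d0 EB that)
  have Kdiff: "\<bar>K w x - K w' x\<bar> \<le> N / 2 * E x"
    if w: "ess_bounded w M" "ess_bounded w' M'" and N: "\<And>s. \<bar>w s - w' s\<bar> \<le> N" for w w' M M' N x
  proof -
    have N0: "N \<ge> 0" using N[of 0] by linarith
    have zz: "ess_bounded (\<lambda>s. w s - w' s) (M + M')" by (rule ess_bounded_diff[OF w])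
    define z where "z = (\<lambda>s. d0 s * (E s * (w s - w' s)))"
    have zB: "ess_bounded z (D * (exp k * (M + M')))"
      unfolding z_def by (intro ess_bounded_mult ess_bounded_d0 EB zz)
    have in_eq: "prim (\<lambda>s. d0 s * (E s * w s)) t - prim (\<lambda>s. d0 s * (E s * w' s)) t = prim z t" for t
      unfolding z_def
      using prim_diff_ess_bounded[OF ess_bounded_mult[OF ess_bounded_d0 ess_bounded_mult[OF EB w(1)]]
          ess_bounded_mult[OF ess_bounded_d0 ess_bounded_mult[OF EB w(2)]], of t]
      by (simp add: algebra_simps)
    have "K w x - K w' x = prim (\<lambda>t. prim z t / a t) x"
      unfolding K_def prim_diff_ess_bounded[OF KB[OF w(1)] KB[OF w(2)], symmetric]
      by (simp add: in_eq[symmetric] diff_divide_distrib)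
    also have "\<bar>\<dots>\<bar> \<le> prim (\<lambda>t. (D * N / \<nu>) * E t) x"
    proof (rule prim_abs_le)
      show "integrable leb (\<lambda>t. prim z t / a t)"
        by (rule ess_bounded_integrable[OF ess_bounded_div_a[OF ess_bounded_prim[OF zB]]])
      show "integrable leb (\<lambda>t. (D * N / \<nu>) * E t)"
        using ess_bounded_integrable[OF EB] by simp
      show "AE t in leb. \<bar>prim z t / a t\<bar> \<le> (D * N / \<nu>) * E t"
      proof (rule AE_leb_I)
        fix t assume t: "t \<in> Omega"
        have "AE r in leb. r \<in> {0..<t} \<longrightarrow> \<bar>z r\<bar> \<le> D * (E t * N)"
          using d0_AE
        proof eventually_elim
          case (elim r)
          show ?case
          proof
            assume "r \<in> {0..<t}"
            then have "E r \<le> E t" by (intro Emono) simp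
            then show "\<bar>z r\<bar> \<le> D * (E t * N)"
              unfolding z_def abs_mult using elim N[of r] E1[of r] N0 D
              by (intro mult_mono) auto
          qed
        qed
        moreover have "0 \<le> D * (E t * N)" using D N0 E1[of t] by simp
        moreover have t0: "0 \<le> t" using t by (simp add: Omega_iff)
        ultimately have "\<bar>prim z t - prim z 0\<bar> \<le> D * (E t * N) * (t - 0)"
          unfolding prim_diff_eq[OF ess_bounded_integrable[OF zB] t0]
          by (intro integral_over_interval_le[OF ess_bounded_integrable[OF zB] t0])
        also have "\<dots> \<le> D * (E t * N)"
          using t \<open>0 \<le> D * (E t * N)\<close> unfolding Omega_iff by (simp add: mult_left_le)
        finally have pz: "\<bar>prim z t\<bar> \<le> D * (E t * N)" by simp
        have at: "\<nu> \<le> a t" using a_ge[of t] t by (simp add: Omega_iff)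
        have "\<bar>prim z t / a t\<bar> \<le> D * (E t * N) / \<nu>"
          unfolding abs_divide using pz at \<nu> by (intro frac_le) auto
        then show "\<bar>prim z t / a t\<bar> \<le> (D * N / \<nu>) * E t" by (simp add: mult_ac)
      qed
    qed
    also have "\<dots> \<le> (D * N / \<nu>) * (E x / k)"
      unfolding prim_cmult using primE[of x] D N0 \<nu> by (intro mult_left_mono) auto
    also have "\<dots> = D / (\<nu> * k) * (N * E x)" by simp
    also have "\<dots> \<le> 1 / 2 * (N * E x)"
      using kD N0 E1[of x] by (intro mult_right_mono) auto
    finally show ?thesis by simp
  qed
  \<comment> \<open>the fixed point equation for \<open>w = u / E\<close>\<close>
  define F where "F = (\<lambda>w x. (G x + K w x) / E x)"
  have wB: "\<exists>M. ess_bounded (apply_bcontfun w) M" for w :: "real \<Rightarrow>\<^sub>C real"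
  proof -
    obtain M where "\<And>x. \<bar>apply_bcontfun w x\<bar> \<le> M"
      using bounded_apply_bcontfun[of w] unfolding bounded_iff by auto
    then show ?thesis using ess_bounded_continuous[of "apply_bcontfun w" M] by auto
  qed
  have F: "F (apply_bcontfun w) \<in> bcontfun" for w :: "real \<Rightarrow>\<^sub>C real"
  proof -
    obtain M where M: "ess_bounded (apply_bcontfun w) M" using wB by blast
    have "continuous_on UNIV (F (apply_bcontfun w))"
      unfolding F_def K_def using E1
      by (intro continuous_intros G(1) Econt prim_ess_bounded_continuous[OF KB[OF M]]) (metis not_one_le_zero)
    moreover have "norm (F (apply_bcontfun w) x) \<le> Gb + D * (exp k * M) / \<nu>" for x
    proof -
      have "\<bar>F (apply_bcontfun w) x\<bar> \<le> \<bar>G x + K (apply_bcontfun w) x\<bar>"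
        unfolding F_def abs_divide using E1[of x] by (simp add: divide_le_eq mult_left_le mult_le_cancel_left1)
      also have "\<dots> \<le> Gb + D * (exp k * M) / \<nu>"
        using G(2)[of x] prim_ess_bound[OF KB[OF M], of x] unfolding K_def by linarith
      finally show ?thesis by simp
    qed
    ultimately show ?thesis by (rule bcontfun_normI)
  qed
  define T where "T = (\<lambda>w. Bcontfun (F (apply_bcontfun w)))"
  have T: "apply_bcontfun (T w) = F (apply_bcontfun w)" for w
    unfolding T_def by (rule Bcontfun_inverse[OF F])
  have "\<exists>!w. T w = w"
  proof (rule banach_fix_type)
    show "\<forall>w w'. dist (T w) (T w') \<le> 1 / 2 * dist w w'"
    proof (intro allI dist_bound)
      fix w w' :: "real \<Rightarrow>\<^sub>C real" and x
      obtain M M' where M: "ess_bounded (apply_bcontfun w) M" "ess_bounded (apply_bcontfun w') M'"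
        using wB by blast
      have "\<bar>apply_bcontfun w s - apply_bcontfun w' s\<bar> \<le> dist w w'" for s
        using dist_bounded[of w s w'] by (simp add: dist_real_def)
      from Kdiff[OF M this] have "\<bar>K (apply_bcontfun w) x - K (apply_bcontfun w') x\<bar> \<le> dist w w' / 2 * E x" .
      then have "\<bar>(K (apply_bcontfun w) x - K (apply_bcontfun w') x) / E x\<bar> \<le> dist w w' / 2"
        unfolding abs_divide using E1[of x] by (simp add: divide_le_eq)
      moreover have "F (apply_bcontfun w) x - F (apply_bcontfun w') x
          = (K (apply_bcontfun w) x - K (apply_bcontfun w') x) / E x"
        unfolding F_def by (simp add: diff_divide_distrib add_divide_distrib)
      ultimately show "dist (apply_bcontfun (T w) x) (apply_bcontfun (T w') x) \<le> 1 / 2 * dist w w'"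
        unfolding T dist_real_def by simp
    qed
  qed auto
  then obtain w where w: "T w = w" by blast
  obtain M where M: "\<And>x. \<bar>apply_bcontfun w x\<bar> \<le> M"
    using bounded_apply_bcontfun[of w] unfolding bounded_iff by auto
  define u where "u = (\<lambda>x. E x * apply_bcontfun w x)"
  have "u x = G x + K (apply_bcontfun w) x" for x
    using fun_cong[OF T[of w], of x] E1[of x] unfolding w u_def F_def by simp
  moreover have "continuous_on UNIV u" unfolding u_def by (intro continuous_intros Econt) simp
  moreover have "\<bar>u x\<bar> \<le> exp k * M" for x
    unfolding u_def abs_mult using Eb[of x] M[of x] by (intro mult_mono) auto
  ultimately show ?thesis unfolding K_def u_def by blast
qed

text \<open>The first integral of the equation: \<open>flux f k u\<close> is \<open>a u'\<close> for a solution \<open>u\<close> with right-hand side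
  \<open>f\<close> and \<open>a u' = k\<close> at the left end, where \<open>u\<close> vanishes.\<close>

definition flux :: "(real \<Rightarrow> real) \<Rightarrow> real \<Rightarrow> (real \<Rightarrow> real) \<Rightarrow> real \<Rightarrow> real" where
  "flux f k u t = k + prim (\<lambda>s. d0 s * u s - f s) t"

definition ivp :: "(real \<Rightarrow> real) \<Rightarrow> real \<Rightarrow> (real \<Rightarrow> real) \<Rightarrow> bool" where
  "ivp f k u \<longleftrightarrow> (\<exists>N. ess_bounded u N) \<and> u = prim (\<lambda>t. flux f k u t / a t)"

lemma ess_bounded_source:
  assumes "ess_bounded f B" "ess_bounded u N" shows "ess_bounded (\<lambda>s. d0 s * u s - f s) (D * N + B)"
  by (intro ess_bounded_diff ess_bounded_mult ess_bounded_d0 assms)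

lemma ess_bounded_flux:
  assumes "ess_bounded f B" "ess_bounded u N" shows "ess_bounded (flux f k u) (\<bar>k\<bar> + (D * N + B))"
  unfolding flux_def
  by (intro ess_bounded_add[OF ess_bounded_const] ess_bounded_prim ess_bounded_source assms)

lemma ivp_exists:
  assumes f: "ess_bounded f B" shows "\<exists>u. ivp f k u"
proof -
  have fB: "ess_bounded (\<lambda>t. (k - prim f t) / a t) ((\<bar>k\<bar> + B) / \<nu>)"
    by (intro ess_bounded_div_a ess_bounded_diff ess_bounded_const ess_bounded_prim f)
  obtain u N where u: "continuous_on UNIV u" "\<And>x. \<bar>u x\<bar> \<le> N"
    and eq: "\<And>x. u x = prim (\<lambda>t. (k - prim f t) / a t) x + prim (\<lambda>t. prim (\<lambda>s. d0 s * u s) t / a t) x"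
    using volterra[OF prim_ess_bounded_continuous[OF fB] prim_ess_bound[OF fB]] by blast
  have uB: "ess_bounded u N" by (rule ess_bounded_continuous[OF u])
  have dB: "ess_bounded (\<lambda>s. d0 s * u s) (D * N)" by (intro ess_bounded_mult ess_bounded_d0 uB)
  have "u x = prim (\<lambda>t. flux f k u t / a t) x" for x
  proof -
    have "u x = prim (\<lambda>t. (k - prim f t) / a t + 1 * (prim (\<lambda>s. d0 s * u s) t / a t)) x"
      using eq[of x] prim_add_ess_bounded[OF fB ess_bounded_div_a[OF ess_bounded_prim[OF dB]], of 1 x] by simp
    also have "(\<lambda>t. (k - prim f t) / a t + 1 * (prim (\<lambda>s. d0 s * u s) t / a t)) = (\<lambda>t. flux f k u t / a t)"
      unfolding flux_def using prim_diff_ess_bounded[OF dB f]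
      by (simp add: fun_eq_iff diff_divide_distrib add_divide_distrib)
    finally show ?thesis .
  qed
  then show ?thesis unfolding ivp_def using uB by blast
qed

lemma ivp_lincomb:
  assumes "ess_bounded f B" "ivp f k u" "ivp (\<lambda>t. 0) m w"
  shows "ivp f (k + c * m) (\<lambda>t. u t + c * w t)"
proof -
  obtain N N' where B: "ess_bounded u N" "ess_bounded w N'" using assms unfolding ivp_def by blast
  have B0: "ess_bounded (\<lambda>t. 0) 0" by (rule ess_bounded_I) auto
  have uw: "ess_bounded (\<lambda>t. u t + c * w t) (N + \<bar>c\<bar> * N')"
    by (intro ess_bounded_add ess_bounded_mult ess_bounded_const B)
  have "flux f (k + c * m) (\<lambda>t. u t + c * w t) t = flux f k u t + c * flux (\<lambda>t. 0) m w t" for t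
    unfolding flux_def
    using prim_add_ess_bounded[OF ess_bounded_source[OF assms(1) B(1)] ess_bounded_source[OF B0 B(2)], of c t]
    by (simp add: algebra_simps)
  then have "prim (\<lambda>t. flux f (k + c * m) (\<lambda>t. u t + c * w t) t / a t) x = u x + c * w x" for x
    using prim_add_ess_bounded[OF ess_bounded_div_a[OF ess_bounded_flux[OF assms(1) B(1)]]
        ess_bounded_div_a[OF ess_bounded_flux[OF B0 B(2)]], of k c m x] assms(2,3)
    unfolding ivp_def by (simp add: add_divide_distrib)
  then show ?thesis unfolding ivp_def using uw by (auto simp: fun_eq_iff)
qed

text \<open>A solution of the initial value problem that also vanishes at the right end is a weak solution:
  integrate the flux by parts against an arbitrary member of \<open>H10_space\<close>.\<close>

lemma ivp_zero_end_state:
  assumes f: "ess_bounded f B" and u: "ivp f k u" and u1: "u 1 = 0"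
  shows "is_state a d0 H10_space f u" and "AE t in leb. weak_deriv u t = flux f k u t / a t"
proof -
  obtain N where N: "ess_bounded u N" and eq: "u = prim (\<lambda>t. flux f k u t / a t)"
    using u unfolding ivp_def by blast
  note gB = ess_bounded_div_a[OF ess_bounded_flux[OF f N, of k]]
  have mean: "(LINT t|leb. flux f k u t / a t) = 0"
    using u1 fun_cong[OF eq, of 1] by (simp add: prim_1)
  note H = prim_H10[OF ess_bounded_measurable[OF gB] _ mean ess_bounded_measurable[OF N]]
  have AEg: "AE t in leb. \<bar>flux f k u t / a t\<bar> \<le> (\<bar>k\<bar> + (D * N + B)) / \<nu>"
    using gB unfolding ess_bounded_def by simp
  have AEu: "AE t in leb. u t = prim (\<lambda>t. flux f k u t / a t) t" using eq by (simp add: fun_eq_iff)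
  have uH: "u \<in> H10_space" by (rule H(1)[OF AEg AEu])
  show d: "AE t in leb. weak_deriv u t = flux f k u t / a t" by (rule H(2)[OF AEg AEu])
  have r: "ess_bounded (\<lambda>s. d0 s * u s - f s) (D * N + B)" by (rule ess_bounded_source[OF f N])
  have "state_form a d0 u w = L2_inner f w" if w: "w \<in> H10_space" for w
  proof -
    have "L2_inner (\<lambda>t. a t * weak_deriv u t) (weak_deriv w) = L2_inner (flux f k u) (weak_deriv w)"
    proof (rule L2_inner_cong_AE)
      show "AE t in leb. a t * weak_deriv u t = flux f k u t"
        using d AE_space
      proof eventually_elim
        case (elim t)
        then have "a t > 0" using a_ge[of t] \<nu> by (simp add: Omega_iff)
        then show ?case using elim by simp
      qed
    qed (use L2_measurable[OF H10_weak_deriv(1)[OF uH]] L2_measurable[OF H10_weak_deriv(1)[OF w]]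
          a_measurable ess_bounded_measurable[OF ess_bounded_flux[OF f N]] in auto)
    also have "\<dots> = - L2_inner (\<lambda>s. d0 s * u s - f s) w"
    proof (rule integration_by_parts_H10[OF _ ess_bounded_L2[OF r] _ w])
      show "flux f k u \<in> L2_space" by (rule ess_bounded_L2[OF ess_bounded_flux[OF f N]])
      show "has_weak_deriv (flux f k u) (\<lambda>s. d0 s * u s - f s)"
        using has_weak_deriv_prim[of "\<lambda>s. d0 s * u s - f s" "D * N + B" k] r
        unfolding ess_bounded_def flux_def by simp
    qed
    also have "\<dots> = L2_inner f w - L2_inner (\<lambda>t. d0 t * u t) w"
      using L2.form_diff_left[OF reaction_L2[OF ess_bounded_L2[OF N]] ess_bounded_L2[OF f] H10_L2[OF w]] by simp
    finally show ?thesis unfolding state_form_def by simp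
  qed
  then show "is_state a d0 H10_space f u" unfolding is_state_def using uH by blast
qed

text \<open>Shooting: the homogeneous solution with initial flux \<open>1\<close> cannot vanish at the right end, since
  it would be a state for the zero control, hence constant, and its flux would be zero.\<close>

lemma homogeneous_end_nonzero:
  assumes w: "ivp (\<lambda>t. 0) 1 w" shows "w 1 \<noteq> 0"
proof
  assume w1: "w 1 = 0"
  have B0: "ess_bounded (\<lambda>t. 0) 0" by (rule ess_bounded_I) auto
  obtain N where N: "ess_bounded w N" and eq: "w = prim (\<lambda>t. flux (\<lambda>t. 0) 1 w t / a t)"
    using w unfolding ivp_def by blast
  note st = ivp_zero_end_state[OF B0 w w1]
  have wH: "w \<in> H10_space" using st(1) unfolding is_state_def by simp
  have "L2_norm (weak_deriv w) \<le> L2_norm (\<lambda>t. 0) / \<nu>"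
    by (rule state_deriv_bound[OF order_refl ess_bounded_L2[OF B0] st(1)])
  moreover have "L2_norm (\<lambda>t. 0) = 0" by (simp add: L2_norm_def L2_inner_def)
  ultimately have "L2_norm (weak_deriv w) = 0"
    using L2_norm_nonneg[of "weak_deriv w"] by simp
  then have "AE t in leb. weak_deriv w t = 0"
    by (rule L2_norm_0_AE[OF H10_weak_deriv(1)[OF wH]])
  with st(2) have g0: "AE t in leb. flux (\<lambda>t. 0) 1 w t / a t = 0" by eventually_elim simp
  have "w x = 0" for x
  proof -
    have "w x = prim (\<lambda>t. flux (\<lambda>t. 0) 1 w t / a t) x" by (rule fun_cong[OF eq])
    also have "\<dots> = prim (\<lambda>t. 0) x"
      using g0 ess_bounded_measurable[OF ess_bounded_div_a[OF ess_bounded_flux[OF B0 N]]]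
      by (intro prim_cong_AE) auto
    also have "\<dots> = 0" unfolding prim_def by simp
    finally show ?thesis .
  qed
  then have flux1: "flux (\<lambda>t. 0) 1 w t = 1" for t unfolding flux_def prim_def by simp
  from g0 AE_space have "AE t in leb. False"
  proof eventually_elim
    case (elim t)
    then show ?case using flux1 a_ge[of t] \<nu> by (simp add: Omega_iff)
  qed
  then have "(LINT t|leb. (1::real)) = (LINT t|leb. 0)" by (intro integral_cong_AE) auto
  then show False by simp
qed

text \<open>For a control bounded by \<open>B\<close>, the products of these constants with \<open>B\<close> bound \<open>a u'\<close>, \<open>u'\<close> and the
  Lipschitz constant of \<open>u'\<close>.\<close>

definition flux_const :: real where "flux_const = A / \<nu> + (D / \<nu> + 1)"
definition deriv_const :: real where "deriv_const = flux_const / \<nu>"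
definition lip_const :: real where "lip_const = (D / \<nu> + 1) / \<nu> + flux_const * L / \<nu>\<^sup>2"

lemma flux_const_nonneg: "0 \<le> flux_const"
  unfolding flux_const_def using A_pos \<nu> D by simp

lemma lip_const_nonneg: "0 \<le> lip_const"
  unfolding lip_const_def using flux_const_nonneg \<nu> D L_nonneg by simp

text \<open>Existence together with the regularity that drives the error estimate: the energy estimate
  bounds the state, hence the derivative of the flux, and thus the Lipschitz constant of \<open>u'\<close>.\<close>

lemma state_exists_regular:
  assumes f: "ess_bounded f B"
  obtains u g where "is_state a d0 H10_space f u" "u = prim g" "g \<in> borel_measurable leb"
    "(LINT t|leb. g t) = 0" "AE t in leb. weak_deriv u t = g t"
    "\<And>t. t \<in> Omega \<Longrightarrow> \<bar>g t\<bar> \<le> deriv_const * B"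
    "\<And>s t. s \<in> Omega \<Longrightarrow> t \<in> Omega \<Longrightarrow> \<bar>g s - g t\<bar> \<le> lip_const * B * \<bar>s - t\<bar>"
proof -
  have B: "B \<ge> 0" by (rule ess_bounded_nonneg[OF f])
  have B0: "ess_bounded (\<lambda>t. 0) 0" by (rule ess_bounded_I) auto
  obtain u0 where u0: "ivp f 0 u0" using ivp_exists[OF f] by blast
  obtain w where w: "ivp (\<lambda>t. 0) 1 w" using ivp_exists[OF B0] by blast
  define k where "k = - u0 1 / w 1"
  define u where "u = (\<lambda>t. u0 t + k * w t)"
  have ivp: "ivp f k u" unfolding u_def using ivp_lincomb[OF f u0 w, of k] by simp
  have u1: "u 1 = 0" unfolding u_def k_def using homogeneous_end_nonzero[OF w] by simp
  note st = ivp_zero_end_state[OF f ivp u1]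
  define p where "p = flux f k u"
  define g where "g = (\<lambda>t. p t / a t)"
  have ug: "u = prim g" using ivp unfolding ivp_def g_def p_def by blast
  have dg: "AE t in leb. weak_deriv u t = g t" using st(2) unfolding g_def p_def .
  obtain N where N: "ess_bounded u N" using ivp unfolding ivp_def by blast
  note pB0 = ess_bounded_flux[OF f N, of k, folded p_def]
  have gB0: "ess_bounded g ((\<bar>k\<bar> + (D * N + B)) / \<nu>)" unfolding g_def by (rule ess_bounded_div_a[OF pB0])
  have uH: "u \<in> H10_space" using st(1) unfolding is_state_def by simp
  have "L2_norm g = L2_norm (weak_deriv u)"
    using dg ess_bounded_measurable[OF gB0] L2_measurable[OF H10_weak_deriv(1)[OF uH]]
    by (intro L2_norm_cong_AE) auto
  also have "\<dots> \<le> L2_norm f / \<nu>" by (rule state_deriv_bound[OF order_refl ess_bounded_L2[OF f] st(1)])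
  also have "\<dots> \<le> B / \<nu>" using ess_bounded_L2_norm[OF f] \<nu> by (simp add: divide_right_mono)
  finally have gn: "L2_norm g \<le> B / \<nu>" .
  have "\<bar>u t\<bar> \<le> B / \<nu>" for t
    using prim_le_L2_norm[OF ess_bounded_L2[OF gB0], of t] gn unfolding ug by linarith
  then have uB: "ess_bounded u (B / \<nu>)"
    using N by (intro ess_bounded_I) (auto dest: ess_bounded_measurable)
  define R where "R = (D / \<nu> + 1) * B"
  have R: "R \<ge> 0" unfolding R_def using D \<nu> B by simp
  have rB: "ess_bounded (\<lambda>s. d0 s * u s - f s) R"
    using ess_bounded_source[OF f uB] unfolding R_def by (simp add: algebra_simps)
  have plip: "\<bar>p s - p t\<bar> \<le> R * \<bar>s - t\<bar>" for s t
    using prim_ess_lipschitz[OF rB, of s t] unfolding p_def flux_def by simp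
  \<comment> \<open>compare \<open>p t\<close> with \<open>p s\<close> and average over \<open>s\<close>\<close>
  have pb: "\<bar>p t\<bar> \<le> flux_const * B" if t: "t \<in> Omega" for t
  proof -
    have "(LINT s|leb. \<bar>p t\<bar>) \<le> (LINT s|leb. R + A * \<bar>g s\<bar>)"
    proof (rule integral_mono)
      fix s assume s: "s \<in> space leb"
      then have a: "0 < a s" "a s \<le> A" using a_ge[of s] a_le[of s] \<nu> by (auto simp: Omega_iff)
      have "\<bar>s - t\<bar> \<le> 1" using s t by (auto simp: Omega_iff)
      then have "\<bar>p t - p s\<bar> \<le> R"
        using plip[of t s] R mult_left_le[of "\<bar>t - s\<bar>" R] by (simp add: abs_minus_commute)
      moreover have "\<bar>p s\<bar> \<le> A * \<bar>g s\<bar>"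
      proof -
        have "\<bar>p s\<bar> = a s * \<bar>g s\<bar>" unfolding g_def using a by simp
        then show ?thesis using a by (simp add: mult_right_mono)
      qed
      ultimately show "\<bar>p t\<bar> \<le> R + A * \<bar>g s\<bar>" by linarith
    qed (use ess_bounded_integrable[OF gB0] in auto)
    also have "\<dots> = R + A * (LINT s|leb. \<bar>g s\<bar>)" using ess_bounded_integrable[OF gB0] by simp
    also have "\<dots> \<le> R + A * (B / \<nu>)"
      using integral_abs_le_L2_norm[OF ess_bounded_L2[OF gB0]] gn A_pos
      by (intro add_left_mono mult_left_mono) auto
    also have "\<dots> = flux_const * B" unfolding R_def flux_const_def by (simp add: algebra_simps)
    finally show ?thesis by simp
  qed
  show thesis
  proof (rule that[OF st(1) ug ess_bounded_measurable[OF gB0] _ dg])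
    show "(LINT t|leb. g t) = 0" using u1 fun_cong[OF ug, of 1] by (simp add: prim_1)
    show "\<bar>g t\<bar> \<le> deriv_const * B" if t: "t \<in> Omega" for t
    proof -
      have "\<bar>g t\<bar> \<le> flux_const * B / \<nu>"
        unfolding g_def abs_divide using pb[OF t] a_ge[of t] t \<nu> flux_const_nonneg B
        by (intro frac_le) (auto simp: Omega_iff)
      then show ?thesis unfolding deriv_const_def by simp
    qed
    show "\<bar>g s - g t\<bar> \<le> lip_const * B * \<bar>s - t\<bar>" if s: "s \<in> Omega" and t: "t \<in> Omega" for s t
    proof -
      have a: "\<nu> \<le> a s" "\<nu> \<le> a t" using a_ge s t by (auto simp: Omega_iff)
      have pos: "0 < a s" "0 < a t" using a \<nu> by auto
      have "g s - g t = (p s - p t) / a s + p t * (a t - a s) / (a s * a t)"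
        unfolding g_def using pos by (simp add: field_simps)
      then have "\<bar>g s - g t\<bar> \<le> \<bar>p s - p t\<bar> / a s + \<bar>p t\<bar> * \<bar>a t - a s\<bar> / (a s * a t)"
        using pos abs_triangle_ineq[of "(p s - p t) / a s" "p t * (a t - a s) / (a s * a t)"]
        by (simp add: abs_mult)
      also have "\<dots> \<le> R * \<bar>s - t\<bar> / \<nu> + (flux_const * B) * (L * \<bar>s - t\<bar>) / (\<nu> * \<nu>)"
      proof (intro add_mono frac_le mult_mono)
        show "\<bar>a t - a s\<bar> \<le> L * \<bar>s - t\<bar>"
          using lipschitz_onD[OF a_lipschitz, of t s] s t by (simp add: dist_real_def Omega_iff abs_minus_commute)
      qed (use plip pb[OF t] a \<nu> R flux_const_nonneg B L_nonneg in auto)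
      also have "\<dots> = lip_const * B * \<bar>s - t\<bar>"
        unfolding lip_const_def R_def power2_eq_square using \<nu> by (simp add: field_simps)
      finally show ?thesis .
    qed
  qed
qed

lemma state_exists:
  assumes f: "ess_bounded f B"
  obtains u g where "is_state a d0 H10_space f u" "u = prim g" "ess_bounded g (deriv_const * B)"
proof -
  obtain u g where u: "is_state a d0 H10_space f u" "u = prim g" "g \<in> borel_measurable leb"
    "(LINT t|leb. g t) = 0" "AE t in leb. weak_deriv u t = g t"
    "\<And>t. t \<in> Omega \<Longrightarrow> \<bar>g t\<bar> \<le> deriv_const * B"
    "\<And>s t. s \<in> Omega \<Longrightarrow> t \<in> Omega \<Longrightarrow> \<bar>g s - g t\<bar> \<le> lip_const * B * \<bar>s - t\<bar>"
    using state_exists_regular[OF f] by blast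
  show thesis by (rule that[OF u(1,2) ess_bounded_I[OF u(3,6)]])
qed

end

section \<open>Partitions and finite elements\<close>

lemma weak_deriv_cong_AE:
  assumes "v \<in> H10_space" "w \<in> H10_space" "AE t in leb. v t = w t"
  shows "AE t in leb. weak_deriv v t = weak_deriv w t"
  using has_weak_deriv_cong_AE[OF L2_measurable[OF H10_L2[OF assms(1)]] L2_measurable[OF H10_L2[OF assms(2)]]
      assms(3) H10_weak_deriv(2)[OF assms(2)]]
    weak_deriv_AE_eq[OF H10_L2[OF assms(1)] H10_weak_deriv(1)[OF assms(2)]] by blast

lemma integral_indicator_leb:
  assumes "0 \<le> s" "s \<le> t" "t \<le> 1" shows "(LINT r|leb. indicator {s..<t} r) = t - s"
proof -
  have "AE r in leb. r \<noteq> s" using AE_leb_not_in_finite[of "{s}"] by simp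
  then have "AE r in leb. (indicator {s..<t} r :: real) = indicator {s<..<t} r"
    by eventually_elim (auto simp: indicator_def)
  then have "(LINT r|leb. indicator {s..<t} r) = (LINT r|leb. indicator {s<..<t} r :: real)"
    by (intro integral_cong_AE borel_measurable_leb) auto
  also have "\<dots> = measure leb ({s<..<t} \<inter> Omega)" by simp
  also have "{s<..<t} \<inter> Omega = {s<..<t}" using assms by (auto simp: Omega_iff)
  finally show ?thesis using measure_leb_interval[OF assms] by simp
qed

lemma (in elliptic) state_form_cong_right:
  assumes "u \<in> H10_space" "v \<in> H10_space" "w \<in> H10_space" "AE t in leb. v t = w t"
  shows "state_form a d0 u v = state_form a d0 u w"
proof -
  have "L2_inner (\<lambda>t. a t * weak_deriv u t) (weak_deriv v) = L2_inner (\<lambda>t. a t * weak_deriv u t) (weak_deriv w)"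
    using assms weak_deriv_cong_AE[OF assms(2-4)] H10_weak_deriv(1) flux_L2 L2_measurable
    by (intro L2_inner_cong_AE) auto
  moreover have "L2_inner (\<lambda>t. d0 t * u t) v = L2_inner (\<lambda>t. d0 t * u t) w"
    using assms H10_L2 reaction_L2 L2_measurable by (intro L2_inner_cong_AE) auto
  ultimately show ?thesis unfolding state_form_def by simp
qed

locale mesh =
  fixes l :: nat and x :: "nat \<Rightarrow> real"
  assumes partition: "is_partition l x"
begin

definition h :: real where "h = mesh_width l x"

definition cell :: "nat \<Rightarrow> real set" where "cell i = {x (i - 1)<..<x i}"

lemma l_pos: "l > 1" and x_0: "x 0 = 0" and x_l: "x l = 1"
  and x_step: "i \<in> {1..l} \<Longrightarrow> x (i - 1) < x i"
  using partition unfolding is_partition_def by auto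

lemma x_less: "i < j \<Longrightarrow> j \<le> l \<Longrightarrow> x i < x j"
proof (induction j)
  case (Suc j)
  have "x j < x (Suc j)" using x_step[of "Suc j"] Suc.prems by simp
  then show ?case using Suc by (cases "i = j") auto
qed simp

lemma x_le: "i \<le> j \<Longrightarrow> j \<le> l \<Longrightarrow> x i \<le> x j"
  using x_less[of i j] by (cases "i = j") auto

lemma x_range: "i \<le> l \<Longrightarrow> 0 \<le> x i \<and> x i \<le> 1"
  using x_le[of 0 i] x_le[of i l] x_0 x_l by auto

lemma width_le: "i \<in> {1..l} \<Longrightarrow> x i - x (i - 1) \<le> h"
  unfolding h_def mesh_width_def by (intro Max_ge) auto

lemma width_pos: "i \<in> {1..l} \<Longrightarrow> 0 < x i - x (i - 1)"
  using x_step by force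

lemma h_pos: "h > 0"
  using width_le[of 1] width_pos[of 1] l_pos by simp

lemma cell_Omega: "i \<in> {1..l} \<Longrightarrow> t \<in> cell i \<Longrightarrow> t \<in> Omega"
proof -
  assume i: "i \<in> {1..l}" and t: "t \<in> cell i"
  have "0 \<le> x (i - 1)" "x i \<le> 1" using x_range[of i] x_range[of "i - 1"] i by auto
  then show "t \<in> Omega" using t unfolding cell_def Omega_iff by auto
qed

lemma cell_unique:
  assumes "i \<in> {1..l}" "j \<in> {1..l}" "t \<in> cell i" "t \<in> cell j" shows "i = j"
proof (rule ccontr)
  assume "i \<noteq> j"
  then consider "i \<le> j - 1" | "j \<le> i - 1" by linarith
  then show False
  proof cases
    case 1
    have "j - 1 \<le> l" using assms(2) by auto
    from x_le[OF 1 this] assms show ?thesis unfolding cell_def by auto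
  next
    case 2
    have "i - 1 \<le> l" using assms(1) by auto
    from x_le[OF 2 this] assms show ?thesis unfolding cell_def by auto
  qed
qed

lemma cell_cover:
  assumes t: "t \<in> Omega" "t \<notin> x ` {0..l}" obtains i where "i \<in> {1..l}" "t \<in> cell i"
proof -
  define i where "i = (LEAST i. t < x i)"
  have "t < x l" using t x_l by (simp add: Omega_iff)
  then have i: "t < x i" "i \<le> l" unfolding i_def by (auto intro: LeastI Least_le)
  have "i \<noteq> 0" using i(1) t x_0 by (metis Omega_iff less_asym)
  then have i1: "i - 1 < i" by simp
  have "\<not> t < x (i - 1)" using not_less_Least[of "i - 1" "\<lambda>i. t < x i"] i1 unfolding i_def by simp
  moreover have "t \<noteq> x (i - 1)" using t(2) i(2) by auto
  ultimately show thesis using that[of i] i \<open>i \<noteq> 0\<close> unfolding cell_def by auto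
qed

lemma AE_cell: "AE t in leb. \<exists>i\<in>{1..l}. t \<in> cell i"
proof -
  have "AE t in leb. t \<notin> x ` {0..l}" by (rule AE_leb_not_in_finite) simp
  then show ?thesis using AE_space
    by eventually_elim (metis cell_cover space_leb)
qed

lemma sum_widths_telescope:
  fixes u :: "real \<Rightarrow> real"
  shows "(\<Sum>i\<in>{1..l}. u (x i) - u (x (i - 1))) = u 1 - u 0"
proof -
  have "(\<Sum>i\<in>{1..k}. u (x i) - u (x (i - 1))) = u (x k) - u (x 0)" for k
    by (induction k) auto
  then show ?thesis by (simp add: x_0 x_l)
qed

definition step :: "(nat \<Rightarrow> real) \<Rightarrow> real \<Rightarrow> real" where
  "step c t = (\<Sum>i\<in>{1..l}. c i * indicator (cell i) t)"

lemma step_cell: "i \<in> {1..l} \<Longrightarrow> t \<in> cell i \<Longrightarrow> step c t = c i"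
proof -
  assume i: "i \<in> {1..l}" "t \<in> cell i"
  have ind: "indicator (cell j) t = (if j = i then 1 else 0 :: real)" if "j \<in> {1..l}" for j
    using cell_unique[OF that i(1) _ i(2)] i(2) by (cases "j = i") (auto simp: indicator_def)
  have "step c t = (\<Sum>j\<in>{1..l}. if j = i then c i else 0)"
    unfolding step_def by (rule sum.cong[OF refl]) (simp add: ind del: indicator_simps)
  also have "\<dots> = c i" using i(1) by (simp add: sum.delta)
  finally show "step c t = c i" .
qed

lemma step_lincomb: "step (\<lambda>i. c i + k * d i) t = step c t + k * step d t"
  unfolding step_def sum_distrib_left sum.distrib[symmetric]
  by (rule sum.cong) (auto simp: distrib_right)

lemma step_borel: "step c \<in> borel_measurable borel"
  unfolding step_def cell_def by measurable

lemma step_ess_bounded: "ess_bounded (step c) (\<Sum>i\<in>{1..l}. \<bar>c i\<bar>)"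
proof (rule ess_bounded_I)
  show "step c \<in> borel_measurable leb" by (rule borel_measurable_leb[OF step_borel])
  have "\<bar>step c t\<bar> \<le> (\<Sum>i\<in>{1..l}. \<bar>c i * indicator (cell i) t\<bar>)" for t
    unfolding step_def by (rule sum_abs)
  also have "\<dots> t \<le> (\<Sum>i\<in>{1..l}. \<bar>c i\<bar>)" for t
    by (intro sum_mono) (auto simp: indicator_def)
  finally show "\<bar>step c t\<bar> \<le> (\<Sum>i\<in>{1..l}. \<bar>c i\<bar>)" for t .
qed

lemma integral_cell: "i \<in> {1..l} \<Longrightarrow> (LINT t|leb. indicator (cell i) t) = x i - x (i - 1)"
proof -
  assume i: "i \<in> {1..l}"
  have "cell i \<inter> Omega = cell i" using cell_Omega[OF i] by auto
  moreover have "measure leb (cell i) = x i - x (i - 1)"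
    unfolding cell_def using i x_range[of i] x_range[of "i - 1"] x_step[OF i]
    by (intro measure_leb_interval) auto
  ultimately show "(LINT t|leb. indicator (cell i) t) = x i - x (i - 1)" by simp
qed

lemma integral_step: "(LINT t|leb. step c t) = (\<Sum>i\<in>{1..l}. c i * (x i - x (i - 1)))"
proof -
  have "integrable leb (\<lambda>t. c i * indicator (cell i) t)" for i
    by (intro integrable_bounded[of _ "\<bar>c i\<bar>"] borel_measurable_leb AE_leb_I)
       (auto simp: cell_def indicator_def)
  then have "(LINT t|leb. step c t) = (\<Sum>i\<in>{1..l}. LINT t|leb. c i * indicator (cell i) t)"
    unfolding step_def by (intro Bochner_Integration.integral_sum)
  also have "\<dots> = (\<Sum>i\<in>{1..l}. c i * (x i - x (i - 1)))"
    by (intro sum.cong refl) (simp only: integral_mult_right_zero integral_cell)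
  finally show ?thesis .
qed

lemma prim_step_cell:
  assumes i: "i \<in> {1..l}" and st: "s \<in> cell i" "t \<in> cell i"
  shows "prim (step c) t = prim (step c) s + c i * (t - s)"
proof -
  have *: "prim (step c) t - prim (step c) s = c i * (t - s)" if "s \<in> cell i" "t \<in> cell i" "s \<le> t" for s t
  proof -
    have "indicator {s..<t} r * step c r = c i * indicator {s..<t} r" for r
      using step_cell[OF i, of r c] that by (auto simp: indicator_def cell_def)
    then have "prim (step c) t - prim (step c) s = (LINT r|leb. c i * indicator {s..<t} r)"
      unfolding prim_diff_eq[OF ess_bounded_integrable[OF step_ess_bounded] that(3)] by presburger
    also have "\<dots> = c i * (LINT r|leb. indicator {s..<t} r)" by (rule integral_mult_right_zero)
    also have "(LINT r|leb. indicator {s..<t} r) = t - s"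
      using cell_Omega[OF i that(1)] cell_Omega[OF i that(2)] that(3)
      by (intro integral_indicator_leb) (auto simp: Omega_iff)
    finally show ?thesis .
  qed
  show ?thesis
  proof (cases "s \<le> t")
    case True then show ?thesis using *[OF st] by simp
  next
    case False then show ?thesis using *[OF st(2,1)] by (simp add: algebra_simps)
  qed
qed

lemma prim_step_V_h:
  assumes "(\<Sum>i\<in>{1..l}. c i * (x i - x (i - 1))) = 0" shows "prim (step c) \<in> V_h l x"
proof -
  have "\<exists>k d. \<forall>t\<in>{x (i - 1)<..<x i}. prim (step c) t = k + d * t" if i: "i \<in> {1..l}" for i
  proof -
    obtain s where s: "s \<in> cell i" using dense[OF x_step[OF i]] unfolding cell_def by auto
    have "prim (step c) t = (prim (step c) s - c i * s) + c i * t" if "t \<in> cell i" for t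
      using prim_step_cell[OF i s that, of c] by (simp add: algebra_simps)
    then show ?thesis unfolding cell_def by blast
  qed
  moreover have "prim (step c) 1 = 0" using integral_step[of c] assms by (simp add: prim_1)
  ultimately show ?thesis
    unfolding V_h_def using prim_ess_bounded_continuous[OF step_ess_bounded] by auto
qed

lemma V_h_lincomb:
  assumes "v \<in> V_h l x" "w \<in> V_h l x" shows "(\<lambda>t. v t + k * w t) \<in> V_h l x"
proof -
  have "\<exists>c d. \<forall>t\<in>{x (i - 1)<..<x i}. v t + k * w t = c + d * t" if i: "i \<in> {1..l}" for i
  proof -
    obtain c d where 1: "\<forall>t\<in>{x (i - 1)<..<x i}. v t = c + d * t"
      using assms(1) i unfolding V_h_def by blast
    obtain c' d' where 2: "\<forall>t\<in>{x (i - 1)<..<x i}. w t = c' + d' * t"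
      using assms(2) i unfolding V_h_def by blast
    show ?thesis using 1 2
      by (intro exI[of _ "c + k * c'"] exI[of _ "d + k * d'"]) (simp add: algebra_simps)
  qed
  then show ?thesis using assms unfolding V_h_def by (auto intro!: continuous_intros)
qed

lemma V_h_diff: "v \<in> V_h l x \<Longrightarrow> w \<in> V_h l x \<Longrightarrow> (\<lambda>t. v t - w t) \<in> V_h l x"
  using V_h_lincomb[of v w "- 1"] by simp

text \<open>Functions in \<open>V_h\<close> are described by their slopes; the weighted sum of the slopes is the value at
  the right end.\<close>

lemma V_h_slopes:
  assumes v: "v \<in> V_h l x"
  obtains d where "\<And>t. t \<in> {0..1} \<Longrightarrow> v t = prim (step d) t"
    "(\<Sum>i\<in>{1..l}. d i * (x i - x (i - 1))) = 0"
proof -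
  have "\<forall>i\<in>{1..l}. \<exists>c d. \<forall>t\<in>cell i. v t = c + d * t" using v unfolding V_h_def cell_def by simp
  then obtain c d where cd: "\<And>i t. i \<in> {1..l} \<Longrightarrow> t \<in> cell i \<Longrightarrow> v t = c i + d i * t" by metis
  have v0: "continuous_on {0..1} v" "v 0 = 0" "v 1 = 0" using v unfolding V_h_def by auto
  have eq: "prim (step d) t = v t - v 0" if "t \<in> {0..1}" for t
  proof (rule prim_FTC[of "x ` {0..l}", OF _ v0(1) ess_bounded_integrable[OF step_ess_bounded] _ that])
    fix t assume "t \<in> Omega - x ` {0..l}"
    then obtain i where i: "i \<in> {1..l}" "t \<in> cell i" using cell_cover by auto
    have "((\<lambda>t. c i + d i * t) has_real_derivative step d t) (at t)"
      using i by (auto intro!: derivative_eq_intros simp: step_cell)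
    then show "(v has_real_derivative step d t) (at t)"
      by (rule has_field_derivative_transform_within_open[of _ _ _ "cell i"])
         (use i cd in \<open>auto simp: cell_def\<close>)
  qed simp
  have "(\<Sum>i\<in>{1..l}. d i * (x i - x (i - 1))) = 0"
    using eq[of 1] v0 integral_step[of d] by (simp add: prim_1)
  then show thesis using that[of d] eq v0 by simp
qed

lemma V_h_continuous_measurable:
  assumes "v \<in> V_h l x" shows "v \<in> borel_measurable leb"
proof (rule continuous_imp_measurable_on_sets_lebesgue)
  show "continuous_on Omega v"
    using assms unfolding V_h_def
    by (auto intro: continuous_on_subset[of "{0..1}"] simp: Omega_iff)
qed simp

lemma V_h_H10: assumes v: "v \<in> V_h l x" shows "v \<in> H10_space"
proof -
  obtain d where d: "\<And>t. t \<in> {0..1} \<Longrightarrow> v t = prim (step d) t"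
    "(\<Sum>i\<in>{1..l}. d i * (x i - x (i - 1))) = 0" using V_h_slopes[OF v] by blast
  show ?thesis
  proof (rule prim_H10(1))
    show "step d \<in> borel_measurable leb" by (rule ess_bounded_measurable[OF step_ess_bounded])
    show "AE t in leb. \<bar>step d t\<bar> \<le> (\<Sum>i\<in>{1..l}. \<bar>d i\<bar>)" using step_ess_bounded ess_bounded_def by auto
    show "(LINT t|leb. step d t) = 0" using integral_step d(2) by simp
    show "v \<in> borel_measurable leb" by (rule V_h_continuous_measurable[OF v])
    show "AE t in leb. v t = prim (step d) t" by (rule AE_leb_I) (simp add: d(1) Omega_iff)
  qed
qed

lemma V_h_sup_bound:
  assumes v: "v \<in> V_h l x" shows "ess_bounded v (L2_norm (weak_deriv v))"
proof (rule ess_bounded_I[OF V_h_continuous_measurable[OF v]])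
  obtain d where d: "\<And>t. t \<in> {0..1} \<Longrightarrow> v t = prim (step d) t"
    "(\<Sum>i\<in>{1..l}. d i * (x i - x (i - 1))) = 0" using V_h_slopes[OF v] by blast
  have "AE t in leb. weak_deriv v t = step d t"
  proof (rule prim_H10(2))
    show "AE t in leb. \<bar>step d t\<bar> \<le> (\<Sum>i\<in>{1..l}. \<bar>d i\<bar>)" using step_ess_bounded ess_bounded_def by auto
    show "(LINT t|leb. step d t) = 0" using integral_step d(2) by simp
    show "AE t in leb. v t = prim (step d) t" by (rule AE_leb_I) (simp add: d(1) Omega_iff)
  qed (auto intro: V_h_continuous_measurable[OF v] ess_bounded_measurable[OF step_ess_bounded])
  then have "L2_norm (weak_deriv v) = L2_norm (step d)"
    using L2_measurable[OF H10_weak_deriv(1)[OF V_h_H10[OF v]]] ess_bounded_measurable[OF step_ess_bounded]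
    by (intro L2_norm_cong_AE) auto
  then show "\<bar>v t\<bar> \<le> L2_norm (weak_deriv v)" if "t \<in> Omega" for t
    using prim_le_L2_norm[OF ess_bounded_L2[OF step_ess_bounded], of d t] d(1)[of t] that
    by (simp add: Omega_iff)
qed

end

section \<open>Galerkin approximation\<close>

text \<open>For a control bounded by \<open>B\<close>, the finite element error is at most \<open>fe_const * B * h\<close> in the energy
  norm.\<close>

definition (in elliptic) fe_const :: real where "fe_const = sqrt (A + D) * lip_const"

locale galerkin = elliptic + mesh
begin

text \<open>The functions in \<open>V_h\<close> whose slopes vanish on the cells strictly between \<open>k\<close> and \<open>l\<close>; the
  slope on the last cell is determined by the zero boundary value.  These spaces grow by one
  dimension at a time.\<close>

definition V_part :: "nat \<Rightarrow> (real \<Rightarrow> real) set" where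
  "V_part k = {prim (step d) | d. (\<Sum>i\<in>{1..l}. d i * (x i - x (i - 1))) = 0 \<and>
     (\<forall>i\<in>{1..l}. k < i \<longrightarrow> i < l \<longrightarrow> d i = 0)}"

lemma V_part_V_h: "V_part k \<subseteq> V_h l x"
  unfolding V_part_def using prim_step_V_h by auto

lemma prim_step_lincomb:
  "(\<lambda>t. prim (step c) t + k * prim (step d) t) = prim (step (\<lambda>i. c i + k * d i))"
proof -
  have eq: "step (\<lambda>i. c i + k * d i) = (\<lambda>t. step c t + k * step d t)" by (rule ext, rule step_lincomb)
  show ?thesis
    unfolding eq by (rule ext, rule prim_add_ess_bounded[OF step_ess_bounded step_ess_bounded, symmetric])
qed

lemma V_part_lincomb:
  assumes "v \<in> V_part k" "w \<in> V_part k" shows "(\<lambda>t. v t + c * w t) \<in> V_part k"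
proof -
  obtain d where d: "v = prim (step d)" "(\<Sum>i\<in>{1..l}. d i * (x i - x (i - 1))) = 0"
    "\<And>i. i \<in> {1..l} \<Longrightarrow> k < i \<Longrightarrow> i < l \<Longrightarrow> d i = 0" using assms(1) unfolding V_part_def by blast
  obtain e where e: "w = prim (step e)" "(\<Sum>i\<in>{1..l}. e i * (x i - x (i - 1))) = 0"
    "\<And>i. i \<in> {1..l} \<Longrightarrow> k < i \<Longrightarrow> i < l \<Longrightarrow> e i = 0" using assms(2) unfolding V_part_def by blast
  have "(\<Sum>i\<in>{1..l}. (d i + c * e i) * (x i - x (i - 1)))
      = (\<Sum>i\<in>{1..l}. d i * (x i - x (i - 1))) + c * (\<Sum>i\<in>{1..l}. e i * (x i - x (i - 1)))"
    by (simp add: sum.distrib sum_distrib_left distrib_right mult.assoc)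
  then have "(\<Sum>i\<in>{1..l}. (d i + c * e i) * (x i - x (i - 1))) = 0" using d e by simp
  then show ?thesis
    unfolding V_part_def d(1) e(1) prim_step_lincomb using d(3) e(3)
    by (intro CollectI exI[of _ "\<lambda>i. d i + c * e i"]) auto
qed

lemma V_part_projection:
  assumes "f \<in> H10_space"
  shows "\<exists>p\<in>V_part k. \<forall>w\<in>V_part k. state_form a d0 p w = state_form a d0 f w"
  using assms
proof (induction k arbitrary: f)
  case zero: 0
  have z: "v = (\<lambda>t. 0)" if vV: "v \<in> V_part 0" for v
  proof -
    obtain d where d: "v = prim (step d)" "(\<Sum>i\<in>{1..l}. d i * (x i - x (i - 1))) = 0"
      "\<And>i. i \<in> {1..l} \<Longrightarrow> 0 < i \<Longrightarrow> i < l \<Longrightarrow> d i = 0" using vV unfolding V_part_def by blast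
    have "(\<Sum>i\<in>{1..l}. d i * (x i - x (i - 1))) = (\<Sum>i\<in>{1..l}. if i = l then d l * (x l - x (l - 1)) else 0)"
      by (intro sum.cong) (use d(3) in auto)
    then have "d l * (x l - x (l - 1)) = 0" using d(2) l_pos by simp
    then have "d l = 0" using width_pos[of l] l_pos by simp
    then have "d i = 0" if "i \<in> {1..l}" for i using d(3)[OF that] that by (cases "i = l") auto
    then have "step d = (\<lambda>t. 0)" unfolding step_def by auto
    then show ?thesis unfolding d(1) prim_def by simp
  qed
  have m: "prim (step (\<lambda>i. 0)) \<in> V_part 0" unfolding V_part_def by (intro CollectI exI[of _ "\<lambda>i. 0"]) simp
  have 0: "state_form a d0 g (\<lambda>t. 0) = 0" if "g \<in> H10_space" for g
    using energy.form_diff_right[OF zero_H10 zero_H10 that] by simp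
  have "state_form a d0 (prim (step (\<lambda>i. 0))) w = state_form a d0 f w" if "w \<in> V_part 0" for w
    unfolding z[OF that] z[OF m] 0[OF zero_H10] 0[OF zero.prems] ..
  then show ?case using m by blast
next
  case (Suc k)
  show ?case
  proof (cases "Suc k < l")
    case False
    then have "(\<forall>i\<in>{1..l}. Suc k < i \<longrightarrow> i < l \<longrightarrow> d i = 0) \<longleftrightarrow>
        (\<forall>i\<in>{1..l}. k < i \<longrightarrow> i < l \<longrightarrow> d i = 0)" for d :: "nat \<Rightarrow> real"
      by auto
    then have "V_part (Suc k) = V_part k" unfolding V_part_def by presburger
    then show ?thesis using Suc by simp
  next
    case True
    let ?j = "Suc k"
    let ?r = "(x ?j - x (?j - 1)) / (x l - x (l - 1))"
    define \<beta> where "\<beta> = (\<lambda>i. if i = ?j then 1 else if i = l then - ?r else 0)"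
    have hl: "x l - x (l - 1) \<noteq> 0" using width_pos[of l] l_pos by simp
    have "(\<Sum>i\<in>{1..l}. \<beta> i * (x i - x (i - 1)))
        = (\<Sum>i\<in>{1..l}. (if i = ?j then x ?j - x (?j - 1) else 0) + (if i = l then - ?r * (x l - x (l - 1)) else 0))"
      unfolding \<beta>_def using True by (intro sum.cong) auto
    also have "\<dots> = (x ?j - x (?j - 1)) + (- ?r * (x l - x (l - 1)))"
      using True by (simp add: sum.distrib)
    also have "\<dots> = 0" using hl by simp
    finally have \<beta>0: "(\<Sum>i\<in>{1..l}. \<beta> i * (x i - x (i - 1))) = 0" .
    define b where "b = prim (step \<beta>)"
    have bV: "b \<in> V_part (Suc k)" unfolding V_part_def b_def
      by (intro CollectI exI[of _ \<beta>] conjI \<beta>0) (auto simp: \<beta>_def)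
    have mono: "V_part k \<subseteq> V_part (Suc k)" unfolding V_part_def by auto
    have dec: "\<exists>u\<in>V_part k. \<exists>c. w = (\<lambda>t. u t + c * b t)" if wV: "w \<in> V_part (Suc k)" for w
    proof -
      obtain d where d: "w = prim (step d)" "(\<Sum>i\<in>{1..l}. d i * (x i - x (i - 1))) = 0"
        "\<And>i. i \<in> {1..l} \<Longrightarrow> Suc k < i \<Longrightarrow> i < l \<Longrightarrow> d i = 0"
        using wV unfolding V_part_def by blast
      define e where "e = (\<lambda>i. d i + (- d ?j) * \<beta> i)"
      have "(\<Sum>i\<in>{1..l}. e i * (x i - x (i - 1)))
          = (\<Sum>i\<in>{1..l}. d i * (x i - x (i - 1))) + (- d ?j) * (\<Sum>i\<in>{1..l}. \<beta> i * (x i - x (i - 1)))"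
        unfolding e_def sum_distrib_left sum.distrib[symmetric] by (intro sum.cong) (auto simp: algebra_simps)
      then have e0: "(\<Sum>i\<in>{1..l}. e i * (x i - x (i - 1))) = 0" using d(2) \<beta>0 by simp
      have "e i = 0" if "i \<in> {1..l}" "k < i" "i < l" for i
        using d(3)[OF that(1)] that unfolding e_def \<beta>_def by (cases "i = ?j") auto
      then have eV: "prim (step e) \<in> V_part k" unfolding V_part_def using e0 by blast
      have "w = (\<lambda>t. prim (step e) t + d ?j * b t)"
        unfolding b_def prim_step_lincomb d(1) by (simp add: e_def)
      then show ?thesis using eV by blast
    qed
    have UH: "V_part k \<subseteq> H10_space" for k using V_part_V_h V_h_H10 by blast
    have "\<exists>u\<in>V_part k. \<exists>c. \<forall>w\<in>V_part k. \<forall>m. state_form a d0 (\<lambda>t. u t + c * b t) (\<lambda>t. w t + m * b t)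
         = state_form a d0 f (\<lambda>t. w t + m * b t)"
      by (rule energy.projection_extend[OF UH V_part_lincomb Suc.IH subsetD[OF UH bV] Suc.prems])
    then obtain u c where u: "u \<in> V_part k"
      "\<forall>w\<in>V_part k. \<forall>m. state_form a d0 (\<lambda>t. u t + c * b t) (\<lambda>t. w t + m * b t)
         = state_form a d0 f (\<lambda>t. w t + m * b t)"
      by (elim bexE exE)
    have uc: "state_form a d0 (\<lambda>t. u t + c * b t) w = state_form a d0 f w" if wS: "w \<in> V_part (Suc k)" for w
    proof -
      obtain w' m where w': "w' \<in> V_part k" "w = (\<lambda>t. w' t + m * b t)" using dec[OF wS] by (elim bexE exE)
      show ?thesis unfolding w'(2) using u(2) w'(1) by simp
    qed
    have "(\<lambda>t. u t + c * b t) \<in> V_part (Suc k)" using u(1) mono bV by (intro V_part_lincomb) auto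
    then show ?thesis using uc by (intro bexI[of _ "\<lambda>t. u t + c * b t"]) auto
  qed
qed

text \<open>Members of \<open>V_h\<close> are arbitrary outside the unit interval, while \<open>V_part l\<close> contains one continuation
  of each; the energy form does not distinguish them.\<close>

lemma V_h_projection:
  assumes "f \<in> H10_space"
  shows "\<exists>p\<in>V_h l x. \<forall>w\<in>V_h l x. state_form a d0 p w = state_form a d0 f w"
proof -
  obtain p where p: "p \<in> V_part l" "\<And>w. w \<in> V_part l \<Longrightarrow> state_form a d0 p w = state_form a d0 f w"
    using V_part_projection[OF assms, of l] by blast
  have pH: "p \<in> H10_space" using p V_part_V_h V_h_H10 by blast
  have "state_form a d0 p w = state_form a d0 f w" if w: "w \<in> V_h l x" for w
  proof -
    obtain d where d: "\<And>t. t \<in> {0..1} \<Longrightarrow> w t = prim (step d) t"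
      "(\<Sum>i\<in>{1..l}. d i * (x i - x (i - 1))) = 0" using V_h_slopes[OF w] by blast
    have dV: "prim (step d) \<in> V_part l" unfolding V_part_def using d(2) by auto
    have dH: "prim (step d) \<in> H10_space" using dV V_part_V_h V_h_H10 by blast
    have AE: "AE t in leb. w t = prim (step d) t" by (rule AE_leb_I) (simp add: d(1) Omega_iff)
    show ?thesis
      using state_form_cong_right[OF pH V_h_H10[OF w] dH AE]
        state_form_cong_right[OF assms V_h_H10[OF w] dH AE] p(2)[OF dV] by simp
  qed
  then show ?thesis using p(1) V_part_V_h by blast
qed

text \<open>The discrete solution is the energy projection of the continuous one.\<close>

lemma discrete_state_exists:
  assumes "ess_bounded f B" shows "\<exists>u. is_state a d0 (V_h l x) f u"
proof -
  obtain u where u: "is_state a d0 H10_space f u" by (rule state_exists_regular[OF assms])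
  then obtain p where "p \<in> V_h l x" "\<forall>w\<in>V_h l x. state_form a d0 p w = state_form a d0 u w"
    using V_h_projection unfolding is_state_def by blast
  then show ?thesis using u V_h_H10 unfolding is_state_def by auto
qed

text \<open>The comparison function integrates the cell averages of \<open>u'\<close>, that is, it interpolates \<open>u\<close>
  at the nodes.\<close>

lemma interpolation_error:
  assumes f: "ess_bounded f B" and u: "is_state a d0 H10_space f u"
  shows "\<exists>w\<in>V_h l x. sqrt (state_form a d0 (\<lambda>t. u t - w t) (\<lambda>t. u t - w t)) \<le> fe_const * B * h"
proof -
  have B: "B \<ge> 0" by (rule ess_bounded_nonneg[OF f])
  obtain v g where v: "is_state a d0 H10_space f v" "v = prim g" "g \<in> borel_measurable leb"
    "(LINT t|leb. g t) = 0" "AE t in leb. weak_deriv v t = g t"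
    "\<And>t. t \<in> Omega \<Longrightarrow> \<bar>g t\<bar> \<le> deriv_const * B"
    "\<And>s t. s \<in> Omega \<Longrightarrow> t \<in> Omega \<Longrightarrow> \<bar>g s - g t\<bar> \<le> lip_const * B * \<bar>s - t\<bar>"
    using state_exists_regular[OF f] by blast
  have uH: "u \<in> H10_space" and vH: "v \<in> H10_space" using u v(1) unfolding is_state_def by auto
  have uv: "AE t in leb. u t = v t"
    by (rule is_state_unique[OF order_refl energy.diff_mem u v(1)])
  have gB: "ess_bounded g (deriv_const * B)" by (rule ess_bounded_I[OF v(3,6)])
  define m where "m = (\<lambda>i. (prim g (x i) - prim g (x (i - 1))) / (x i - x (i - 1)))"
  have m: "m i * (x i - x (i - 1)) = prim g (x i) - prim g (x (i - 1))" if "i \<in> {1..l}" for i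
    unfolding m_def using width_pos[OF that] by simp
  have "(\<Sum>i\<in>{1..l}. m i * (x i - x (i - 1))) = prim g 1 - prim g 0"
    unfolding sum_widths_telescope[of "prim g", symmetric] by (rule sum.cong[OF refl m])
  then have m0: "(\<Sum>i\<in>{1..l}. m i * (x i - x (i - 1))) = 0" using v(4) by (simp add: prim_1)
  define w where "w = prim (step m)"
  have wV: "w \<in> V_h l x" unfolding w_def by (rule prim_step_V_h[OF m0])
  have close: "\<bar>g t - m i\<bar> \<le> lip_const * B * h" if i: "i \<in> {1..l}" and t: "t \<in> cell i" for i t
  proof -
    let ?w = "x i - x (i - 1)"
    have tO: "t \<in> Omega" by (rule cell_Omega[OF i t])
    have le: "x (i - 1) \<le> x i" using x_step[OF i] by simp
    have ind: "integrable leb (\<lambda>r. g t * indicator {x (i - 1)..<x i} r)"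
      by (intro integrable_bounded[of _ "\<bar>g t\<bar>"] borel_measurable_leb AE_leb_I) (auto simp: indicator_def)
    have "(g t - m i) * ?w = g t * ?w - (LINT r|leb. indicator {x (i - 1)..<x i} r * g r)"
      using m[OF i] prim_diff_eq[OF ess_bounded_integrable[OF gB] le] by (simp add: algebra_simps)
    also have "g t * ?w = g t * (LINT r|leb. indicator {x (i - 1)..<x i} r)"
      using x_range[of i] x_range[of "i - 1"] i le by (subst integral_indicator_leb) auto
    also have "\<dots> = (LINT r|leb. g t * indicator {x (i - 1)..<x i} r)"
      by (rule integral_mult_right_zero[symmetric])
    also have "\<dots> - (LINT r|leb. indicator {x (i - 1)..<x i} r * g r)
        = (LINT r|leb. g t * indicator {x (i - 1)..<x i} r - indicator {x (i - 1)..<x i} r * g r)"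
      using ind integrable_indicator_mult[OF ess_bounded_integrable[OF gB], of "{x (i - 1)..<x i}"] by simp
    also have "\<dots> = (LINT r|leb. indicator {x (i - 1)..<x i} r * (g t - g r))"
      by (simp add: algebra_simps)
    finally have "\<bar>(g t - m i) * ?w\<bar> = \<bar>LINT r|leb. indicator {x (i - 1)..<x i} r * (g t - g r)\<bar>" by simp
    also have "\<dots> \<le> lip_const * B * h * (x i - x (i - 1))"
    proof (rule integral_over_interval_le[OF _ le])
      show "integrable leb (\<lambda>r. g t - g r)" using ess_bounded_integrable[OF gB] by simp
      show "AE r in leb. r \<in> {x (i - 1)..<x i} \<longrightarrow> \<bar>g t - g r\<bar> \<le> lip_const * B * h"
      proof (rule AE_leb_I, rule impI)
        fix r assume r: "r \<in> Omega" "r \<in> {x (i - 1)..<x i}"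
        have "\<bar>g t - g r\<bar> \<le> lip_const * B * \<bar>t - r\<bar>" by (rule v(7)[OF tO r(1)])
        also have "\<dots> \<le> lip_const * B * h"
          using r t width_le[OF i] lip_const_nonneg B unfolding cell_def by (intro mult_left_mono) auto
        finally show "\<bar>g t - g r\<bar> \<le> lip_const * B * h" .
      qed
      show "0 \<le> lip_const * B * h" using lip_const_nonneg B h_pos by simp
    qed
    finally have "\<bar>g t - m i\<bar> * ?w \<le> lip_const * B * h * ?w"
      using width_pos[OF i] by (simp add: abs_mult)
    then show ?thesis using width_pos[OF i] by (simp add: mult_le_cancel_right)
  qed
  have wH: "w \<in> H10_space" by (rule V_h_H10[OF wV])
  have dw: "AE t in leb. weak_deriv w t = step m t"
  proof (rule prim_H10(2))
    show "AE t in leb. \<bar>step m t\<bar> \<le> (\<Sum>i\<in>{1..l}. \<bar>m i\<bar>)" using step_ess_bounded ess_bounded_def by auto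
    show "(LINT t|leb. step m t) = 0" using integral_step m0 by simp
    show "AE t in leb. w t = prim (step m) t" by (simp add: w_def)
  qed (auto intro: V_h_continuous_measurable[OF wV] ess_bounded_measurable[OF step_ess_bounded])
  let ?e = "\<lambda>t. u t - w t"
  have eH: "?e \<in> H10_space" by (rule energy.diff_mem[OF uH wH])
  have "AE t in leb. weak_deriv ?e t = weak_deriv u t - weak_deriv w t"
    using H10_lincomb(2)[OF uH wH, of "- 1"] by simp
  then have "AE t in leb. \<bar>weak_deriv ?e t\<bar> \<le> lip_const * B * h"
    using dw weak_deriv_cong_AE[OF uH vH uv] v(5) AE_cell
  proof eventually_elim
    case (elim t)
    then obtain i where "i \<in> {1..l}" "t \<in> cell i" by blast
    then show ?case using elim close step_cell by simp
  qed
  then have "L2_norm (weak_deriv ?e) \<le> lip_const * B * h"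
    using L2_measurable[OF H10_weak_deriv(1)[OF eH]] lip_const_nonneg B h_pos by (intro L2_norm_bound) auto
  have "state_form a d0 ?e ?e \<le> (A + D) * (L2_norm (weak_deriv ?e))\<^sup>2" by (rule energy_le[OF eH])
  also have "\<dots> \<le> (A + D) * (lip_const * B * h)\<^sup>2"
    using \<open>L2_norm (weak_deriv ?e) \<le> lip_const * B * h\<close> A_pos D by (intro mult_left_mono power_mono) auto
  finally have "sqrt (state_form a d0 ?e ?e) \<le> sqrt ((A + D) * (lip_const * B * h)\<^sup>2)"
    by (rule real_sqrt_le_mono)
  also have "\<dots> = fe_const * B * h"
    unfolding fe_const_def using lip_const_nonneg B h_pos by (simp add: real_sqrt_mult)
  finally show ?thesis using wV by blast
qed

lemma galerkin_orthogonality: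
  assumes "is_state a d0 H10_space f u" "is_state a d0 (V_h l x) f uh" "w \<in> V_h l x"
  shows "state_form a d0 (\<lambda>t. u t - uh t) w = 0"
  using assms V_h_H10 unfolding is_state_def by (simp add: energy.form_diff_left)

text \<open>Cea's lemma: the Galerkin solution is the best approximation in the energy norm.\<close>

lemma energy_error:
  assumes f: "ess_bounded f B" and u: "is_state a d0 H10_space f u" and uh: "is_state a d0 (V_h l x) f uh"
  shows "sqrt (state_form a d0 (\<lambda>t. u t - uh t) (\<lambda>t. u t - uh t)) \<le> fe_const * B * h"
proof -
  obtain w where w: "w \<in> V_h l x"
    "sqrt (state_form a d0 (\<lambda>t. u t - w t) (\<lambda>t. u t - w t)) \<le> fe_const * B * h"
    using interpolation_error[OF f u] by blast
  have uhV: "uh \<in> V_h l x" using uh unfolding is_state_def by simp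
  have H: "u \<in> H10_space" "uh \<in> H10_space" "w \<in> H10_space"
    using u uhV w V_h_H10 unfolding is_state_def by auto
  define e where "e = (\<lambda>t. u t - uh t)"
  define d where "d = (\<lambda>t. u t - w t)"
  have eH: "e \<in> H10_space" "d \<in> H10_space" unfolding e_def d_def using energy.diff_mem H by auto
  have "e = (\<lambda>t. d t - (uh t - w t))" unfolding e_def d_def by auto
  then have "state_form a d0 e e = state_form a d0 e d - state_form a d0 e (\<lambda>t. uh t - w t)"
    using energy.form_diff_right[OF eH(2) energy.diff_mem[OF H(2,3)] eH(1)] by simp
  also have "state_form a d0 e (\<lambda>t. uh t - w t) = 0"
    unfolding e_def by (rule galerkin_orthogonality[OF u uh V_h_diff[OF uhV w(1)]])
  also have "state_form a d0 e d - 0 \<le> sqrt (state_form a d0 e e) * sqrt (state_form a d0 d d)"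
    using energy.Cauchy_Schwarz[OF eH] by linarith
  finally have *: "state_form a d0 e e \<le> sqrt (state_form a d0 e e) * sqrt (state_form a d0 d d)" .
  have "sqrt (state_form a d0 e e) \<le> sqrt (state_form a d0 d d)"
  proof (cases "state_form a d0 e e = 0")
    case True then show ?thesis using energy.form_nonneg[OF eH(2)] by simp
  next
    case False
    then have "0 < sqrt (state_form a d0 e e)" using energy.form_nonneg[OF eH(1)] by simp
    moreover have "sqrt (state_form a d0 e e) * sqrt (state_form a d0 e e) \<le> sqrt (state_form a d0 e e) * sqrt (state_form a d0 d d)"
      using * energy.form_nonneg[OF eH(1)] by simp
    ultimately show ?thesis by (rule mult_left_le_imp_le[rotated])
  qed
  then show ?thesis using w(2) unfolding e_def d_def by linarith
qed

text \<open>Galerkin orthogonality in both arguments turns the pairing into the energy product of two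
  discretization errors, which makes it second order.\<close>

lemma galerkin_pairing:
  assumes f: "ess_bounded f Bf" and g: "ess_bounded g Bg"
    and u: "is_state a d0 H10_space g u" "is_state a d0 (V_h l x) g uh"
  shows "\<bar>L2_inner f (\<lambda>t. u t - uh t)\<bar> \<le> fe_const\<^sup>2 * Bf * Bg * h\<^sup>2"
proof -
  obtain v where v: "is_state a d0 H10_space f v" by (rule state_exists_regular[OF f])
  obtain vh where vh: "is_state a d0 (V_h l x) f vh" using discrete_state_exists[OF f] by blast
  have V: "vh \<in> V_h l x" "uh \<in> V_h l x" using u(2) vh unfolding is_state_def by auto
  have H: "v \<in> H10_space" "vh \<in> H10_space" "u \<in> H10_space" "uh \<in> H10_space"
    using u v V V_h_H10 unfolding is_state_def by auto
  define e where "e = (\<lambda>t. u t - uh t)"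
  define d where "d = (\<lambda>t. v t - vh t)"
  have eH: "e \<in> H10_space" "d \<in> H10_space" unfolding e_def d_def using energy.diff_mem H by auto
  have "L2_inner f e = state_form a d0 v e" using v eH(1) unfolding is_state_def by simp
  also have "\<dots> = state_form a d0 d e + state_form a d0 vh e"
    using energy.form_diff_left[OF H(1,2) eH(1)] unfolding d_def by simp
  also have "state_form a d0 vh e = 0"
    using galerkin_orthogonality[OF u V(1)] energy.form_sym[OF H(2) eH(1)] unfolding e_def by simp
  finally have "\<bar>L2_inner f e\<bar> = \<bar>state_form a d0 d e\<bar>" by simp
  also have "\<dots> \<le> sqrt (state_form a d0 d d) * sqrt (state_form a d0 e e)"
    by (rule energy.Cauchy_Schwarz[OF eH(2,1)])
  also have "\<dots> \<le> (fe_const * Bf * h) * (fe_const * Bg * h)"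
    using energy_error[OF f v vh] energy_error[OF g u] energy.form_nonneg[OF eH(1)] energy.form_nonneg[OF eH(2)]
    unfolding d_def e_def by (intro mult_mono) (auto intro: order_trans[rotated])
  also have "\<dots> = fe_const\<^sup>2 * Bf * Bg * h\<^sup>2" by (simp add: power2_eq_square)
  finally show ?thesis unfolding e_def .
qed

end

section \<open>Functions of bounded variation\<close>

abbreviation borel_Omega :: "real measure" where
  "borel_Omega \<equiv> restrict_space borel Omega"

lemma borel_Omega_iff: "A \<in> sets borel_Omega \<longleftrightarrow> A \<subseteq> Omega \<and> A \<in> sets borel"
  by (subst sets_restrict_space_iff) auto

lemma borel_Omega_Int: "A \<in> sets borel \<Longrightarrow> A \<inter> Omega \<in> sets borel_Omega"
  by (auto simp: borel_Omega_iff)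

definition fin_meas :: "real measure \<Rightarrow> bool" where
  "fin_meas M \<longleftrightarrow> finite_measure M \<and> sets M = sets borel_Omega"

text \<open>Defined on the whole line, the distribution function is monotone and right continuous everywhere,
  which is what is needed to recover a measure from it.\<close>

definition distr_fun :: "real measure \<Rightarrow> real \<Rightarrow> real" where
  "distr_fun M t = measure M ({..t} \<inter> Omega)"

lemma fin_meas_space: "fin_meas M \<Longrightarrow> space M = Omega"
  unfolding fin_meas_def using sets_eq_imp_space_eq[of M borel_Omega] by (simp add: space_restrict_space)

lemma distr_fun_mono: "fin_meas M \<Longrightarrow> s \<le> t \<Longrightarrow> distr_fun M s \<le> distr_fun M t"
  unfolding distr_fun_def fin_meas_def
  by (intro finite_measure.finite_measure_mono) (auto simp: borel_Omega_Int)

lemma distr_fun_nonneg: "0 \<le> distr_fun M t"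
  unfolding distr_fun_def by simp

lemma distr_fun_le: "fin_meas M \<Longrightarrow> distr_fun M t \<le> measure M Omega"
  unfolding distr_fun_def fin_meas_def
  by (intro finite_measure.finite_measure_mono) (auto simp: borel_Omega_iff)

lemma distr_fun_right_continuous:
  assumes M: "fin_meas M" shows "continuous (at_right t) (distr_fun M)"
  unfolding continuous_within
proof (rule tendsto_at_right_sequentially[of t "t + 1"])
  fix S :: "nat \<Rightarrow> real"
  assume S: "\<And>n. t < S n" "decseq S" "S \<longlonglongrightarrow> t"
  have "(\<lambda>n. measure M ({..S n} \<inter> Omega)) \<longlonglongrightarrow> measure M (\<Inter>n. {..S n} \<inter> Omega)"
    using M S(2) unfolding fin_meas_def
    by (intro finite_measure.finite_Lim_measure_decseq) (auto simp: borel_Omega_Int decseq_def intro: order_trans)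
  moreover have "(\<Inter>n. {..S n} \<inter> Omega) = {..t} \<inter> Omega"
  proof (intro equalityI subsetI)
    fix s assume s: "s \<in> (\<Inter>n. {..S n} \<inter> Omega)"
    then have "\<And>n. s \<le> S n" by auto
    then have "s \<le> t" by (intro LIMSEQ_le_const[OF S(3)]) auto
    then show "s \<in> {..t} \<inter> Omega" using s by auto
  next
    fix s assume "s \<in> {..t} \<inter> Omega"
    then show "s \<in> (\<Inter>n. {..S n} \<inter> Omega)" using S(1) by (force intro: less_imp_le order_trans)
  qed
  ultimately show "(\<lambda>n. distr_fun M (S n)) \<longlonglongrightarrow> distr_fun M t" unfolding distr_fun_def by simp
qed simp

lemma mono_borel_leb:
  fixes F :: "real \<Rightarrow> real" assumes "\<And>s t. s \<le> t \<Longrightarrow> F s \<le> F t" shows "F \<in> borel_measurable borel"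
  by (rule borel_measurable_mono) (auto simp: mono_def assms)

lemma distr_fun_borel: "fin_meas M \<Longrightarrow> distr_fun M \<in> borel_measurable borel"
  by (rule mono_borel_leb) (rule distr_fun_mono)

lemma distr_fun_ess_bounded: "fin_meas M \<Longrightarrow> ess_bounded (distr_fun M) (measure M Omega)"
  using distr_fun_le distr_fun_nonneg
  by (intro ess_bounded_I borel_measurable_leb distr_fun_borel) auto

lemma test_integrable_fin_meas:
  assumes M: "fin_meas M" and \<phi>: "\<phi> \<in> test_functions" shows "integrable M \<phi>"
proof -
  obtain K where K: "\<And>t. \<bar>\<phi> t\<bar> \<le> K" using test_bounded[OF \<phi>] by metis
  interpret finite_measure M using M unfolding fin_meas_def by simp
  have "\<phi> \<in> borel_measurable borel_Omega" by (intro measurable_restrict_space1 test_measurable \<phi>)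
  then have "\<phi> \<in> borel_measurable M"
    using M measurable_cong_sets[of M borel_Omega] unfolding fin_meas_def by auto
  then show ?thesis by (intro integrable_const_bound[of _ K]) (auto simp: K)
qed

text \<open>Fubini's theorem produces the mass to the right of \<open>t\<close>; the total mass drops out since derivatives
  of test functions have mean zero.\<close>

lemma integral_test_fin_meas:
  assumes M: "fin_meas M" and \<phi>: "\<phi> \<in> test_functions"
  shows "integral\<^sup>L M \<phi> = - (LINT t|leb. distr_fun M t * deriv \<phi> t)"
proof -
  interpret finite_measure M using M unfolding fin_meas_def by simp
  note d = integrable_test[OF test_deriv[OF \<phi>]]
  have "integral\<^sup>L M \<phi> = (LINT s|M. 1 * prim (deriv \<phi>) s)"
    by (rule Bochner_Integration.integral_cong)
       (auto simp: fin_meas_space[OF M] prim_deriv_test[OF \<phi>] Omega_iff)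
  also have "\<dots> = (LINT t|leb. deriv \<phi> t * (LINT s|M. indicator {t<..} s * 1))"
  proof (rule integral_times_prim[OF finite_measure_axioms _ _ _ d])
    have "(\<lambda>s. s) \<in> borel_measurable borel_Omega" by (intro measurable_restrict_space1) simp
    then show "(\<lambda>s. s) \<in> borel_measurable M"
      using M measurable_cong_sets[of M borel_Omega] unfolding fin_meas_def by auto
  qed (auto simp: fin_meas_space[OF M])
  also have "\<dots> = (LINT t|leb. deriv \<phi> t * (measure M Omega - distr_fun M t))"
  proof -
    have "(LINT s|M. indicator {t<..} s * 1) = measure M Omega - distr_fun M t" for t
    proof -
      have "(LINT s|M. indicator {t<..} s * 1) = measure M ({t<..} \<inter> Omega)"
        by (simp add: fin_meas_space[OF M])
      also have "{t<..} \<inter> Omega = Omega - ({..t} \<inter> Omega)" by auto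
      also have "measure M \<dots> = measure M Omega - measure M ({..t} \<inter> Omega)"
        using M unfolding fin_meas_def
        by (intro finite_measure_Diff) (auto simp: borel_Omega_Int borel_Omega_iff)
      finally show ?thesis unfolding distr_fun_def .
    qed
    then show ?thesis by simp
  qed
  also have "\<dots> = (LINT t|leb. measure M Omega * deriv \<phi> t - distr_fun M t * deriv \<phi> t)"
    by (simp add: algebra_simps)
  also have "\<dots> = - (LINT t|leb. distr_fun M t * deriv \<phi> t)"
  proof -
    have "integrable leb (\<lambda>t. distr_fun M t * deriv \<phi> t)"
      using L2_mult_integrable[OF ess_bounded_L2[OF distr_fun_ess_bounded[OF M]] test_L2[OF test_deriv[OF \<phi>]]] .
    then show ?thesis using d integral_deriv_test[OF \<phi>] by simp
  qed
  finally show ?thesis .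
qed

subsection \<open>Signed measures\<close>

text \<open>Some decomposition into finite positive measures; the two parts may overlap.\<close>

definition decomposes :: "(real set \<Rightarrow> real) \<Rightarrow> real measure \<Rightarrow> real measure \<Rightarrow> bool" where
  "decomposes \<mu> M N \<longleftrightarrow> fin_meas M \<and> fin_meas N \<and>
     (\<forall>A\<in>sets borel_Omega. \<mu> A = measure M A - measure N A)"

lemma decomposes_signed_measure:
  assumes "decomposes \<mu> M N" shows "signed_measure \<mu>"
  unfolding signed_measure_def
proof (intro allI impI)
  fix A :: "nat \<Rightarrow> real set"
  assume A: "range A \<subseteq> sets borel_Omega" "disjoint_family A"
  have M: "fin_meas M" "fin_meas N" "\<And>A. A \<in> sets borel_Omega \<Longrightarrow> \<mu> A = measure M A - measure N A"
    using assms unfolding decomposes_def by auto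
  have "(\<lambda>n. measure M (A n) - measure N (A n)) sums (measure M (\<Union>n. A n) - measure N (\<Union>n. A n))"
    using A M(1,2) unfolding fin_meas_def
    by (intro sums_diff finite_measure.finite_measure_UNION) auto
  moreover have "(\<Union>n. A n) \<in> sets borel_Omega" using A(1) by auto
  moreover have "A n \<in> sets borel_Omega" for n using A(1) by auto
  ultimately show "(\<lambda>n. \<mu> (A n)) sums \<mu> (\<Union>n. A n)" using M(3) by simp
qed

lemma signed_measure_lincomb:
  assumes "signed_measure \<mu>" "signed_measure \<nu>" shows "signed_measure (\<lambda>A. c * \<mu> A + d * \<nu> A)"
  using assms unfolding signed_measure_def by (auto intro!: sums_add sums_mult)

lemma signed_measure_empty:
  assumes "signed_measure \<mu>" shows "\<mu> {} = 0"
proof -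
  have "(\<lambda>n::nat. \<mu> {}) sums \<mu> {}"
    using assms[unfolded signed_measure_def, rule_format, of "\<lambda>n. {}"] by (simp add: disjoint_family_on_def)
  then have "summable (\<lambda>n::nat. \<mu> {})" by (rule sums_summable)
  then show ?thesis by (simp add: summable_const_iff)
qed

lemma signed_measure_Diff:
  assumes \<mu>: "signed_measure \<mu>" and A: "A \<in> sets borel_Omega" "B \<in> sets borel_Omega" "A \<subseteq> B"
  shows "\<mu> (B - A) = \<mu> B - \<mu> A"
proof -
  define S where "S = (\<lambda>n::nat. if n = 0 then A else if n = 1 then B - A else {})"
  have "(\<lambda>n. \<mu> (S n)) sums \<mu> (\<Union>n. S n)"
  proof (rule \<mu>[unfolded signed_measure_def, rule_format])
    show "range S \<subseteq> sets borel_Omega" using A by (auto simp: S_def)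
    show "disjoint_family S" by (auto simp: disjoint_family_on_def S_def)
  qed
  moreover have "(\<Union>n. S n) = B"
  proof -
    have "S 0 = A" "S 1 = B - A" by (auto simp: S_def)
    then have "B \<subseteq> (\<Union>n. S n)" using UNIV_I by blast
    moreover have "(\<Union>n. S n) \<subseteq> B" using A(3) by (auto simp: S_def split: if_splits)
    ultimately show ?thesis by auto
  qed
  moreover have "(\<lambda>n. \<mu> (S n)) sums (\<Sum>n\<in>{0, 1}. \<mu> (S n))"
    by (rule sums_finite) (auto simp: S_def signed_measure_empty[OF \<mu>])
  ultimately have "\<mu> B = (\<Sum>n\<in>{0, 1}. \<mu> (S n))" using sums_unique2 by metis
  then show ?thesis by (simp add: S_def)
qed

lemma signed_measure_Ioc:
  assumes \<mu>: "signed_measure \<mu>" and st: "0 \<le> s" "s \<le> t" "t < 1"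
  shows "\<mu> {s<..t} = \<mu> ({..t} \<inter> Omega) - \<mu> ({..s} \<inter> Omega)"
proof -
  have eq: "{s<..t} = ({..t} \<inter> Omega) - ({..s} \<inter> Omega)" using st by (auto simp: Omega_iff)
  show ?thesis
    by (subst eq, rule signed_measure_Diff[OF \<mu> borel_Omega_Int borel_Omega_Int]) (use st in auto)
qed

text \<open>By right continuity the distribution function is constant on the whole interval, and its value
  at \<open>0\<close>, the measure of the empty set, shows that it is zero.  The rays \<open>{..t}\<close> are closed under
  intersection and generate the Borel sets.\<close>

lemma signed_measure_zero:
  assumes \<mu>: "signed_measure \<mu>"
    and rc: "\<And>t. continuous (at_right t) (\<lambda>t. \<mu> ({..t} \<inter> Omega))"
    and c: "AE t in leb. \<mu> ({..t} \<inter> Omega) = c"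
    and A: "A \<in> sets borel_Omega"
  shows "\<mu> A = 0"
proof -
  define F where "F = (\<lambda>t. \<mu> ({..t} \<inter> Omega))"
  have Fc: "F t = c" if t: "0 \<le> t" "t < 1" for t
  proof (rule ccontr)
    assume "F t \<noteq> c"
    moreover have "(F \<longlongrightarrow> F t) (at_right t)" using rc[of t] unfolding F_def continuous_within .
    ultimately have "\<forall>\<^sub>F s in at_right t. F s \<noteq> c"
      using tendsto_imp_eventually_ne by blast
    then obtain b where b: "b > t" "\<And>s. t < s \<Longrightarrow> s < b \<Longrightarrow> F s \<noteq> c"
      unfolding eventually_at_right_field by blast
    define b' where "b' = min b 1"
    have b': "t < b'" "b' \<le> 1" using b t unfolding b'_def by auto
    have "AE s in leb. (indicator {t<..<b'} s :: real) = 0"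
      using c by eventually_elim (use b in \<open>auto simp: F_def b'_def indicator_def\<close>)
    then have "(LINT s|leb. indicator {t<..<b'} s :: real) = 0" by (rule integral_eq_zero_AE)
    moreover have "{t<..<b'} \<inter> Omega = {t<..<b'}" using t b' by (auto simp: Omega_iff)
    ultimately show False using measure_leb_interval[of t b'] t b' by simp
  qed
  have "F 0 = \<mu> {}" unfolding F_def by (rule arg_cong[of _ _ \<mu>]) (auto simp: Omega_iff)
  then have c0: "c = 0" using Fc[of 0] signed_measure_empty[OF \<mu>] by simp
  have \<Omega>: "\<mu> Omega = 0"
  proof -
    define y where "y = (\<lambda>n::nat. 1 - 1 / (real n + 1))"
    define S where "S = (\<lambda>n. {y n<..y (Suc n)})"
    have y: "y n \<le> y (Suc n)" "0 \<le> y n" "y n < 1" for n unfolding y_def by (auto simp: field_simps)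
    have S: "S n \<in> sets borel_Omega" "\<mu> (S n) = 0" for n
    proof -
      have "\<mu> (S n) = F (y (Suc n)) - F (y n)"
        unfolding F_def S_def by (rule signed_measure_Ioc[OF \<mu> y(2,1,3)])
      then show "\<mu> (S n) = 0" using Fc y by simp
      show "S n \<in> sets borel_Omega"
        unfolding S_def borel_Omega_iff using y(2)[of n] y(3)[of "Suc n"] by (auto simp: Omega_iff)
    qed
    have mono: "y m \<le> y n" if "m \<le> n" for m n using y(1) that by (rule lift_Suc_mono_le)
    have "S m \<inter> S n = {}" if "m < n" for m n
      using mono[of "Suc m" n] that unfolding S_def by auto
    then have "S m \<inter> S n = {}" if "m \<noteq> n" for m n
      using that by (metis Int_commute linorder_neqE_nat)
    then have "disjoint_family S" unfolding disjoint_family_on_def by blast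
    then have "(\<lambda>n. \<mu> (S n)) sums \<mu> (\<Union>n. S n)"
      using \<mu>[unfolded signed_measure_def] S(1) by blast
    moreover have "(\<Union>n. S n) = Omega"
    proof (intro equalityI subsetI)
      fix t assume "t \<in> (\<Union>n. S n)"
      then show "t \<in> Omega" using S(1) borel_Omega_iff by blast
    next
      fix t assume t: "t \<in> Omega"
      have "\<exists>n. t \<le> y n"
      proof -
        obtain n where "1 / real (Suc n) < 1 - t" using nat_approx_posE[of "1 - t"] t by (auto simp: Omega_iff)
        then show ?thesis unfolding y_def by (intro exI[of _ n]) (simp add: add.commute)
      qed
      define n where "n = (LEAST n. t \<le> y n)"
      have n: "t \<le> y n" unfolding n_def using \<open>\<exists>n. t \<le> y n\<close> by (rule LeastI_ex)
      have "y 0 = 0" unfolding y_def by simp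
      then have "n \<noteq> 0" using n t unfolding Omega_iff by (metis not_le)
      then obtain m where m: "n = Suc m" using not0_implies_Suc by blast
      have "\<not> t \<le> y m" using not_less_Least[of m "\<lambda>n. t \<le> y n"] m unfolding n_def by auto
      then have "t \<in> S m" using n m unfolding S_def by auto
      then show "t \<in> (\<Union>n. S n)" by blast
    qed
    ultimately have "(\<lambda>n::nat. 0) sums \<mu> Omega" using S(2) by simp
    then show ?thesis using sums_unique2 sums_zero by blast
  qed
  have F0: "\<mu> (Omega \<inter> {..t}) = 0" for t
  proof -
    consider "t < 0" | "0 \<le> t" "t < 1" | "t \<ge> 1" by linarith
    then show ?thesis
    proof cases
      case 1
      then have "Omega \<inter> {..t} = {}" by (auto simp: Omega_iff)
      then show ?thesis using signed_measure_empty[OF \<mu>] by simp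
    next
      case 2 then show ?thesis using Fc[OF 2] c0 unfolding F_def by (simp add: Int_commute)
    next
      case 3
      then have "Omega \<inter> {..t} = Omega" by (auto simp: Omega_iff)
      then show ?thesis using \<Omega> by simp
    qed
  qed
  define G where "G = (\<inter>) Omega ` range (atMost :: real \<Rightarrow> real set)"
  have gen: "sets borel_Omega = sigma_sets Omega G"
  proof -
    have "sets (borel :: real measure) = sigma_sets UNIV (range atMost)"
      by (subst borel_eq_atMost) simp
    then show ?thesis unfolding G_def sets_restrict_space
      using sigma_sets_Int[of Omega UNIV "range atMost"] by (simp add: Omega_borel[unfolded \<open>sets borel = _\<close>])
  qed
  have stable: "Int_stable G"
  proof (rule Int_stableI)
    fix A B assume "A \<in> G" "B \<in> G"
    then obtain s t where "A = Omega \<inter> {..s}" "B = Omega \<inter> {..t}" unfolding G_def by auto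
    then have "A \<inter> B = Omega \<inter> {..min s t}" by auto
    then show "A \<inter> B \<in> G" unfolding G_def by blast
  qed
  have "G \<subseteq> Pow Omega" unfolding G_def by auto
  from stable this A[unfolded gen] show ?thesis
  proof (induction rule: sigma_sets_induct_disjoint)
    case (basic A) then show ?case unfolding G_def using F0 by auto
  next
    case empty show ?case by (rule signed_measure_empty[OF \<mu>])
  next
    case (compl A)
    have "\<mu> (Omega - A) = \<mu> Omega - \<mu> A"
      using compl(1) unfolding gen[symmetric]
      by (intro signed_measure_Diff[OF \<mu>]) (auto simp: borel_Omega_iff)
    then show ?case using compl \<Omega> by simp
  next
    case (union A)
    then have "(\<lambda>n. \<mu> (A n)) sums \<mu> (\<Union>n. A n)"
      using \<mu>[unfolded signed_measure_def] unfolding gen[symmetric] by blast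
    then show ?case using union(3) sums_unique2[OF _ sums_zero] by simp
  qed
qed

lemma decomposes_distr:
  "decomposes \<mu> M N \<Longrightarrow> \<mu> ({..t} \<inter> Omega) = distr_fun M t - distr_fun N t"
  unfolding decomposes_def distr_fun_def by (simp add: borel_Omega_Int)

lemma decomposes_right_continuous:
  assumes "decomposes \<mu> M N" shows "continuous (at_right t) (\<lambda>t. \<mu> ({..t} \<inter> Omega))"
  unfolding decomposes_distr[OF assms] using assms unfolding decomposes_def
  by (intro continuous_intros distr_fun_right_continuous) auto

subsection \<open>Representation by monotone functions\<close>

text \<open>The decomposition behind the integral of \<open>\<phi>\<close> may depend on \<open>\<phi>\<close>, but the difference of the two
  distribution functions is determined by \<open>\<mu>\<close>; the lemma of du Bois-Reymond then identifies \<open>q\<close> up to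
  a constant.\<close>

lemma measure_deriv_representation:
  assumes q: "integrable leb q" and \<mu>: "has_measure_deriv q \<mu>"
  obtains M N c where "decomposes \<mu> M N" "AE t in leb. q t = c + (distr_fun M t - distr_fun N t)"
proof -
  have J: "\<exists>M N. decomposes \<mu> M N \<and> - (LINT t|leb. q t * deriv \<phi> t) = integral\<^sup>L M \<phi> - integral\<^sup>L N \<phi>"
    if "\<phi> \<in> test_functions" for \<phi>
    using \<mu> that unfolding has_measure_deriv_def has_signed_integral_def decomposes_def fin_meas_def by blast
  obtain M N where MN: "decomposes \<mu> M N" using J[OF zero_test] by blast
  have fin: "fin_meas M" "fin_meas N" using MN unfolding decomposes_def by auto
  have D: "ess_bounded (\<lambda>t. distr_fun M t - distr_fun N t) (measure M Omega + measure N Omega)"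
    by (intro ess_bounded_diff distr_fun_ess_bounded fin)
  have "\<exists>c. AE t in leb. q t - (distr_fun M t - distr_fun N t) = c"
  proof (rule AE_const_if_orthogonal_to_test_derivs)
    show "integrable leb (\<lambda>t. q t - (distr_fun M t - distr_fun N t))"
      using q ess_bounded_integrable[OF D] by simp
  next
    fix \<phi> assume \<phi>: "\<phi> \<in> test_functions"
    obtain M' N' where MN': "decomposes \<mu> M' N'"
      "- (LINT t|leb. q t * deriv \<phi> t) = integral\<^sup>L M' \<phi> - integral\<^sup>L N' \<phi>" using J[OF \<phi>] by blast
    have fin': "fin_meas M'" "fin_meas N'" using MN' unfolding decomposes_def by auto
    note d = test_L2[OF test_deriv[OF \<phi>]]
    have i: "integrable leb (\<lambda>t. distr_fun K t * deriv \<phi> t)" if "fin_meas K" for K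
      using L2_mult_integrable[OF ess_bounded_L2[OF distr_fun_ess_bounded[OF that]] d] .
    have qi: "integrable leb (\<lambda>t. q t * deriv \<phi> t)"
    proof -
      obtain K where "\<And>t. \<bar>deriv \<phi> t\<bar> \<le> K" using test_bounded[OF test_deriv[OF \<phi>]] by metis
      then show ?thesis by (intro integrable_mult_bounded[OF q L2_measurable[OF d], of K]) auto
    qed
    have "(LINT t|leb. q t * deriv \<phi> t) = (LINT t|leb. distr_fun M' t * deriv \<phi> t) - (LINT t|leb. distr_fun N' t * deriv \<phi> t)"
      using MN'(2) integral_test_fin_meas[OF fin'(1) \<phi>] integral_test_fin_meas[OF fin'(2) \<phi>] by simp
    also have "\<dots> = (LINT t|leb. (distr_fun M' t - distr_fun N' t) * deriv \<phi> t)"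
      using i fin' by (simp add: left_diff_distrib)
    also have "\<dots> = (LINT t|leb. (distr_fun M t - distr_fun N t) * deriv \<phi> t)"
      using decomposes_distr[OF MN] decomposes_distr[OF MN'(1)] by simp
    finally have "(LINT t|leb. q t * deriv \<phi> t - (distr_fun M t - distr_fun N t) * deriv \<phi> t) = 0"
      using qi L2_mult_integrable[OF ess_bounded_L2[OF D] d] by simp
    then show "(LINT t|leb. (q t - (distr_fun M t - distr_fun N t)) * deriv \<phi> t) = 0"
      by (simp add: left_diff_distrib)
  qed
  then obtain c where "AE t in leb. q t - (distr_fun M t - distr_fun N t) = c" by blast
  then have "AE t in leb. q t = c + (distr_fun M t - distr_fun N t)" by eventually_elim simp
  then show thesis using that MN by blast
qed

text \<open>Sums of finite measures are handled through their distribution functions: monotone right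
  continuous functions can be added, and every such function is turned back into a measure.\<close>

definition monotone_rc :: "(real \<Rightarrow> real) \<Rightarrow> bool" where
  "monotone_rc F \<longleftrightarrow> (\<forall>s t. s \<le> t \<longrightarrow> F s \<le> F t) \<and> (\<forall>t. continuous (at_right t) F)"

definition stieltjes :: "(real \<Rightarrow> real) \<Rightarrow> real measure" where
  "stieltjes F = restrict_space (interval_measure F) Omega"

lemma distr_fun_monotone_rc: "fin_meas M \<Longrightarrow> monotone_rc (distr_fun M)"
  unfolding monotone_rc_def using distr_fun_mono distr_fun_right_continuous by blast

lemma monotone_rc_lincomb:
  assumes "monotone_rc F" "monotone_rc G" "c \<ge> 0" "d \<ge> 0"
  shows "monotone_rc (\<lambda>t. c * F t + d * G t)"
  using assms unfolding monotone_rc_def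
  by (auto intro!: add_mono mult_left_mono continuous_intros)

lemma stieltjes_distr:
  assumes F: "monotone_rc F"
  shows "fin_meas (stieltjes F)" and "measure (stieltjes F) Omega \<le> F 1 - F 0"
    and "t \<in> Omega \<Longrightarrow> distr_fun (stieltjes F) t = F t - F 0"
proof -
  have sets: "sets (stieltjes F) = sets borel_Omega"
    unfolding stieltjes_def by (simp add: sets_restrict_space)
  have Om: "Omega \<inter> space (interval_measure F) \<in> sets (interval_measure F)" by simp
  have em: "emeasure (stieltjes F) A = emeasure (interval_measure F) A" if "A \<subseteq> Omega" for A
    unfolding stieltjes_def by (rule emeasure_restrict_space[OF Om that])
  have Ioc: "emeasure (interval_measure F) {s<..t} = F t - F s" if "s \<le> t" for s t
    using F that unfolding monotone_rc_def by (intro emeasure_interval_measure_Ioc) auto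
  have le: "emeasure (stieltjes F) Omega \<le> ennreal (F 1 - F 0)"
    unfolding em[OF order_refl] Ioc[of 0 1, simplified, symmetric]
    by (intro emeasure_mono) (auto simp: Omega_iff)
  have sp: "space (stieltjes F) = Omega" unfolding stieltjes_def by (simp add: space_restrict_space)
  have "finite_measure (stieltjes F)"
    by (rule finite_measureI) (use le sp in \<open>auto simp: top_unique\<close>)
  then show fin: "fin_meas (stieltjes F)" unfolding fin_meas_def using sets by simp
  interpret finite_measure "stieltjes F" by fact
  have mono: "F s \<le> F t" if "s \<le> t" for s t using F that unfolding monotone_rc_def by simp
  show "measure (stieltjes F) Omega \<le> F 1 - F 0"
    using le mono[of 0 1] unfolding emeasure_eq_measure by (simp add: ennreal_le_iff)
  assume t: "t \<in> Omega"
  then have "{..t} \<inter> Omega = {0<..t}" by (auto simp: Omega_iff)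
  moreover have "emeasure (stieltjes F) {0<..t} = ennreal (F t - F 0)"
    using t Ioc[of 0 t] by (subst em) (auto simp: Omega_iff)
  ultimately show "distr_fun (stieltjes F) t = F t - F 0"
    unfolding distr_fun_def measure_def using mono[of 0 t] t by (simp add: Omega_iff)
qed

text \<open>The converse of the representation: differences of monotone right continuous functions have a
  measure as derivative.\<close>

lemma has_measure_deriv_stieltjes:
  assumes F: "monotone_rc F" and G: "monotone_rc G" and q: "q \<in> borel_measurable leb"
    and eq: "AE t in leb. q t = c + (F t - G t)"
  defines "\<mu> \<equiv> \<lambda>A. measure (stieltjes F) A - measure (stieltjes G) A"
  shows "has_measure_deriv q \<mu>" and "decomposes \<mu> (stieltjes F) (stieltjes G)" and "integrable leb q"
proof -
  note SF = stieltjes_distr[OF F] and SG = stieltjes_distr[OF G]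
  show J: "decomposes \<mu> (stieltjes F) (stieltjes G)" unfolding decomposes_def \<mu>_def using SF SG by auto
  define k where "k = c + (F 0 - G 0)"
  define r where "r = (\<lambda>t. distr_fun (stieltjes F) t - distr_fun (stieltjes G) t)"
  have r: "ess_bounded r (measure (stieltjes F) Omega + measure (stieltjes G) Omega)"
    unfolding r_def by (intro ess_bounded_diff distr_fun_ess_bounded SF(1) SG(1))
  have qr: "AE t in leb. q t = k + r t"
    using eq AE_space by eventually_elim (simp add: k_def r_def SF(3) SG(3))
  have qB: "ess_bounded q (\<bar>k\<bar> + (measure (stieltjes F) Omega + measure (stieltjes G) Omega))"
    by (rule ess_bounded_cong_AE[OF ess_bounded_add[OF ess_bounded_const r] q qr])
  then show "integrable leb q" by (rule ess_bounded_integrable)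
  show "has_measure_deriv q \<mu>"
    unfolding has_measure_deriv_def
  proof (intro conjI ballI)
    show "signed_measure \<mu>" by (rule decomposes_signed_measure[OF J])
    fix \<phi> assume \<phi>: "\<phi> \<in> test_functions"
    note d = test_L2[OF test_deriv[OF \<phi>]]
    have i: "integrable leb (\<lambda>t. distr_fun K t * deriv \<phi> t)" if "fin_meas K" for K
      using L2_mult_integrable[OF ess_bounded_L2[OF distr_fun_ess_bounded[OF that]] d] .
    have "(LINT t|leb. q t * deriv \<phi> t) = (LINT t|leb. k * deriv \<phi> t
        + (distr_fun (stieltjes F) t * deriv \<phi> t - distr_fun (stieltjes G) t * deriv \<phi> t))"
    proof (rule integral_cong_AE)
      show "AE t in leb. q t * deriv \<phi> t = k * deriv \<phi> t
        + (distr_fun (stieltjes F) t * deriv \<phi> t - distr_fun (stieltjes G) t * deriv \<phi> t)"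
        using qr by eventually_elim (simp add: r_def distrib_right left_diff_distrib)
    qed (use q L2_measurable[OF d] i[OF SF(1)] i[OF SG(1)] in \<open>auto dest: borel_measurable_integrable\<close>)
    also have "\<dots> = (LINT t|leb. distr_fun (stieltjes F) t * deriv \<phi> t) - (LINT t|leb. distr_fun (stieltjes G) t * deriv \<phi> t)"
      using i[OF SF(1)] i[OF SG(1)] integrable_test[OF test_deriv[OF \<phi>]] integral_deriv_test[OF \<phi>] by simp
    finally have "- (LINT t|leb. q t * deriv \<phi> t) = integral\<^sup>L (stieltjes F) \<phi> - integral\<^sup>L (stieltjes G) \<phi>"
      using integral_test_fin_meas[OF SF(1) \<phi>] integral_test_fin_meas[OF SG(1) \<phi>] by simp
    then show "has_signed_integral \<mu> \<phi> (- (LINT t|leb. q t * deriv \<phi> t))"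
      unfolding has_signed_integral_def
      using J test_integrable_fin_meas[OF SF(1) \<phi>] test_integrable_fin_meas[OF SG(1) \<phi>]
      unfolding decomposes_def fin_meas_def by blast
  qed
qed

lemma BV_measure_deriv:
  assumes "q \<in> BV_space" shows "integrable leb q" "has_measure_deriv q (measure_deriv q)"
  using assms someI_ex[of "has_measure_deriv q"] unfolding BV_space_def L1_space_def measure_deriv_def by auto

text \<open>The choice made in \<open>measure_deriv\<close> is immaterial on Borel sets: every signed measure with the right
  distribution function agrees with it there.\<close>

lemma measure_deriv_eq:
  assumes q: "q \<in> BV_space" and \<nu>: "signed_measure \<nu>"
    and rc: "\<And>t. continuous (at_right t) (\<lambda>t. \<nu> ({..t} \<inter> Omega))"
    and eq: "AE t in leb. q t = c + \<nu> ({..t} \<inter> Omega)" and A: "A \<in> sets borel_Omega"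
  shows "measure_deriv q A = \<nu> A"
proof -
  obtain M N c' where MN: "decomposes (measure_deriv q) M N"
    "AE t in leb. q t = c' + (distr_fun M t - distr_fun N t)"
    using measure_deriv_representation[OF BV_measure_deriv[OF q]] by blast
  let ?\<delta> = "\<lambda>A. 1 * measure_deriv q A + (- 1) * \<nu> A"
  have "?\<delta> A = 0"
  proof (rule signed_measure_zero[OF _ _ _ A])
    show "signed_measure ?\<delta>" by (rule signed_measure_lincomb[OF decomposes_signed_measure[OF MN(1)] \<nu>])
    show "continuous (at_right t) (\<lambda>t. ?\<delta> ({..t} \<inter> Omega))" for t
      by (intro continuous_intros rc decomposes_right_continuous[OF MN(1)])
    show "AE t in leb. ?\<delta> ({..t} \<inter> Omega) = c - c'"
      using MN(2) eq by eventually_elim (simp add: decomposes_distr[OF MN(1)])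
  qed
  then show ?thesis by simp
qed

subsection \<open>Total variation\<close>

definition borel_partitions :: "real set set set" where
  "borel_partitions = {P. finite P \<and> P \<subseteq> sets borel_Omega \<and> partition_on Omega P}"

lemma total_variation_alt: "total_variation \<mu> = (SUP P\<in>borel_partitions. \<Sum>E\<in>P. \<bar>\<mu> E\<bar>)"
  unfolding total_variation_def borel_partitions_def ..

lemma borel_partitions_nonempty: "borel_partitions \<noteq> {}"
proof -
  have "{Omega} \<in> borel_partitions"
    unfolding borel_partitions_def partition_on_def
    using Omega_iff[of "1/2"] by (auto simp: borel_Omega_iff)
  then show ?thesis by blast
qed

lemma partition_sum_le:
  assumes J: "decomposes \<mu> M N" and P: "P \<in> borel_partitions"
  shows "(\<Sum>E\<in>P. \<bar>\<mu> E\<bar>) \<le> measure M Omega + measure N Omega"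
proof -
  have P': "finite P" "P \<subseteq> sets borel_Omega" "partition_on Omega P" using P unfolding borel_partitions_def by auto
  have sum: "(\<Sum>E\<in>P. measure K E) = measure K Omega" if K: "fin_meas K" for K
  proof -
    have "disjoint_family_on (\<lambda>E. E) P"
      using P'(3) unfolding partition_on_def disjoint_family_on_def disjoint_def by auto
    then have "measure K (\<Union>E\<in>P. E) = (\<Sum>E\<in>P. measure K E)"
      using K P'(1,2) unfolding fin_meas_def by (intro finite_measure.finite_measure_finite_Union) auto
    then show ?thesis using P'(3) unfolding partition_on_def by simp
  qed
  have "(\<Sum>E\<in>P. \<bar>\<mu> E\<bar>) \<le> (\<Sum>E\<in>P. measure M E + measure N E)"
  proof (rule sum_mono)
    fix E assume "E \<in> P"
    then have "\<mu> E = measure M E - measure N E" using J P'(2) unfolding decomposes_def by auto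
    then show "\<bar>\<mu> E\<bar> \<le> measure M E + measure N E"
      using measure_nonneg[of M E] measure_nonneg[of N E] by linarith
  qed
  then show ?thesis using sum J unfolding decomposes_def by (simp add: sum.distrib)
qed

lemma total_variation_leI:
  "(\<And>P. P \<in> borel_partitions \<Longrightarrow> (\<Sum>E\<in>P. \<bar>\<mu> E\<bar>) \<le> K) \<Longrightarrow> total_variation \<mu> \<le> K"
  unfolding total_variation_alt by (rule cSUP_least[OF borel_partitions_nonempty])

lemma total_variation_ge:
  assumes "decomposes \<mu> M N" "P \<in> borel_partitions" shows "(\<Sum>E\<in>P. \<bar>\<mu> E\<bar>) \<le> total_variation \<mu>"
  unfolding total_variation_alt
  by (rule cSUP_upper[OF assms(2)], rule bdd_aboveI2) (rule partition_sum_le[OF assms(1)])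

text \<open>Disjoint intervals together with the rest of the unit interval form a partition.\<close>

lemma total_variation_increments:
  assumes J: "decomposes \<mu> M N" and y: "\<And>i. i < n \<Longrightarrow> y i < y (Suc i)" and y\<Omega>: "\<And>i. i \<le> n \<Longrightarrow> y i \<in> Omega"
  shows "(\<Sum>i<n. \<bar>\<mu> {y i<..y (Suc i)}\<bar>) \<le> total_variation \<mu>"
proof -
  define E where "E = (\<lambda>i. {y i<..y (Suc i)})"
  have mono: "y i \<le> y j" if "i \<le> j" "j \<le> n" for i j
    using that
  proof (induction j)
    case (Suc j) then show ?case using y[of j] by (cases "i = Suc j") auto
  qed simp
  have disj: "E i \<inter> E j = {}" if "i < j" "j < n" for i j
    using mono[of "Suc i" j] that unfolding E_def by auto
  have disj': "E i \<inter> E j = {}" if "i \<noteq> j" "i < n" "j < n" for i j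
    using disj[of i j] disj[of j i] that by (cases "i < j") (auto simp: Int_commute)
  have ne: "E i \<noteq> {}" if "i < n" for i using y[OF that] unfolding E_def by auto
  have sub: "E i \<subseteq> Omega" if "i < n" for i
    using y\<Omega>[of i] y\<Omega>[of "Suc i"] that unfolding E_def by (auto simp: Omega_iff)
  have inj: "inj_on E {..<n}" using disj' ne by (intro inj_onI) (metis inf.idem lessThan_iff)
  define R where "R = Omega - (\<Union>i<n. E i)"
  have "y 0 \<notin> E i" if "i < n" for i using mono[of 0 i] that unfolding E_def by simp
  then have "y 0 \<in> R" using y\<Omega>[of 0] unfolding R_def by simp
  then have Rne: "R \<noteq> {}" by blast
  define P where "P = insert R (E ` {..<n})"
  have P: "P \<in> borel_partitions"
    unfolding borel_partitions_def
  proof (intro CollectI conjI)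
    show "finite P" unfolding P_def by simp
    have "E i \<in> sets borel_Omega" if "i < n" for i
      unfolding borel_Omega_iff using sub[OF that] by (simp add: E_def)
    moreover have "R \<in> sets borel_Omega"
      unfolding borel_Omega_iff R_def by (auto simp: E_def)
    ultimately show "P \<subseteq> sets borel_Omega" unfolding P_def by auto
    show "partition_on Omega P"
      unfolding partition_on_def
    proof (intro conjI)
      show "\<Union>P = Omega" unfolding P_def R_def using sub by auto
      show "{} \<notin> P" unfolding P_def using Rne ne by auto
      show "disjoint P"
      proof (rule disjointI)
        have RE: "R \<inter> E i = {}" "E i \<inter> R = {}" if "i < n" for i using that unfolding R_def by auto
        have EE: "E i \<inter> E j = {}" if "E i \<noteq> E j" "i < n" "j < n" for i j
          using disj'[of i j] that by (cases "i = j") auto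
        fix A B assume AB: "A \<in> P" "B \<in> P" "A \<noteq> B"
        consider "A = R" "B = R" | i where "i < n" "A = R" "B = E i" | i where "i < n" "A = E i" "B = R"
          | i j where "i < n" "j < n" "A = E i" "B = E j" using AB unfolding P_def by blast
        then show "A \<inter> B = {}"
          by cases (use AB RE EE in simp_all)
      qed
    qed
  qed
  have "(\<Sum>i<n. \<bar>\<mu> {y i<..y (Suc i)}\<bar>) = (\<Sum>A\<in>E ` {..<n}. \<bar>\<mu> A\<bar>)"
    unfolding sum.reindex[OF inj] by (simp add: E_def)
  also have "\<dots> \<le> (\<Sum>A\<in>P. \<bar>\<mu> A\<bar>)" unfolding P_def by (intro sum_mono2) auto
  also have "\<dots> \<le> total_variation \<mu>" by (rule total_variation_ge[OF J P])
  finally show ?thesis .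
qed

text \<open>The good representative of a function of bounded variation: its increments are the values of
  the derivative on intervals, so they are controlled by the seminorm, and simultaneously by the
  increments of a fixed monotone function \<open>V\<close>.\<close>

lemma BV_representative:
  assumes q: "q \<in> BV_space"
  obtains R V K where "R \<in> borel_measurable borel" "AE t in leb. q t = R t"
    "\<forall>y n. (\<forall>i<n. y i < y (Suc i)) \<longrightarrow> (\<forall>i\<le>n. y i \<in> Omega) \<longrightarrow>
       (\<Sum>i<n. \<bar>R (y (Suc i)) - R (y i)\<bar>) \<le> BV_seminorm q"
    "\<forall>s t. s \<le> t \<longrightarrow> \<bar>R t - R s\<bar> \<le> V t - V s" "\<forall>t. 0 \<le> V t \<and> V t \<le> K"
proof -
  obtain M N c where MN: "decomposes (measure_deriv q) M N"
    and eq: "AE t in leb. q t = c + (distr_fun M t - distr_fun N t)"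
    using measure_deriv_representation[OF BV_measure_deriv[OF q]] by blast
  have fin: "fin_meas M" "fin_meas N" using MN unfolding decomposes_def by auto
  define R where "R = (\<lambda>t. c + (distr_fun M t - distr_fun N t))"
  define V where "V = (\<lambda>t. distr_fun M t + distr_fun N t)"
  have inc: "measure_deriv q {s<..t} = R t - R s" if "s \<in> Omega" "t \<in> Omega" "s \<le> t" for s t
  proof -
    have "measure_deriv q {s<..t} = measure_deriv q ({..t} \<inter> Omega) - measure_deriv q ({..s} \<inter> Omega)"
      using that by (intro signed_measure_Ioc[OF decomposes_signed_measure[OF MN]]) (auto simp: Omega_iff)
    then show ?thesis unfolding R_def decomposes_distr[OF MN] by simp
  qed
  show thesis
  proof (rule that[of R V "measure M Omega + measure N Omega"])
    show "R \<in> borel_measurable borel"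
      unfolding R_def using distr_fun_borel[OF fin(1)] distr_fun_borel[OF fin(2)] by simp
    show "AE t in leb. q t = R t" using eq unfolding R_def .
    show "\<forall>s t. s \<le> t \<longrightarrow> \<bar>R t - R s\<bar> \<le> V t - V s"
    proof (intro allI impI)
      fix s t :: real assume "s \<le> t"
      then show "\<bar>R t - R s\<bar> \<le> V t - V s"
        using distr_fun_mono[OF fin(1), of s t] distr_fun_mono[OF fin(2), of s t]
        unfolding R_def V_def by linarith
    qed
    show "\<forall>t. 0 \<le> V t \<and> V t \<le> measure M Omega + measure N Omega"
      unfolding V_def using distr_fun_le[OF fin(1)] distr_fun_le[OF fin(2)]
      by (auto intro: add_mono simp: distr_fun_nonneg)
    show "\<forall>y n. (\<forall>i<n. y i < y (Suc i)) \<longrightarrow> (\<forall>i\<le>n. y i \<in> Omega) \<longrightarrow>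
       (\<Sum>i<n. \<bar>R (y (Suc i)) - R (y i)\<bar>) \<le> BV_seminorm q"
    proof (intro allI impI)
      fix y :: "nat \<Rightarrow> real" and n
      assume y: "\<forall>i<n. y i < y (Suc i)" "\<forall>i\<le>n. y i \<in> Omega"
      have "(\<Sum>i<n. \<bar>R (y (Suc i)) - R (y i)\<bar>) = (\<Sum>i<n. \<bar>measure_deriv q {y i<..y (Suc i)}\<bar>)"
        using y by (intro sum.cong refl) (simp add: inc less_imp_le)
      also have "\<dots> \<le> BV_seminorm q"
        unfolding BV_seminorm_def by (rule total_variation_increments[OF MN]) (use y in auto)
      finally show "(\<Sum>i<n. \<bar>R (y (Suc i)) - R (y i)\<bar>) \<le> BV_seminorm q" .
    qed
  qed
qed

lemma BV_measurable: "q \<in> BV_space \<Longrightarrow> q \<in> borel_measurable leb"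
  using BV_measure_deriv(1) borel_measurable_integrable by blast

text \<open>Two values differ by at most the seminorm; averaging over one of the two points brings in the
  \<open>L\<^sup>1\<close> norm.\<close>

lemma BV_ess_bounded:
  assumes q: "q \<in> BV_space" shows "ess_bounded q (BV_norm q)"
proof -
  obtain R where R: "R \<in> borel_measurable borel" "AE t in leb. q t = R t"
    "\<forall>y n. (\<forall>i<n. y i < y (Suc i)) \<longrightarrow> (\<forall>i\<le>n. y i \<in> Omega) \<longrightarrow>
       (\<Sum>i<n. \<bar>R (y (Suc i)) - R (y i)\<bar>) \<le> BV_seminorm q"
    by (rule BV_representative[OF q])
  have inc: "\<bar>R t - R s\<bar> \<le> BV_seminorm q" if "s \<in> Omega" "t \<in> Omega" "s < t" for s t
    using R(3)[rule_format, of 1 "\<lambda>i. if i = 0 then s else t"] that by simp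
  have tv0: "0 \<le> BV_seminorm q" using R(3)[rule_format, of 0 "\<lambda>i. 1 / 2"] by (simp add: Omega_iff)
  have dif: "\<bar>R t - R s\<bar> \<le> BV_seminorm q" if "s \<in> Omega" "t \<in> Omega" for s t
    using inc[of s t] inc[of t s] that tv0 by (cases s t rule: linorder_cases) (auto simp: abs_minus_commute)
  have qi: "integrable leb q" by (rule BV_measure_deriv(1)[OF q])
  have Rm: "R \<in> borel_measurable leb" by (rule borel_measurable_leb[OF R(1)])
  have Ri: "integrable leb R"
    using integrable_cong_AE[of q leb R] R(2) qi Rm borel_measurable_integrable[OF qi] by simp
  have bound: "\<bar>R t\<bar> \<le> BV_norm q" if t: "t \<in> Omega" for t
  proof -
    have "(LINT s|leb. \<bar>R t\<bar>) \<le> (LINT s|leb. \<bar>R s\<bar> + BV_seminorm q)"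
    proof (rule integral_mono)
      fix s assume "s \<in> space leb"
      then show "\<bar>R t\<bar> \<le> \<bar>R s\<bar> + BV_seminorm q" using dif[of s t] t by simp
    qed (use Ri in auto)
    also have "\<dots> = (LINT s|leb. \<bar>R s\<bar>) + BV_seminorm q" using Ri by simp
    also have "(LINT s|leb. \<bar>R s\<bar>) = L1_norm q"
      unfolding L1_norm_def
    proof (rule integral_cong_AE)
      show "AE t in leb. \<bar>R t\<bar> = \<bar>q t\<bar>" using R(2) by eventually_elim simp
    qed (use Rm borel_measurable_integrable[OF qi] in auto)
    finally show ?thesis unfolding BV_norm_def by simp
  qed
  show ?thesis
    by (rule ess_bounded_cong_AE[OF ess_bounded_I[OF Rm bound] BV_measurable[OF q] R(2)])
qed

text \<open>Positive combinations of the monotone parts represent the combination, and its derivative is the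
  combination of the derivatives.\<close>

lemma BV_convex:
  assumes p: "p \<in> BV_space" and q: "q \<in> BV_space" and c: "c \<ge> 0" "d \<ge> 0"
  shows "(\<lambda>t. c * p t + d * q t) \<in> BV_space"
    and "BV_seminorm (\<lambda>t. c * p t + d * q t) \<le> c * BV_seminorm p + d * BV_seminorm q"
proof -
  let ?r = "\<lambda>t. c * p t + d * q t"
  obtain M N k where MN: "decomposes (measure_deriv p) M N"
    "AE t in leb. p t = k + (distr_fun M t - distr_fun N t)"
    using measure_deriv_representation[OF BV_measure_deriv[OF p]] by blast
  obtain M' N' k' where MN': "decomposes (measure_deriv q) M' N'"
    "AE t in leb. q t = k' + (distr_fun M' t - distr_fun N' t)"
    using measure_deriv_representation[OF BV_measure_deriv[OF q]] by blast
  have F: "monotone_rc (\<lambda>t. c * distr_fun M t + d * distr_fun M' t)"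
    and G: "monotone_rc (\<lambda>t. c * distr_fun N t + d * distr_fun N' t)"
    using MN(1) MN'(1) c unfolding decomposes_def by (auto intro!: monotone_rc_lincomb distr_fun_monotone_rc)
  have rm: "?r \<in> borel_measurable leb" using BV_measurable[OF p] BV_measurable[OF q] by simp
  have eq: "AE t in leb. ?r t = (c * k + d * k') + ((c * distr_fun M t + d * distr_fun M' t)
      - (c * distr_fun N t + d * distr_fun N' t))"
    using MN(2) MN'(2) by eventually_elim (simp only:, simp add: algebra_simps)
  note H = has_measure_deriv_stieltjes[OF F G rm eq]
  show rBV: "?r \<in> BV_space" unfolding BV_space_def L1_space_def using H(1,3) by blast
  define \<nu> where "\<nu> = (\<lambda>A. c * measure_deriv p A + d * measure_deriv q A)"
  have deriv: "measure_deriv ?r A = \<nu> A" if "A \<in> sets borel_Omega" for A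
  proof (rule measure_deriv_eq[OF rBV _ _ _ that])
    show "signed_measure \<nu>"
      unfolding \<nu>_def by (intro signed_measure_lincomb decomposes_signed_measure[OF MN(1)] decomposes_signed_measure[OF MN'(1)])
    show "continuous (at_right t) (\<lambda>t. \<nu> ({..t} \<inter> Omega))" for t
      unfolding \<nu>_def
      by (intro continuous_intros decomposes_right_continuous[OF MN(1)] decomposes_right_continuous[OF MN'(1)])
    show "AE t in leb. ?r t = (c * k + d * k') + \<nu> ({..t} \<inter> Omega)"
      using eq by eventually_elim
        (simp add: \<nu>_def decomposes_distr[OF MN(1)] decomposes_distr[OF MN'(1)] algebra_simps)
  qed
  show "BV_seminorm ?r \<le> c * BV_seminorm p + d * BV_seminorm q"
    unfolding BV_seminorm_def
  proof (rule total_variation_leI)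
    fix P assume P: "P \<in> borel_partitions"
    have "(\<Sum>E\<in>P. \<bar>measure_deriv ?r E\<bar>) = (\<Sum>E\<in>P. \<bar>\<nu> E\<bar>)"
      using P deriv unfolding borel_partitions_def by (intro sum.cong) auto
    also have "\<dots> \<le> (\<Sum>E\<in>P. c * \<bar>measure_deriv p E\<bar> + d * \<bar>measure_deriv q E\<bar>)"
      unfolding \<nu>_def using c by (intro sum_mono) (metis abs_mult abs_of_nonneg abs_triangle_ineq)
    also have "\<dots> = c * (\<Sum>E\<in>P. \<bar>measure_deriv p E\<bar>) + d * (\<Sum>E\<in>P. \<bar>measure_deriv q E\<bar>)"
      by (simp add: sum.distrib sum_distrib_left)
    also have "\<dots> \<le> c * total_variation (measure_deriv p) + d * total_variation (measure_deriv q)"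
      using total_variation_ge[OF MN(1) P] total_variation_ge[OF MN'(1) P] c
      by (intro add_mono mult_left_mono) auto
    finally show "(\<Sum>E\<in>P. \<bar>measure_deriv ?r E\<bar>) \<le> \<dots>" .
  qed
qed

context mesh
begin

lemma step_monotone_rc:
  assumes "\<And>i. k i \<ge> 0" shows "monotone_rc (\<lambda>t. \<Sum>i\<in>{1..<l}. k i * (if x i \<le> t then 1 else 0))"
  unfolding monotone_rc_def
proof (intro conjI allI impI)
  show "(\<Sum>i\<in>{1..<l}. k i * (if x i \<le> s then 1 else 0)) \<le> (\<Sum>i\<in>{1..<l}. k i * (if x i \<le> t then 1 else 0))"
    if "s \<le> t" for s t using that assms by (intro sum_mono) auto
  have "continuous (at_right t) (\<lambda>t. if y \<le> t then 1 else 0 :: real)" for t y :: real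
  proof (cases "y \<le> t")
    case True
    have "\<forall>\<^sub>F s in at_right t. (1::real) = (if y \<le> s then 1 else 0)"
      using True by (auto simp: eventually_at_filter)
    then show ?thesis using True unfolding continuous_within
      by (auto intro: Lim_transform_eventually[OF tendsto_const])
  next
    case False
    have "\<forall>\<^sub>F s in at_right t. (0::real) = (if y \<le> s then 1 else 0)"
      using False unfolding eventually_at_right_field by (intro exI[of _ y]) auto
    then show ?thesis using False unfolding continuous_within
      by (auto intro: Lim_transform_eventually[OF tendsto_const])
  qed
  then show "continuous (at_right t) (\<lambda>t. \<Sum>i\<in>{1..<l}. k i * (if x i \<le> t then 1 else 0))" for t
    by (intro continuous_intros)
qed

lemma Q_h_values:
  assumes "q \<in> Q_h l x" obtains c where "\<And>i t. i \<in> {1..l} \<Longrightarrow> t \<in> cell i \<Longrightarrow> q t = c i"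
proof -
  have "\<forall>i\<in>{1..l}. \<exists>c. \<forall>t\<in>cell i. q t = c" using assms unfolding Q_h_def cell_def by simp
  then obtain c where "\<forall>i\<in>{1..l}. \<forall>t\<in>cell i. q t = c i" by metis
  then show thesis using that by blast
qed

text \<open>The values at the nodes are arbitrary and have to be inserted explicitly.\<close>

lemma cellwise_constant_measurable:
  fixes q :: "real \<Rightarrow> real"
  assumes c: "\<And>i t. i \<in> {1..l} \<Longrightarrow> t \<in> cell i \<Longrightarrow> q t = c i"
  shows "q \<in> borel_measurable leb"
proof -
  define X where "X = x ` {0..l}"
  have "(\<lambda>t. if t \<in> X then (\<Sum>y\<in>X. q y * indicator {y} t) else step c t) \<in> borel_measurable leb"
  proof (rule borel_measurable_leb)
    have "X \<in> sets borel" unfolding X_def by (intro borel_closed finite_imp_closed) simp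
    then show "(\<lambda>t. if t \<in> X then (\<Sum>y\<in>X. q y * indicator {y} t) else step c t) \<in> borel_measurable borel"
      using step_borel[of c] by (intro measurable_If_set) auto
  qed
  moreover have "q t = (if t \<in> X then (\<Sum>y\<in>X. q y * indicator {y} t) else step c t)" if tO: "t \<in> Omega" for t
  proof (cases "t \<in> X")
    case True
    have "(\<Sum>y\<in>X. q y * indicator {y} t) = (\<Sum>y\<in>X. if y = t then q t else 0)"
      by (intro sum.cong) auto
    then show ?thesis using True unfolding X_def by simp
  next
    case False
    then obtain i where "i \<in> {1..l}" "t \<in> cell i" using cell_cover[OF tO] unfolding X_def by auto
    then show ?thesis using False c by (simp add: step_cell)
  qed
  ultimately show ?thesis using measurable_cong[of leb q] by simp
qed

text \<open>The monotone parts collect the upward and the downward jumps at the interior nodes; their total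
  masses add up to the sum of the absolute jumps.\<close>

lemma Q_h_BV:
  assumes c: "\<And>i t. i \<in> {1..l} \<Longrightarrow> t \<in> cell i \<Longrightarrow> q t = c i"
  shows "q \<in> BV_space" and "BV_seminorm q \<le> (\<Sum>i\<in>{1..<l}. \<bar>c (Suc i) - c i\<bar>)"
proof -
  define F where "F = (\<lambda>t. \<Sum>i\<in>{1..<l}. max 0 (c (Suc i) - c i) * (if x i \<le> t then 1 else 0))"
  define G where "G = (\<lambda>t. \<Sum>i\<in>{1..<l}. max 0 (c i - c (Suc i)) * (if x i \<le> t then 1 else 0))"
  have FG: "monotone_rc F" "monotone_rc G" unfolding F_def G_def by (intro step_monotone_rc; simp)+
  have eq: "AE t in leb. q t = c 1 + (F t - G t)"
    using AE_cell
  proof eventually_elim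
    case (elim t)
    then obtain k where k: "k \<in> {1..l}" "t \<in> cell k" by blast
    have ind: "x i \<le> t \<longleftrightarrow> i < k" if "i \<in> {1..<l}" for i
    proof
      assume "i < k"
      then have "x i \<le> x (k - 1)" using k by (intro x_le) auto
      then show "x i \<le> t" using k(2) unfolding cell_def by simp
    next
      assume *: "x i \<le> t"
      show "i < k"
      proof (rule ccontr)
        assume "\<not> i < k"
        then have "x k \<le> x i" using that by (intro x_le) auto
        then show False using * k(2) unfolding cell_def by simp
      qed
    qed
    have "F t - G t = (\<Sum>i\<in>{1..<l}. if i < k then c (Suc i) - c i else 0)"
      unfolding F_def G_def sum_subtractf[symmetric] by (intro sum.cong refl) (auto simp: ind)
    also have "\<dots> = (\<Sum>i\<in>{1..<k}. c (Suc i) - c i)"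
      using k by (intro sum.mono_neutral_cong_right) auto
    also have "\<dots> = c k - c 1" using k by (intro sum_Suc_diff') auto
    finally show ?case using c[OF k] by simp
  qed
  have qm: "q \<in> borel_measurable leb" by (rule cellwise_constant_measurable[OF c])
  note M = has_measure_deriv_stieltjes[OF FG qm eq]
  show qBV: "q \<in> BV_space" unfolding BV_space_def L1_space_def using M(1,3) by blast
  define \<nu> where "\<nu> = (\<lambda>A. measure (stieltjes F) A - measure (stieltjes G) A)"
  have J: "decomposes \<nu> (stieltjes F) (stieltjes G)" using M(2) unfolding \<nu>_def .
  have deriv: "measure_deriv q A = \<nu> A" if "A \<in> sets borel_Omega" for A
  proof (rule measure_deriv_eq[OF qBV decomposes_signed_measure[OF J] decomposes_right_continuous[OF J] _ that])
    show "AE t in leb. q t = (c 1 + (F 0 - G 0)) + \<nu> ({..t} \<inter> Omega)"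
      using eq AE_space
      by eventually_elim (simp add: decomposes_distr[OF J] stieltjes_distr(3)[OF FG(1)] stieltjes_distr(3)[OF FG(2)])
  qed
  show "BV_seminorm q \<le> (\<Sum>i\<in>{1..<l}. \<bar>c (Suc i) - c i\<bar>)"
    unfolding BV_seminorm_def
  proof (rule total_variation_leI)
    fix P assume P: "P \<in> borel_partitions"
    have "(\<Sum>E\<in>P. \<bar>measure_deriv q E\<bar>) = (\<Sum>E\<in>P. \<bar>\<nu> E\<bar>)"
      using P deriv unfolding borel_partitions_def by (intro sum.cong) auto
    also have "\<dots> \<le> measure (stieltjes F) Omega + measure (stieltjes G) Omega"
      by (rule partition_sum_le[OF J P])
    also have "\<dots> \<le> (F 1 - F 0) + (G 1 - G 0)"
      by (intro add_mono stieltjes_distr(2) FG)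
    also have "\<dots> = (\<Sum>i\<in>{1..<l}. \<bar>c (Suc i) - c i\<bar>)"
    proof -
      have in01: "0 < x i" "x i \<le> 1" if "i \<in> {1..<l}" for i
        using x_less[of 0 i] x_range[of i] x_0 that by auto
      have not0: "\<not> x i \<le> 0" if "i \<in> {1..<l}" for i using in01(1)[OF that] by simp
      have "F 0 = 0" "G 0 = 0" unfolding F_def G_def
        by (rule sum.neutral, rule ballI, subst if_not_P[OF not0], assumption, simp)+
      moreover have "F 1 = (\<Sum>i\<in>{1..<l}. max 0 (c (Suc i) - c i))" "G 1 = (\<Sum>i\<in>{1..<l}. max 0 (c i - c (Suc i)))"
        unfolding F_def G_def using in01 by (auto intro!: sum.cong)
      ultimately show ?thesis by (auto simp: sum.distrib[symmetric] intro!: sum.cong)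
    qed
    finally show "(\<Sum>E\<in>P. \<bar>measure_deriv q E\<bar>) \<le> \<dots>" .
  qed
qed

end

section \<open>Cell averages\<close>

lemma integral_leb_lborel:
  fixes f :: "real \<Rightarrow> real"
  assumes "f \<in> borel_measurable borel"
  shows "(LINT t|leb. f t) = (LINT t|lborel. indicator Omega t * f t)"
proof -
  have "(LINT t|leb. f t) = (LINT t|lebesgue. indicator Omega t * f t)"
    by (subst integral_restrict_space) auto
  also have "\<dots> = (LINT t|lborel. indicator Omega t * f t)"
    by (rule integral_completion)
       (use assms Omega_borel in \<open>auto intro!: borel_measurable_times borel_measurable_indicator simp del: indicator_simps\<close>)
  finally show ?thesis .
qed

context mesh
begin

definition point :: "real \<Rightarrow> nat \<Rightarrow> real" where
  "point \<theta> i = x i + \<theta> * (x (Suc i) - x i)"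

text \<open>The average over the \<open>i\<close>-th cell, as a mean over the points that divide the cells in the
  same ratio \<open>\<theta>\<close>.\<close>

definition average :: "(real \<Rightarrow> real) \<Rightarrow> nat \<Rightarrow> real" where
  "average R i = (LINT \<theta>|leb. R (point \<theta> (i - 1)))"

lemma point_in_cell:
  assumes "\<theta> \<in> Omega" "i < l" shows "point \<theta> i \<in> cell (Suc i)"
proof -
  have w: "x (Suc i) - x i > 0" using width_pos[of "Suc i"] assms by simp
  have "\<theta> * (x (Suc i) - x i) < 1 * (x (Suc i) - x i)"
    using assms w by (intro mult_strict_right_mono) (auto simp: Omega_iff)
  moreover have "0 < \<theta> * (x (Suc i) - x i)" using assms w by (simp add: Omega_iff)
  ultimately show ?thesis
    unfolding point_def cell_def greaterThanLessThan_iff diff_Suc_1 by auto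
qed

lemma integral_cell_average:
  assumes R: "R \<in> borel_measurable borel" and i: "i \<in> {1..l}"
  shows "(LINT t|leb. indicator (cell i) t * R t) = (x i - x (i - 1)) * average R i"
proof -
  let ?w = "x i - x (i - 1)"
  have w: "?w > 0" by (rule width_pos[OF i])
  have R'[measurable]: "R \<in> borel_measurable borel" by fact
  have Om[measurable]: "Omega \<in> sets borel" by simp
  have cm[measurable]: "cell i \<in> sets borel" unfolding cell_def by simp
  have "(LINT t|leb. indicator (cell i) t * R t) = (LINT t|lborel. indicator Omega t * (indicator (cell i) t * R t))"
    by (rule integral_leb_lborel) measurable
  also have "\<dots> = (LINT t|lborel. indicator (cell i) t * R t)"
    using cell_Omega[OF i] by (intro Bochner_Integration.integral_cong) (auto simp: indicator_def)
  also have "\<dots> = \<bar>?w\<bar> *\<^sub>R (LINT \<theta>|lborel. indicator (cell i) (x (i - 1) + ?w * \<theta>) * R (x (i - 1) + ?w * \<theta>))"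
    using w by (intro lborel_integral_real_affine) simp
  also have "\<dots> = ?w * (LINT \<theta>|lborel. indicator Omega \<theta> * R (point \<theta> (i - 1)))"
  proof -
    have "x (i - 1) + ?w * \<theta> \<in> cell i \<longleftrightarrow> \<theta> \<in> Omega" for \<theta>
    proof -
      have "x (i - 1) + ?w * \<theta> < x i \<longleftrightarrow> ?w * \<theta> < ?w * 1" by (simp add: algebra_simps)
      also have "\<dots> \<longleftrightarrow> \<theta> < 1" using w by (simp only: mult_less_cancel_left_pos)
      finally show ?thesis unfolding cell_def Omega_iff using w by (auto simp: zero_less_mult_iff)
    qed
    then have "indicator (cell i) (x (i - 1) + ?w * \<theta>) * R (x (i - 1) + ?w * \<theta>)
        = indicator Omega \<theta> * R (point \<theta> (i - 1))" for \<theta>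
      using i unfolding point_def by (auto simp: indicator_def mult.commute)
    then show ?thesis using w by simp
  qed
  also have "(LINT \<theta>|lborel. indicator Omega \<theta> * R (point \<theta> (i - 1))) = average R i"
    unfolding average_def point_def by (rule integral_leb_lborel[symmetric]) measurable
  finally show ?thesis .
qed

lemma average_close:
  assumes R: "R \<in> borel_measurable borel" and V: "\<forall>s t. s \<le> t \<longrightarrow> \<bar>R t - R s\<bar> \<le> V t - V s"
    and i: "i \<in> {1..l}" and t: "t \<in> cell i"
  shows "\<bar>average R i - R t\<bar> \<le> V (x i) - V (x (i - 1))"
    and "integrable leb (\<lambda>\<theta>. R (point \<theta> (i - 1)))"
proof -
  have mono: "V s \<le> V t" if "s \<le> t" for s t using V that by (metis abs_ge_zero diff_ge_0_iff_ge order_trans)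
  have osc: "\<bar>R s - R t\<bar> \<le> V (x i) - V (x (i - 1))" if s: "s \<in> cell i" for s
  proof -
    have "\<bar>R s - R t\<bar> \<le> V (max s t) - V (min s t)"
      using V[rule_format, of s t] V[rule_format, of t s] by (cases "s \<le> t") (auto simp: abs_minus_commute)
    also have "\<dots> \<le> V (x i) - V (x (i - 1))"
      using s t unfolding cell_def by (intro diff_mono mono) auto
    finally show ?thesis .
  qed
  have b: "\<bar>R (point \<theta> (i - 1)) - R t\<bar> \<le> V (x i) - V (x (i - 1))" if "\<theta> \<in> Omega" for \<theta>
    using osc point_in_cell[OF that, of "i - 1"] i by auto
  have m: "(\<lambda>\<theta>. R (point \<theta> (i - 1))) \<in> borel_measurable leb"
  proof (rule borel_measurable_leb)
    note [measurable] = R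
    show "(\<lambda>\<theta>. R (point \<theta> (i - 1))) \<in> borel_measurable borel" unfolding point_def by measurable
  qed
  have d: "integrable leb (\<lambda>\<theta>. R (point \<theta> (i - 1)) - R t)"
    using m b by (intro integrable_bounded[where M = "V (x i) - V (x (i - 1))"] AE_leb_I) auto
  from Bochner_Integration.integrable_add[OF d, of "\<lambda>_. R t"] show i': "integrable leb (\<lambda>\<theta>. R (point \<theta> (i - 1)))" by simp
  have "average R i - R t = (LINT \<theta>|leb. R (point \<theta> (i - 1)) - R t)"
    unfolding average_def using i' by simp
  then show "\<bar>average R i - R t\<bar> \<le> V (x i) - V (x (i - 1))"
    using integral_leb_bound[OF d AE_leb_I[OF b]] by simp
qed

text \<open>Averaging does not increase the variation: for every ratio \<open>\<theta>\<close> the increments of \<open>R\<close> along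
  the division points are bounded by the seminorm.\<close>

lemma average_variation:
  assumes R: "R \<in> borel_measurable borel" and V: "\<forall>s t. s \<le> t \<longrightarrow> \<bar>R t - R s\<bar> \<le> V t - V s"
    and inc: "\<forall>y n. (\<forall>i<n. y i < y (Suc i)) \<longrightarrow> (\<forall>i\<le>n. y i \<in> Omega) \<longrightarrow>
       (\<Sum>i<n. \<bar>R (y (Suc i)) - R (y i)\<bar>) \<le> TV"
  shows "(\<Sum>i\<in>{1..<l}. \<bar>average R (Suc i) - average R i\<bar>) \<le> TV"
proof -
  have int: "integrable leb (\<lambda>\<theta>. R (point \<theta> i))" if "i < l" for i
  proof -
    have "Suc i \<in> {1..l}" using that by simp
    moreover from this obtain t where "t \<in> cell (Suc i)"
      using dense[OF x_step[of "Suc i"]] unfolding cell_def by auto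
    ultimately show ?thesis using average_close(2)[OF R V, of "Suc i" t] by simp
  qed
  have intd: "integrable leb (\<lambda>\<theta>. \<bar>R (point \<theta> (Suc i)) - R (point \<theta> i)\<bar>)" if "i < l - 1" for i
    using int[of i] int[of "Suc i"] that by auto
  have "(\<Sum>i\<in>{1..<l}. \<bar>average R (Suc i) - average R i\<bar>) = (\<Sum>i<l - 1. \<bar>average R (Suc (Suc i)) - average R (Suc i)\<bar>)"
    using sum.shift_bounds_Suc_ivl[of "\<lambda>i. \<bar>average R (Suc i) - average R i\<bar>" 0 "l - 1"] l_pos
    by (simp add: lessThan_atLeast0)
  also have "\<dots> \<le> (\<Sum>i<l - 1. (LINT \<theta>|leb. \<bar>R (point \<theta> (Suc i)) - R (point \<theta> i)\<bar>))"
  proof (rule sum_mono)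
    fix i assume i: "i \<in> {..<l - 1}"
    then have "average R (Suc (Suc i)) - average R (Suc i) = (LINT \<theta>|leb. R (point \<theta> (Suc i)) - R (point \<theta> i))"
      unfolding average_def using int[of i] int[of "Suc i"] by simp
    then show "\<bar>average R (Suc (Suc i)) - average R (Suc i)\<bar> \<le> (LINT \<theta>|leb. \<bar>R (point \<theta> (Suc i)) - R (point \<theta> i)\<bar>)"
      using integral_norm_bound[of leb "\<lambda>\<theta>. R (point \<theta> (Suc i)) - R (point \<theta> i)"] by simp
  qed
  also have "\<dots> = (LINT \<theta>|leb. (\<Sum>i<l - 1. \<bar>R (point \<theta> (Suc i)) - R (point \<theta> i)\<bar>))"
    using intd by (intro Bochner_Integration.integral_sum[symmetric]) auto
  also have "\<dots> \<le> (LINT \<theta>|leb. TV)"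
  proof (rule integral_mono)
    fix \<theta> assume "\<theta> \<in> space leb"
    then have \<theta>: "\<theta> \<in> Omega" by simp
    have "point \<theta> i < point \<theta> (Suc i)" if "i < l - 1" for i
    proof -
      have "i < l" "Suc i < l" using that by auto
      then show ?thesis
        using point_in_cell[OF \<theta>, of i] point_in_cell[OF \<theta>, of "Suc i"] unfolding cell_def by auto
    qed
    moreover have "point \<theta> i \<in> Omega" if "i \<le> l - 1" for i
      using cell_Omega[OF _ point_in_cell[OF \<theta>, of i]] that l_pos by simp
    ultimately show "(\<Sum>i<l - 1. \<bar>R (point \<theta> (Suc i)) - R (point \<theta> i)\<bar>) \<le> TV"
      using inc[rule_format, of "l - 1" "point \<theta>"] by blast
  qed (use intd in auto)
  also have "\<dots> = TV" by simp
  finally show ?thesis .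
qed

text \<open>The deviation from the averages has mean zero on each cell, so that \<open>z\<close> may be replaced by
  its deviation from a nodal value.  This gains one power of the mesh width; integrating the oscillation
  of \<open>R\<close> over cells gains the other.\<close>

lemma average_pairing:
  assumes R: "R \<in> borel_measurable borel" and V: "\<forall>s t. s \<le> t \<longrightarrow> \<bar>R t - R s\<bar> \<le> V t - V s"
    and K: "\<forall>t. 0 \<le> V t \<and> V t \<le> K" and RB: "ess_bounded R B"
    and z: "\<And>s t. \<bar>z s - z t\<bar> \<le> C * \<bar>s - t\<bar>" and zB: "ess_bounded z Z"
  shows "\<bar>LINT t|leb. (step (average R) t - R t) * z t\<bar> \<le> C * K * h\<^sup>2"
proof -
  have C: "C \<ge> 0" using z[of 1 0] by simp
  have mono: "V s \<le> V t" if "s \<le> t" for s t using V that by (metis abs_ge_zero diff_ge_0_iff_ge order_trans)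
  define f where "f = (\<lambda>i t. indicator (cell i) t * (average R i - R t))"
  have cm: "cell i \<in> sets borel" for i unfolding cell_def by simp
  have indB: "ess_bounded (indicator (cell i)) 1" for i
    by (rule ess_bounded_I[OF borel_measurable_leb[OF borel_measurable_indicator[OF cm]]])
       (simp add: indicator_def)
  have indI: "integrable leb (\<lambda>t. c * indicator (cell i) t)" for c :: real and i
    by (rule ess_bounded_integrable[OF ess_bounded_mult[OF ess_bounded_const indB]])
  have fB: "ess_bounded (f i) (1 * (\<bar>average R i\<bar> + B))" for i
    unfolding f_def by (intro ess_bounded_mult ess_bounded_diff ess_bounded_const RB indB)
  have f0: "(LINT t|leb. f i t) = 0" if i: "i \<in> {1..l}" for i
  proof -
    have 1: "integrable leb (\<lambda>t. average R i * indicator (cell i) t)" by (rule indI)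
    have 2: "integrable leb (\<lambda>t. indicator (cell i) t * R t)"
      by (rule integrable_indicator_mult[OF ess_bounded_integrable[OF RB] cm])
    have "(LINT t|leb. f i t) = (LINT t|leb. average R i * indicator (cell i) t - indicator (cell i) t * R t)"
      unfolding f_def by (intro Bochner_Integration.integral_cong) (auto simp: algebra_simps)
    also have "\<dots> = (LINT t|leb. average R i * indicator (cell i) t) - (LINT t|leb. indicator (cell i) t * R t)"
      by (rule Bochner_Integration.integral_diff[OF 1 2])
    also have "(LINT t|leb. average R i * indicator (cell i) t) = average R i * (x i - x (i - 1))"
      by (simp only: integral_mult_right_zero integral_cell[OF i])
    finally show ?thesis using integral_cell_average[OF R i] by simp
  qed
  have fz: "ess_bounded (\<lambda>t. f i t * z t) ((1 * (\<bar>average R i\<bar> + B)) * Z)" for i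
    by (rule ess_bounded_mult[OF fB zB])
  have bound: "\<bar>LINT t|leb. f i t * z t\<bar> \<le> C * h\<^sup>2 * (V (x i) - V (x (i - 1)))" if i: "i \<in> {1..l}" for i
  proof -
    let ?w = "x i - x (i - 1)" and ?d = "V (x i) - V (x (i - 1))"
    have d0: "?d \<ge> 0" using mono[of "x (i - 1)" "x i"] x_step[OF i] by simp
    have w: "0 < ?w" "?w \<le> h" using width_pos[OF i] width_le[OF i] by auto
    have i1: "integrable leb (\<lambda>t. f i t * z (x i))" using ess_bounded_integrable[OF fB] by simp
    have "(LINT t|leb. f i t * z t) = (LINT t|leb. f i t * z t - f i t * z (x i))"
      using f0[OF i] i1 ess_bounded_integrable[OF fz] by simp
    also have "\<dots> = (LINT t|leb. f i t * (z t - z (x i)))" by (simp add: right_diff_distrib)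
    also have "\<bar>\<dots>\<bar> \<le> (LINT t|leb. \<bar>f i t * (z t - z (x i))\<bar>)"
      using integral_norm_bound[of leb "\<lambda>t. f i t * (z t - z (x i))"] by simp
    also have "\<dots> \<le> (LINT t|leb. (C * h * ?d) * indicator (cell i) t)"
    proof (rule integral_mono)
      show "integrable leb (\<lambda>t. \<bar>f i t * (z t - z (x i))\<bar>)"
        using i1 ess_bounded_integrable[OF fz] by (simp add: right_diff_distrib)
      show "integrable leb (\<lambda>t. (C * h * ?d) * indicator (cell i) t)" by (rule indI)
      fix t
      show "\<bar>f i t * (z t - z (x i))\<bar> \<le> (C * h * ?d) * indicator (cell i) t"
      proof (cases "t \<in> cell i")
        case True
        have "\<bar>z t - z (x i)\<bar> \<le> C * h"
        proof -
          have "\<bar>t - x i\<bar> \<le> h" using True w(2) unfolding cell_def by auto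
          then show ?thesis using z[of t "x i"] C by (meson mult_left_mono order_trans)
        qed
        moreover have "\<bar>average R i - R t\<bar> \<le> ?d" by (rule average_close(1)[OF R V i True])
        ultimately have "\<bar>average R i - R t\<bar> * \<bar>z t - z (x i)\<bar> \<le> ?d * (C * h)"
          using d0 by (intro mult_mono) auto
        then show ?thesis using True by (simp add: f_def abs_mult mult_ac)
      qed (simp add: f_def)
    qed
    also have "\<dots> = (C * h * ?d) * ?w" by (simp only: integral_mult_right_zero integral_cell[OF i])
    also have "\<dots> \<le> (C * h * ?d) * h" using w C d0 h_pos by (intro mult_left_mono) auto
    finally show ?thesis by (simp add: power2_eq_square mult_ac)
  qed
  have "(LINT t|leb. (step (average R) t - R t) * z t) = (LINT t|leb. (\<Sum>i\<in>{1..l}. f i t * z t))"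
  proof (rule integral_cong_AE)
    show "AE t in leb. (step (average R) t - R t) * z t = (\<Sum>i\<in>{1..l}. f i t * z t)"
      using AE_cell
    proof eventually_elim
      case (elim t)
      then obtain k where k: "k \<in> {1..l}" "t \<in> cell k" by blast
      have "(\<Sum>i\<in>{1..l}. f i t * z t) = (\<Sum>i\<in>{1..l}. if i = k then f k t * z t else 0)"
      proof (rule sum.cong[OF refl])
        fix i assume "i \<in> {1..l}"
        then show "f i t * z t = (if i = k then f k t * z t else 0)"
          using cell_unique[of i k t] k unfolding f_def by (cases "t \<in> cell i") auto
      qed
      also have "\<dots> = f k t * z t" using k(1) by simp
      finally show ?case using k by (simp add: f_def step_cell)
    qed
    show "(\<lambda>t. (step (average R) t - R t) * z t) \<in> borel_measurable leb"
      using ess_bounded_measurable[OF step_ess_bounded] ess_bounded_measurable[OF RB] ess_bounded_measurable[OF zB]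
      by simp
    show "(\<lambda>t. \<Sum>i\<in>{1..l}. f i t * z t) \<in> borel_measurable leb"
      using ess_bounded_measurable[OF fz] by (intro borel_measurable_sum)
  qed
  also have "\<dots> = (\<Sum>i\<in>{1..l}. (LINT t|leb. f i t * z t))"
    using ess_bounded_integrable[OF fz] by (intro Bochner_Integration.integral_sum)
  also have "\<bar>\<dots>\<bar> \<le> (\<Sum>i\<in>{1..l}. C * h\<^sup>2 * (V (x i) - V (x (i - 1))))"
    using bound by (intro order_trans[OF sum_abs] sum_mono)
  also have "\<dots> = C * h\<^sup>2 * (V 1 - V 0)"
    unfolding sum_distrib_left[symmetric] sum_widths_telescope[of V] ..
  also have "\<dots> \<le> C * h\<^sup>2 * K"
  proof -
    have "V 1 - V 0 \<le> K" using K[rule_format, of 1] K[rule_format, of 0] by linarith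
    then show ?thesis using C by (intro mult_left_mono) auto
  qed
  finally show ?thesis by (simp add: mult_ac)
qed

lemma Q_h_subset_BV: "Q_h l x \<subseteq> BV_space"
proof
  fix q assume "q \<in> Q_h l x"
  then obtain c where "\<And>i t. i \<in> {1..l} \<Longrightarrow> t \<in> cell i \<Longrightarrow> q t = c i" by (rule Q_h_values) blast
  then show "q \<in> BV_space" by (rule Q_h_BV(1))
qed

lemma Q_h_convex:
  assumes "p \<in> Q_h l x" "q \<in> Q_h l x" shows "(\<lambda>t. c * p t + d * q t) \<in> Q_h l x"
proof -
  have "\<exists>k. \<forall>t\<in>{x (i - 1)<..<x i}. c * p t + d * q t = k" if i: "i \<in> {1..l}" for i
  proof -
    obtain k where "\<forall>t\<in>{x (i - 1)<..<x i}. p t = k" using assms(1) i unfolding Q_h_def by blast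
    moreover obtain m where "\<forall>t\<in>{x (i - 1)<..<x i}. q t = m" using assms(2) i unfolding Q_h_def by blast
    ultimately show ?thesis by (intro exI[of _ "c * k + d * m"]) simp
  qed
  then show ?thesis unfolding Q_h_def by blast
qed

lemma step_Q_h: "step c \<in> Q_h l x"
  unfolding Q_h_def using step_cell[of _ _ c] unfolding cell_def by blast

end

section \<open>Optimality and the error estimate\<close>

context elliptic
begin

lemma is_state_sol_op:
  assumes "\<exists>u. is_state a d0 W q u" shows "is_state a d0 W q (sol_op a d0 W q)"
  unfolding sol_op_def using someI_ex[OF assms] .

text \<open>First order optimality: compare an optimal control with a convex combination and let the
  weight of the competitor tend to zero.\<close>

lemma variational_inequality:
  assumes \<alpha>: "\<alpha> > 0" and ud: "ud \<in> L2_space"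
    and W: "W \<subseteq> H10_space" "\<And>f g c. f \<in> W \<Longrightarrow> g \<in> W \<Longrightarrow> (\<lambda>t. f t + c * g t) \<in> W"
    and U: "U \<subseteq> BV_space"
      "\<And>p q c d. p \<in> U \<Longrightarrow> q \<in> U \<Longrightarrow> c \<ge> 0 \<Longrightarrow> d \<ge> 0 \<Longrightarrow> (\<lambda>t. c * p t + d * q t) \<in> U"
    and ex: "\<And>q. q \<in> BV_space \<Longrightarrow> \<exists>u. is_state a d0 W q u"
    and opt: "optimal_control a d0 ud \<alpha> W U q" and p: "p \<in> U"
  defines "S \<equiv> sol_op a d0 W"
  shows "0 \<le> L2_inner (\<lambda>t. S q t - ud t) (\<lambda>t. S p t - S q t) + \<alpha> * (BV_seminorm p - BV_seminorm q)"
proof -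
  have q: "q \<in> U" using opt unfolding optimal_control_def by simp
  have BV: "p \<in> BV_space" "q \<in> BV_space" using p q U(1) by auto
  have S: "is_state a d0 W r (S r)" if "r \<in> BV_space" for r
    unfolding S_def by (rule is_state_sol_op[OF ex[OF that]])
  have SW: "S r \<in> H10_space" if "r \<in> BV_space" for r using S[OF that] W(1) unfolding is_state_def by auto
  note L = H10_L2[OF SW[OF BV(1)]] H10_L2[OF SW[OF BV(2)]]
  define e where "e = (\<lambda>t. S q t - ud t)"
  define d where "d = (\<lambda>t. S p t - S q t)"
  have eL: "e \<in> L2_space" "d \<in> L2_space" unfolding e_def d_def using L ud by (auto intro: L2.diff_mem)
  let ?X = "L2_inner e d + \<alpha> * (BV_seminorm p - BV_seminorm q)"
  have ineq: "0 \<le> ?X + s / 2 * L2_inner d d" if s: "0 < s" "s \<le> 1" for s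
  proof -
    define r where "r = (\<lambda>t. (1 - s) * q t + s * p t)"
    have rU: "r \<in> U" unfolding r_def using s by (intro U(2) p q) auto
    have rBV: "r \<in> BV_space" using rU U(1) by auto
    have bL: "p \<in> L2_space" "q \<in> L2_space" using BV_ess_bounded[OF BV(1)] BV_ess_bounded[OF BV(2)] ess_bounded_L2 by auto
    have "is_state a d0 W (\<lambda>t. q t + s * (p t + (- 1) * q t)) (\<lambda>t. S q t + s * (S p t + (- 1) * S q t))"
      by (intro is_state_lincomb[OF W] bL L2_lincomb S BV)
    moreover have "(\<lambda>t. q t + s * (p t + (- 1) * q t)) = r" unfolding r_def by (auto simp: algebra_simps)
    ultimately have st: "is_state a d0 W r (\<lambda>t. S q t + s * d t)" unfolding d_def by simp
    have AE: "AE t in leb. S r t = S q t + s * d t"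
    proof (rule is_state_unique[OF W(1) _ S[OF rBV] st])
      show "(\<lambda>t. f t - g t) \<in> W" if "f \<in> W" "g \<in> W" for f g using W(2)[OF that, of "- 1"] by simp
    qed
    have "L2_norm (\<lambda>t. S r t - ud t) = L2_norm (\<lambda>t. e t + s * d t)"
    proof (rule L2_norm_cong_AE)
      show "AE t in leb. S r t - ud t = e t + s * d t" using AE by eventually_elim (simp add: e_def)
    qed (use L2_measurable[OF H10_L2[OF SW[OF rBV]]] L2_measurable[OF ud] eL[THEN L2_measurable] in auto)
    then have sq: "(L2_norm (\<lambda>t. S r t - ud t))\<^sup>2 = L2_inner e e + 2 * s * L2_inner e d + s\<^sup>2 * L2_inner d d"
      using L2.form_square[OF eL] by (simp add: L2_norm_square)
    have tv: "BV_seminorm r \<le> (1 - s) * BV_seminorm q + s * BV_seminorm p"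
      unfolding r_def using s by (intro BV_convex BV) auto
    have "objective a d0 ud \<alpha> W q \<le> objective a d0 ud \<alpha> W r"
      using opt rU unfolding optimal_control_def by blast
    then have "1 / 2 * L2_inner e e + \<alpha> * BV_seminorm q
        \<le> 1 / 2 * (L2_inner e e + 2 * s * L2_inner e d + s\<^sup>2 * L2_inner d d) + \<alpha> * BV_seminorm r"
      unfolding objective_def S_def[symmetric] sq by (simp add: L2_norm_square e_def)
    also have "\<alpha> * BV_seminorm r \<le> \<alpha> * ((1 - s) * BV_seminorm q + s * BV_seminorm p)"
      using tv \<alpha> by (intro mult_left_mono) auto
    finally have "0 \<le> s * (?X + s / 2 * L2_inner d d)"
      by (simp add: algebra_simps power2_eq_square)
    then show ?thesis using s by (simp add: zero_le_mult_iff)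
  qed
  have "0 \<le> ?X"
  proof (rule field_le_epsilon)
    fix \<epsilon> :: real assume \<epsilon>: "\<epsilon> > 0"
    have dd: "0 \<le> L2_inner d d" by (rule L2.form_nonneg[OF eL(2)])
    define s where "s = min 1 (\<epsilon> / (L2_inner d d + 1))"
    have s: "0 < s" "s \<le> 1" unfolding s_def using \<epsilon> dd by auto
    have "s * L2_inner d d \<le> \<epsilon> / (L2_inner d d + 1) * (L2_inner d d + 1)"
      using dd s \<epsilon> by (intro mult_mono) (auto simp: s_def)
    also have "\<dots> = \<epsilon>" using dd by simp
    finally have "s / 2 * L2_inner d d \<le> \<epsilon>" using \<epsilon> by simp
    then show "0 \<le> ?X + \<epsilon>" using ineq[OF s] by linarith
  qed
  then show ?thesis unfolding e_def d_def .
qed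

end

context galerkin
begin

text \<open>Adding the two variational inequalities, tested with the discrete optimal control and with
  the cell averages of the continuous one, leaves only discretization errors paired with bounded
  functions; each of them is of second order.\<close>

lemma optimal_state_error:
  assumes \<alpha>: "\<alpha> > 0" and ud: "ess_bounded ud U"
    and opt: "optimal_control a d0 ud \<alpha> H10_space BV_space q"
    and opth: "optimal_control a d0 ud \<alpha> (V_h l x) (Q_h l x) qh" and C0: "BV_norm qh \<le> C0"
    and R: "R \<in> borel_measurable borel" "AE t in leb. q t = R t"
      "\<forall>y n. (\<forall>i<n. y i < y (Suc i)) \<longrightarrow> (\<forall>i\<le>n. y i \<in> Omega) \<longrightarrow>
         (\<Sum>i<n. \<bar>R (y (Suc i)) - R (y i)\<bar>) \<le> BV_seminorm q"
      "\<forall>s t. s \<le> t \<longrightarrow> \<bar>R t - R s\<bar> \<le> V t - V s" "\<forall>t. 0 \<le> V t \<and> V t \<le> K"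
  shows "(L2_norm (\<lambda>t. sol_op a d0 (V_h l x) qh t - sol_op a d0 H10_space q t))\<^sup>2
    \<le> (fe_const\<^sup>2 * (deriv_const * BV_norm q + U) * C0
       + fe_const\<^sup>2 * (C0 / \<nu> + U) * (BV_norm q + K)
       + deriv_const * (C0 / \<nu> + U) * K) * h\<^sup>2"
proof -
  define S where "S = sol_op a d0 H10_space"
  define Sh where "Sh = sol_op a d0 (V_h l x)"
  have VH: "V_h l x \<subseteq> H10_space" using V_h_H10 by auto
  have exS: "\<exists>u. is_state a d0 H10_space r u" if "r \<in> BV_space" for r
  proof -
    obtain u where "is_state a d0 H10_space r u"
      by (rule state_exists[OF BV_ess_bounded[OF \<open>r \<in> BV_space\<close>]])
    then show ?thesis by blast
  qed
  have exSh: "\<exists>u. is_state a d0 (V_h l x) r u" if "r \<in> BV_space" for r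
    by (rule discrete_state_exists[OF BV_ess_bounded[OF that]])
  have S: "is_state a d0 H10_space r (S r)" "is_state a d0 (V_h l x) r (Sh r)" if "r \<in> BV_space" for r
    unfolding S_def Sh_def using is_state_sol_op exS[OF that] exSh[OF that] by auto
  have H: "S r \<in> H10_space" "Sh r \<in> V_h l x" if "r \<in> BV_space" for r
    using S[OF that] unfolding is_state_def by auto
  have Hh: "Sh r \<in> H10_space" if "r \<in> BV_space" for r using H(2)[OF that] VH by auto
  have qBV: "q \<in> BV_space" using opt unfolding optimal_control_def by simp
  have qhQ: "qh \<in> Q_h l x" using opth unfolding optimal_control_def by simp
  have qhBV: "qh \<in> BV_space" using qhQ Q_h_subset_BV by auto
  define p where "p = step (average R)"
  have pQ: "p \<in> Q_h l x" unfolding p_def by (rule step_Q_h)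
  have pBV: "p \<in> BV_space" using pQ Q_h_subset_BV by auto
  have "BV_seminorm p \<le> (\<Sum>i\<in>{1..<l}. \<bar>average R (Suc i) - average R i\<bar>)"
    unfolding p_def by (rule Q_h_BV(2)) (rule step_cell)
  also have "\<dots> \<le> BV_seminorm q" by (rule average_variation[OF R(1,4,3)])
  finally have tvp: "BV_seminorm p \<le> BV_seminorm q" .
  have qB: "ess_bounded q (BV_norm q)" by (rule BV_ess_bounded[OF qBV])
  have RB: "ess_bounded R (BV_norm q)"
  proof (rule ess_bounded_cong_AE[OF qB borel_measurable_leb[OF R(1)]])
    show "AE t in leb. R t = q t" using R(2) by eventually_elim simp
  qed
  have pB: "ess_bounded p (BV_norm q + K)"
  proof -
    have "AE t in leb. \<bar>R t\<bar> \<le> BV_norm q" using RB unfolding ess_bounded_def by simp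
    then have "AE t in leb. \<bar>p t\<bar> \<le> BV_norm q + K"
      using AE_cell
    proof eventually_elim
      case (elim t)
      then obtain i where i: "i \<in> {1..l}" "t \<in> cell i" by blast
      have "\<bar>average R i - R t\<bar> \<le> V (x i) - V (x (i - 1))" by (rule average_close(1)[OF R(1,4) i])
      also have "\<dots> \<le> K" using R(5)[rule_format, of "x i"] R(5)[rule_format, of "x (i - 1)"] by linarith
      finally show ?case using elim(1) step_cell[OF i] unfolding p_def by simp
    qed
    then show ?thesis unfolding ess_bounded_def p_def
      using ess_bounded_measurable[OF step_ess_bounded] by simp
  qed
  have qhB: "ess_bounded qh C0"
    using BV_ess_bounded[OF qhBV] C0 unfolding ess_bounded_def by (auto elim: eventually_mono)
  let ?u = "S q" and ?uh = "Sh qh"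
  have uB: "ess_bounded ?u (deriv_const * BV_norm q)"
  proof -
    obtain v g where v: "is_state a d0 H10_space q v" "v = prim g" "ess_bounded g (deriv_const * BV_norm q)"
      by (rule state_exists[OF qB])
    have AE: "AE t in leb. ?u t = v t"
      by (rule is_state_unique[OF order_refl energy.diff_mem S(1)[OF qBV] v(1)])
    have "ess_bounded v (deriv_const * BV_norm q)"
      unfolding v(2) by (rule ess_bounded_prim[OF v(3)])
    then show ?thesis
      using AE L2_measurable[OF H10_L2[OF H(1)[OF qBV]]] by (rule_tac ess_bounded_cong_AE)
  qed
  have uhB: "ess_bounded ?uh (C0 / \<nu>)"
  proof -
    have "L2_norm (weak_deriv ?uh) \<le> L2_norm qh / \<nu>"
      by (rule state_deriv_bound[OF VH ess_bounded_L2[OF qhB] S(2)[OF qhBV]])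
    also have "\<dots> \<le> C0 / \<nu>" using ess_bounded_L2_norm[OF qhB] \<nu> by (simp add: divide_right_mono)
    finally show ?thesis
      using V_h_sup_bound[OF H(2)[OF qhBV]] unfolding ess_bounded_def by (auto elim: eventually_mono)
  qed
  define f where "f = (\<lambda>t. ?u t - ud t)"
  define fh where "fh = (\<lambda>t. ?uh t - ud t)"
  have fB: "ess_bounded f (deriv_const * BV_norm q + U)" unfolding f_def by (rule ess_bounded_diff[OF uB ud])
  have fhB: "ess_bounded fh (C0 / \<nu> + U)" unfolding fh_def by (rule ess_bounded_diff[OF uhB ud])
  have udL: "ud \<in> L2_space" by (rule ess_bounded_L2[OF ud])
  have VI: "0 \<le> L2_inner f (\<lambda>t. S qh t - ?u t) + \<alpha> * (BV_seminorm qh - BV_seminorm q)"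
    unfolding f_def S_def
    by (rule variational_inequality[OF \<alpha> udL order_refl H10_lincomb(1) order_refl BV_convex(1) exS opt qhBV])
  have VIh: "0 \<le> L2_inner fh (\<lambda>t. Sh p t - ?uh t) + \<alpha> * (BV_seminorm p - BV_seminorm qh)"
    unfolding fh_def Sh_def
    by (rule variational_inequality[OF \<alpha> udL VH V_h_lincomb Q_h_subset_BV Q_h_convex exSh opth pQ])
  have tv: "\<alpha> * (BV_seminorm p - BV_seminorm qh) \<le> \<alpha> * (BV_seminorm q - BV_seminorm qh)"
    using tvp \<alpha> by (intro mult_left_mono) auto
  have sum: "0 \<le> L2_inner f (\<lambda>t. S qh t - ?u t) + L2_inner fh (\<lambda>t. Sh p t - ?uh t)"
    using VI VIh tv by (simp add: algebra_simps)
  note L = H10_L2[OF H(1)[OF qBV]] H10_L2[OF H(1)[OF qhBV]] H10_L2[OF H(1)[OF pBV]]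
    H10_L2[OF Hh[OF qhBV]] H10_L2[OF Hh[OF pBV]] ess_bounded_L2[OF fB] ess_bounded_L2[OF fhB]
  define w where "w = (\<lambda>t. ?uh t - ?u t)"
  have wL: "w \<in> L2_space" unfolding w_def by (rule L2.diff_mem[OF L(4,1)])
  have "L2_inner w w = L2_inner fh w - L2_inner f w"
  proof -
    have "w = (\<lambda>t. fh t - f t)" unfolding w_def fh_def f_def by simp
    then show ?thesis using L2.form_diff_left[OF L(7,6) wL] by simp
  qed
  also have "\<dots> = L2_inner f (\<lambda>t. S qh t - ?uh t) - L2_inner fh (\<lambda>t. S p t - Sh p t)
      + L2_inner fh (\<lambda>t. S p t - ?u t)
      - (L2_inner f (\<lambda>t. S qh t - ?u t) + L2_inner fh (\<lambda>t. Sh p t - ?uh t))"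
    unfolding w_def using L by (simp add: L2.form_diff_right)
  also have "\<dots> \<le> \<bar>L2_inner f (\<lambda>t. S qh t - ?uh t)\<bar> + \<bar>L2_inner fh (\<lambda>t. S p t - Sh p t)\<bar>
      + \<bar>L2_inner fh (\<lambda>t. S p t - ?u t)\<bar>" using sum by linarith
  also have "\<dots> \<le> fe_const\<^sup>2 * (deriv_const * BV_norm q + U) * C0 * h\<^sup>2
      + fe_const\<^sup>2 * (C0 / \<nu> + U) * (BV_norm q + K) * h\<^sup>2
      + deriv_const * (C0 / \<nu> + U) * K * h\<^sup>2"
  proof (intro add_mono)
    show "\<bar>L2_inner f (\<lambda>t. S qh t - ?uh t)\<bar> \<le> fe_const\<^sup>2 * (deriv_const * BV_norm q + U) * C0 * h\<^sup>2"
      by (rule galerkin_pairing[OF fB qhB S[OF qhBV]])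
    show "\<bar>L2_inner fh (\<lambda>t. S p t - Sh p t)\<bar> \<le> fe_const\<^sup>2 * (C0 / \<nu> + U) * (BV_norm q + K) * h\<^sup>2"
      by (rule galerkin_pairing[OF fhB pB S[OF pBV]])
    obtain z g where z: "is_state a d0 H10_space fh z" "z = prim g"
      and gB: "ess_bounded g (deriv_const * (C0 / \<nu> + U))"
      by (rule state_exists[OF fhB])
    have zH: "z \<in> H10_space" using z(1) unfolding is_state_def by simp
    have zB: "ess_bounded z (deriv_const * (C0 / \<nu> + U))" unfolding z(2) by (rule ess_bounded_prim[OF gB])
    have eH: "(\<lambda>t. S p t - ?u t) \<in> H10_space" by (rule energy.diff_mem[OF H(1)[OF pBV] H(1)[OF qBV]])
    have "L2_inner fh (\<lambda>t. S p t - ?u t) = state_form a d0 (\<lambda>t. S p t - ?u t) z"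
      using z(1) eH energy.form_sym[OF zH eH] unfolding is_state_def by simp
    also have "\<dots> = L2_inner p z - L2_inner q z"
      using energy.form_diff_left[OF H(1)[OF pBV] H(1)[OF qBV] zH] S(1)[OF pBV] S(1)[OF qBV] zH
      unfolding is_state_def by simp
    also have "\<dots> = L2_inner (\<lambda>t. p t - q t) z"
      using L2.form_diff_left[OF ess_bounded_L2[OF pB] ess_bounded_L2[OF qB] H10_L2[OF zH]] by simp
    also have "\<dots> = L2_inner (\<lambda>t. p t - R t) z"
      using R(2) ess_bounded_measurable[OF pB] ess_bounded_measurable[OF qB] ess_bounded_measurable[OF RB]
        ess_bounded_measurable[OF zB]
      by (intro L2_inner_cong_AE) (auto elim: eventually_mono)
    also have "\<bar>\<dots>\<bar> \<le> deriv_const * (C0 / \<nu> + U) * K * h\<^sup>2"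
      unfolding L2_inner_def p_def
    proof (rule average_pairing[OF R(1,4,5) RB _ zB])
      show "\<bar>z s - z t\<bar> \<le> deriv_const * (C0 / \<nu> + U) * \<bar>s - t\<bar>" for s t
        unfolding z(2) by (rule prim_ess_lipschitz[OF gB])
    qed
    finally show "\<bar>L2_inner fh (\<lambda>t. S p t - ?u t)\<bar> \<le> deriv_const * (C0 / \<nu> + U) * K * h\<^sup>2" .
  qed
  finally show ?thesis unfolding L2_norm_square w_def S_def Sh_def by (simp add: distrib_right)
qed

end

theorem lemma4p11:
  fixes \<alpha> \<nu> h0 :: real and a d0 ud qbar :: "real \<Rightarrow> real"
  assumes "\<alpha> > 0"
    and "ud \<in> Linf_space"
    and "\<exists>L. L-lipschitz_on {0..1} a"
    and "\<nu> > 0" and "\<forall>t\<in>{0..1}. \<nu> \<le> a t"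
    and "d0 \<in> Linf_space" and "AE t in leb. 0 \<le> d0 t"
    and "optimal_control a d0 ud \<alpha> H10_space BV_space qbar"
    and "h0 > 0"
    and "\<exists>C0>0. \<forall>l x qh. is_partition l x \<longrightarrow> mesh_width l x \<le> h0 \<longrightarrow>
           optimal_control a d0 ud \<alpha> (V_h l x) (Q_h l x) qh \<longrightarrow> BV_norm qh \<le> C0"
  shows "\<exists>C>0. \<forall>l x qh. is_partition l x \<longrightarrow> mesh_width l x \<le> h0 \<longrightarrow>
           optimal_control a d0 ud \<alpha> (V_h l x) (Q_h l x) qh \<longrightarrow>
           L2_norm (\<lambda>t. sol_op a d0 (V_h l x) qh t - sol_op a d0 H10_space qbar t)
             \<le> C * mesh_width l x"
proof -
  obtain L where L: "L-lipschitz_on {0..1} a" using assms(3) by blast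
  obtain D where d0: "d0 \<in> borel_measurable leb" and D: "AE t in leb. \<bar>d0 t\<bar> \<le> D"
    using assms(6) unfolding Linf_space_def by blast
  interpret elliptic a d0 \<nu> L "\<bar>D\<bar>"
  proof
    show "AE t in leb. d0 t \<le> \<bar>D\<bar>" using D by eventually_elim linarith
  qed (use assms L d0 in auto)
  obtain U where U: "ess_bounded ud U"
    using assms(2) unfolding Linf_space_def ess_bounded_def by blast
  obtain C0 where C0: "\<And>l x qh. is_partition l x \<Longrightarrow> mesh_width l x \<le> h0 \<Longrightarrow>
      optimal_control a d0 ud \<alpha> (V_h l x) (Q_h l x) qh \<Longrightarrow> BV_norm qh \<le> C0"
    using assms(10) by blast
  have "qbar \<in> BV_space" using assms(8) unfolding optimal_control_def by simp
  then obtain R V K where R: "R \<in> borel_measurable borel" "AE t in leb. qbar t = R t"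
      "\<forall>y n. (\<forall>i<n. y i < y (Suc i)) \<longrightarrow> (\<forall>i\<le>n. y i \<in> Omega) \<longrightarrow>
         (\<Sum>i<n. \<bar>R (y (Suc i)) - R (y i)\<bar>) \<le> BV_seminorm qbar"
      "\<forall>s t. s \<le> t \<longrightarrow> \<bar>R t - R s\<bar> \<le> V t - V s" "\<forall>t. 0 \<le> V t \<and> V t \<le> K"
    by (rule BV_representative)
  define Q where "Q = fe_const\<^sup>2 * (deriv_const * BV_norm qbar + U) * C0
       + fe_const\<^sup>2 * (C0 / \<nu> + U) * (BV_norm qbar + K)
       + deriv_const * (C0 / \<nu> + U) * K"
  \<comment> \<open>the absolute value and the summand one make the constant positive whatever the sign of \<open>Q\<close>\<close>
  have "L2_norm (\<lambda>t. sol_op a d0 (V_h l x) qh t - sol_op a d0 H10_space qbar t) \<le> (sqrt \<bar>Q\<bar> + 1) * mesh_width l x"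
    if lx: "is_partition l x" "mesh_width l x \<le> h0" "optimal_control a d0 ud \<alpha> (V_h l x) (Q_h l x) qh" for l x qh
  proof -
    interpret mesh l x by standard (rule lx(1))
    interpret galerkin a d0 \<nu> L "\<bar>D\<bar>" l x ..
    have hh: "h = mesh_width l x" by (rule h_def)
    have "(L2_norm (\<lambda>t. sol_op a d0 (V_h l x) qh t - sol_op a d0 H10_space qbar t))\<^sup>2 \<le> Q * h\<^sup>2"
      unfolding Q_def by (rule optimal_state_error[OF assms(1) U assms(8) lx(3) C0[OF lx] R])
    also have "\<dots> \<le> \<bar>Q\<bar> * h\<^sup>2" by (intro mult_right_mono) auto
    also have "\<dots> = (sqrt \<bar>Q\<bar> * h)\<^sup>2" by (simp add: power_mult_distrib)
    also have "\<dots> \<le> ((sqrt \<bar>Q\<bar> + 1) * h)\<^sup>2" using h_pos by (intro power_mono mult_right_mono) auto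
    finally show ?thesis
      unfolding hh[symmetric] using h_pos by (rule_tac power2_le_imp_le) auto
  qed
  moreover have "sqrt \<bar>Q\<bar> + 1 > 0" by (simp add: add_nonneg_pos)
  ultimately show ?thesis by blast
qed

end
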